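(* Let $u\in C^\infty(I_1)$ and $u\in C^{p-1}(I_2)$, with $u^{(p)}(x)$ absolutely integrable in $I_2$, where $$I_1=(a,a'')\cup(b'',b),\qquad I_2=[a'',b''],\qquad a<a''<b''<b,$$ and assume that $u(x)$ has the asymptotic expansions $$u(x)\sim K(x-a)^{-1}+\sum_{s=0}^\infty c_s(x-a)^{\gamma_s}\quad\text{as } x\to a+,$$ $$u(x)\sim L(b-x)^{-1}+\sum_{s=0}^\infty d_s(b-x)^{\delta_s}\quad\text{as } x\to b-,$$ where the $\gamma_s$ and $\delta_s$ are distinct complex numbers that satisfy $$\gamma_s\ne-1\ \ \forall s;\quad \mathrm{Re}\,\gamma_0\le\mathrm{Re}\,\gamma_1\le\mathrm{Re}\,\gamma_2\le\cdots;\quad \lim_{s\to\infty}\mathrm{Re}\,\gamma_s=+\infty,$$ $$\delta_s\ne-1\ \ \forall s;\quad \mathrm{Re}\,\delta_0\le\mathrm{Re}\,\delta_1\le\mathrm{Re}\,\delta_2\le\cdots;\quad \lim_{s\to\infty}\mathrm{Re}\,\delta_s=+\infty.$$ Assume furthermore that, for each positive integer $k$, $u^{(k)}(x)$ has asymptotic expansions as $x\to a+$ and $x\to b-$ that are obtained by differentiating those of $u(x)$ term by term $k$ times. Let also $h=(b-a)/n$ for $n=1,2,\ldots$. Then, as $h\to0$, $$h\sum_{j=1}^{n-1}u(a+jh)\sim \mathrm{f.p.}\!\int_a^b u(x)\,dx+R_p(h)+K(C-\log h)+\sum_{\substack{s=0\\ \gamma_s\notin\{2,4,6,\ldots\}}}^{\infty}c_s\,\zeta(-\gamma_s)\,h^{\gamma_s+1}$$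 $$\qquad\qquad+L(C-\log h)+\sum_{\substack{s=0\\ \delta_s\notin\{2,4,6,\ldots\}}}^{\infty}d_s\,\zeta(-\delta_s)\,h^{\delta_s+1},$$ where $R_p(h)=O(h^p)$ as $h\to0$ and $C=0.577\cdots$ is Euler's constant. (The constants $K$ and/or $L$ can be zero.)
   Context: $a<b$ are finite real numbers, $p$ is a positive integer, and $\zeta$ is the Riemann zeta function. The expansion $u(x)\sim K(x-a)^{-1}+\sum_{s\ge0}c_s(x-a)^{\gamma_s}$ as $x\to a+$ means: for every $N=0,1,2,\ldots$, $u(x)-K(x-a)^{-1}-\sum_{s=0}^{N-1}c_s(x-a)^{\gamma_s}=O((x-a)^{\mathrm{Re}\,\gamma_N})$ as $x\to a+$; similarly at $b$ and for the derivatives. $\mathrm{f.p.}\!\int_a^b u(x)\,dx$ is the Hadamard Finite Part: expand $\int_{a+\epsilon}^{b-\epsilon}u(x)\,dx$ as $\epsilon\to0+$, which gives a finite combination of non-constant terms $\epsilon^{\gamma_s+1}$, $\epsilon^{\delta_s+1}$ (with $\mathrm{Re}\,\gamma_s\le-1$, $\mathrm{Re}\,\delta_s\le-1$) and $\log\epsilon$, plus a constant, plus $o(1)$; the finite part is that constant. It equals the ordinary integral when the latter exists. The conclusion means: there is a function $R_p(h)=O(h^p)$ such that for every $N$, the left side minus $\mathrm{f.p.}\!\int_a^b u(x)\,dx$, minus $R_p(h)$, minus $(K+L)(C-\log h)$, minus the terms of the two sums with $s<N$, is $O(h^{\mathrm{Re}\,\gamma_N+1})+O(h^{\mathrm{Re}\,\delta_N+1})$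 as $n\to\infty$.
   Formalization: The formal theorem assumes u^(p) absolutely integrable on a slightly larger interval [a''-η, b''+η], η>0, not only on I_2: otherwise u^(p) is uncontrolled as x→a''- or x→b''+ and the claim fails. C^{p-1} on I_2 is read with two-sided derivatives at a'', b''. *)

theory Defs
  imports "HOL-Complex_Analysis.Complex_Analysis" "HOL-Library.Landau_Symbols"
begin

(* The analytic continuation of the Dirichlet series to the plane without 1; the
   junk value at the pole is fixed to 0 only to make the function unique. *)
definition riemann_zeta :: "complex \<Rightarrow> complex" where
  "riemann_zeta = (THE f. f holomorphic_on (- {1}) \<and> f 1 = 0 \<and>
     (\<forall>s. Re s > 1 \<longrightarrow> (\<lambda>n. 1 / (of_nat (Suc n) powr s)) sums f s))"

definition nderiv :: "nat \<Rightarrow> (real \<Rightarrow> complex) \<Rightarrow> real \<Rightarrow> complex" where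
  "nderiv k f = ((\<lambda>g x. vector_derivative g (at x)) ^^ k) f"

(* All derivatives are two-sided, also at boundary points of S. *)
definition Ck_on :: "nat \<Rightarrow> (real \<Rightarrow> complex) \<Rightarrow> real set \<Rightarrow> bool" where
  "Ck_on k f S \<longleftrightarrow>
     (\<forall>j<k. \<forall>x\<in>S. nderiv j f differentiable (at x)) \<and> (\<forall>x\<in>S. isCont (nderiv k f) x)"

definition Cinf_on :: "(real \<Rightarrow> complex) \<Rightarrow> real set \<Rightarrow> bool" where
  "Cinf_on f S \<longleftrightarrow> (\<forall>k. Ck_on k f S)"

(* For q > 0: the q-th derivative is absolutely integrable on [l, r] and the derivative
   of order q - 1 is its indefinite integral.  The second part is automatic if the q-th
   derivative exists everywhere on [l, r]; demanding it instead of that allows the q-th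
   derivative to exist only almost everywhere (its junk values on a null set do not
   affect the integrals), but excludes Cantor-like singular functions. *)
definition abs_integrable_deriv :: "nat \<Rightarrow> (real \<Rightarrow> complex) \<Rightarrow> real \<Rightarrow> real \<Rightarrow> bool" where
  "abs_integrable_deriv q f l r \<longleftrightarrow>
     nderiv q f absolutely_integrable_on {l..r} \<and>
     (\<forall>x\<in>{l..r}. nderiv (q - 1) f x - nderiv (q - 1) f l = integral {l..x} (nderiv q f))"

(* f(x) ~ K (x-a)^(-1) + sum_s c_s (x-a)^(gamma_s) as x -> a+, differentiated term by
   term k times; k = 0 is the expansion of f itself. *)
definition expansion_left ::
  "nat \<Rightarrow> (real \<Rightarrow> complex) \<Rightarrow> real \<Rightarrow> complex \<Rightarrow> (nat \<Rightarrow> complex) \<Rightarrow> (nat \<Rightarrow> complex) \<Rightarrow> bool" where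
  "expansion_left k f a K c \<gamma> \<longleftrightarrow>
     (\<forall>N. (\<lambda>x. norm (nderiv k f x
              - nderiv k (\<lambda>y. K / of_real (y - a)) x
              - (\<Sum>s<N. nderiv k (\<lambda>y. c s * of_real (y - a) powr \<gamma> s) x)))
          \<in> O[at_right a](\<lambda>x. (x - a) powr (Re (\<gamma> N) - real k)))"

definition expansion_right ::
  "nat \<Rightarrow> (real \<Rightarrow> complex) \<Rightarrow> real \<Rightarrow> complex \<Rightarrow> (nat \<Rightarrow> complex) \<Rightarrow> (nat \<Rightarrow> complex) \<Rightarrow> bool" where
  "expansion_right k f b L d \<delta> \<longleftrightarrow>
     (\<forall>N. (\<lambda>x. norm (nderiv k f x
              - nderiv k (\<lambda>y. L / of_real (b - y)) x
              - (\<Sum>s<N. nderiv k (\<lambda>y. d s * of_real (b - y) powr \<delta> s) x)))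
          \<in> O[at_left b](\<lambda>x. (b - x) powr (Re (\<delta> N) - real k)))"

(* The exponents z in Z play the role of gamma_s + 1 and delta_s + 1 with nonpositive real
   part; 0 is excluded since it would be a constant term.  Oscillating terms (Re z = 0,
   Im z \<noteq> 0) do not contribute to the constant. *)
definition has_finite_part :: "(real \<Rightarrow> complex) \<Rightarrow> real \<Rightarrow> real \<Rightarrow> complex \<Rightarrow> bool" where
  "has_finite_part f a b I \<longleftrightarrow>
     (\<exists>Z A B. finite Z \<and> (\<forall>z\<in>Z. Re z \<le> 0 \<and> z \<noteq> 0) \<and>
        ((\<lambda>\<epsilon>. integral {a + \<epsilon>..b - \<epsilon>} f
              - (\<Sum>z\<in>Z. A z * of_real \<epsilon> powr z) - B * of_real (ln \<epsilon>)) \<longlongrightarrow> I) (at_right 0))"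

definition finite_part :: "(real \<Rightarrow> complex) \<Rightarrow> real \<Rightarrow> real \<Rightarrow> complex" where
  "finite_part f a b = (THE I. has_finite_part f a b I)"

definition positive_even :: "complex set" where
  "positive_even = {of_nat (2 * m) | m. m \<ge> 1}"

end

theory Submission
  imports Defs
begin

text \<open>Euler-Maclaurin summation is applied to \<open>w = u - S - T\<close>, where \<open>S\<close> and \<open>T\<close> are the first
  \<open>N\<close> terms of the two expansions.  If \<open>N\<close> is large, the derivatives of \<open>w\<close> up to order \<open>p - 1\<close>
  tend to those of \<open>- T\<close> at \<open>a\<close> and to those of \<open>- S\<close> at \<open>b\<close>, and the last one has bounded
  variation, so the remainder is $O(h^p)$.  For a single power the Riemann sum is
  $h^{\gamma+1} \sum_{j<n} j^\gamma$, and Euler-Maclaurin on the cells $[n,n+1]$ gives its expansion, with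
  constant term $\zeta(-\gamma)$; the same estimate continues the Dirichlet series analytically.
  The endpoint terms of \<open>S\<close>, \<open>T\<close> and \<open>w\<close> cancel, so the claim holds up to $O(h^p)$ for one large
  \<open>N\<close>.  Consecutive truncations differ by terms of the order allowed, so a diagonal choice of the
  truncation turns these errors into one function \<open>R\<close>.\<close>

section \<open>Bernoulli polynomials and Euler-Maclaurin summation on a cell\<close>

text \<open>The obstacle is the low regularity of \<open>u\<close> in the middle: only p - 1
  continuous derivatives are available there, so a remainder integral with a continuous p-th
  derivative is out of reach. The cell formula is therefore run with q = p - 1 derivatives, and its
  error is measured by the increment of the q-th one; the increments add up to a total variation,
  and the spacing supplies h^(q + 1) = h^p. Both singular parts are subtracted at once because
  \<open>S\<close> is smooth at \<open>b\<close> and \<open>T\<close> at \<open>a\<close>: each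
  leaves only a boundary value at the far endpoint, and \<open>w\<close> becomes continuous on all
  of [a, b]. For a power x^z the cell error carries an explicit falling factorial, which serves both
  local uniformity in z (analytic continuation) and exactness for polynomials (trivial zeros). The
  two series need not converge, so no limit over truncations can define \<open>R\<close>; the
  differences of truncations are bounded with constants independent of the later truncation, as the
  diagonal choice requires.\<close>

lemma pderiv_sum: "pderiv (sum f A) = (\<Sum>i\<in>A. pderiv (f i))"
  by (induction A rule: infinite_finite_induct) (auto simp: pderiv_add)

text \<open>An antiderivative is written down coefficientwise and its mean subtracted. This supplies
  the witness for the choice that defines the Bernoulli polynomials; the mean-zero condition fixes
  the constant of integration.\<close>

lemma poly_antiderivative_mean_zero:
  fixes p :: "real poly"
  shows "\<exists>q. pderiv q = p \<and> integral {0..1} (poly q) = 0"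
proof -
  define q where "q = (\<Sum>i\<le>degree p. monom (coeff p i / real (Suc i)) (Suc i))"
  have "pderiv q = (\<Sum>i\<le>degree p. monom (coeff p i) i)"
    unfolding q_def by (simp add: pderiv_sum pderiv_monom del: of_nat_Suc)
  then have q: "pderiv q = p" by (simp add: poly_as_sum_of_monoms)
  define m where "m = integral {0..1} (poly q)"
  have "integral {0..1} (poly (q - [:m:])) = integral {0..1} (\<lambda>x. poly q x - m)"
    by (rule Henstock_Kurzweil_Integration.integral_cong) simp
  also have "\<dots> = m - m"
    unfolding m_def
    by (subst integral_diff) (auto intro!: integrable_continuous_real continuous_intros)
  finally have "integral {0..1} (poly (q - [:m:])) = 0" by simp
  then show ?thesis using q by (intro exI[of _ "q - [:m:]"]) (simp add: pderiv_diff pderiv_pCons)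
qed

text \<open>\<open>bpoly k\<close> is the Bernoulli polynomial $B_k(x)/k!$.\<close>

primrec bpoly :: "nat \<Rightarrow> real poly" where
  "bpoly 0 = 1"
| "bpoly (Suc k) = (SOME q. pderiv q = bpoly k \<and> integral {0..1} (poly q) = 0)"

lemma pderiv_bpoly_Suc: "pderiv (bpoly (Suc k)) = bpoly k"
  and integral_bpoly_Suc: "integral {0..1} (poly (bpoly (Suc k))) = 0"
  using someI_ex[OF poly_antiderivative_mean_zero[of "bpoly k"]] by auto

declare bpoly.simps(2)[simp del]

lemma bpoly_has_derivative:
  "(poly (bpoly (Suc k)) has_vector_derivative poly (bpoly k) x) (at x within A)"
  using poly_DERIV[of "bpoly (Suc k)" x]
  by (auto simp: pderiv_bpoly_Suc has_real_derivative_iff_has_vector_derivative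
      intro: has_vector_derivative_at_within)

lemma bpoly_reflect_DERIV:
  "((\<lambda>x. poly (bpoly (Suc k)) (1 - x)) has_real_derivative - poly (bpoly k) (1 - x)) (at x)"
proof -
  have "((\<lambda>x. 1 - x) has_real_derivative - 1) (at x)"
    by (auto intro!: derivative_eq_intros)
  from DERIV_chain'[OF this poly_DERIV[of "bpoly (Suc k)" "1 - x"]] show ?thesis
    by (simp add: pderiv_bpoly_Suc)
qed

lemma bpoly_has_integral:
  "(poly (bpoly k) has_integral (poly (bpoly (Suc k)) 1 - poly (bpoly (Suc k)) 0)) {0..1}"
  by (rule fundamental_theorem_of_calculus) (auto intro: bpoly_has_derivative)

text \<open>The jump of the antiderivative is the integral of \<open>bpoly k\<close>, which is 1 for
  the constant polynomial and 0 afterwards by the normalisation. On a grid this is why function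
  values, and no derivatives, survive at interior nodes.\<close>

lemma bpoly_jump: "poly (bpoly (Suc k)) 1 - poly (bpoly (Suc k)) 0 = (if k = 0 then 1 else 0)"
proof (cases k)
  case 0
  have "integral {0..1} (poly (bpoly 0)) = integral {0..1} (\<lambda>x::real. 1::real)"
    by (rule Henstock_Kurzweil_Integration.integral_cong) simp
  then show ?thesis using integral_unique[OF bpoly_has_integral[of k]] 0 by simp
next
  case (Suc j)
  then show ?thesis
    using integral_unique[OF bpoly_has_integral[of k]] integral_bpoly_Suc[of j] by simp
qed

text \<open>By the induction hypothesis the difference \<open>D\<close> of the two sides has
  derivative 0 on (0, 1), so it is constant on [0, 1]; the constant is 0 because both sides have
  mean 0.\<close>

lemma bpoly_reflect: "0 \<le> x \<Longrightarrow> x \<le> 1 \<Longrightarrow> poly (bpoly k) (1 - x) = (-1) ^ k * poly (bpoly k) x"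
proof (induction k arbitrary: x)
  case 0
  then show ?case by simp
next
  case (Suc k)
  define D where "D = (\<lambda>x. poly (bpoly (Suc k)) (1 - x) - (-1) ^ Suc k * poly (bpoly (Suc k)) x)"
  have der: "(D has_real_derivative (- poly (bpoly k) (1 - x) - (-1) ^ Suc k * poly (bpoly k) x)) (at x)" for x
    unfolding D_def using poly_DERIV[of "bpoly (Suc k)" x]
    by (intro DERIV_diff bpoly_reflect_DERIV DERIV_cmult) (simp add: pderiv_bpoly_Suc)
  have const: "D x = D 0" if "0 \<le> x" "x \<le> 1" for x
  proof (cases "x = 0")
    case False
    show ?thesis
    proof (intro DERIV_isconst2[of 0 1 D x] )
      show "continuous_on {0..1} D" unfolding D_def by (intro continuous_intros)
      show "(D has_real_derivative 0) (at x)" if "0 < x" "x < 1" for x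
        using der[of x] Suc.IH[of x] that by simp
    qed (use that in auto)
  qed auto
  have "integral {0..1} D = integral {0..1} (\<lambda>x::real. D 0)"
    by (rule Henstock_Kurzweil_Integration.integral_cong) (auto intro: const)
  moreover have "integral {0..1} (\<lambda>x. poly (bpoly (Suc k)) (1 - x)) = 0"
  proof -
    have "((\<lambda>x. poly (bpoly (Suc k)) (1 - x)) has_integral
        (- poly (bpoly (Suc (Suc k))) (1 - 1) - - poly (bpoly (Suc (Suc k))) (1 - 0))) {0..1}"
    proof (rule fundamental_theorem_of_calculus)
      fix x :: real
      have "((\<lambda>x. - poly (bpoly (Suc (Suc k))) (1 - x)) has_real_derivative
          poly (bpoly (Suc k)) (1 - x)) (at x)"
        using DERIV_minus[OF bpoly_reflect_DERIV[of "Suc k" x]] by simp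
      then show "((\<lambda>x. - poly (bpoly (Suc (Suc k))) (1 - x)) has_vector_derivative
          poly (bpoly (Suc k)) (1 - x)) (at x within {0..1})"
        by (simp add: has_real_derivative_iff_has_vector_derivative has_vector_derivative_at_within)
    qed simp
    then show ?thesis using bpoly_jump[of "Suc k"] by (simp add: integral_unique)
  qed
  moreover have "integral {0..1} D = integral {0..1} (\<lambda>x. poly (bpoly (Suc k)) (1 - x)) -
      integral {0..1} (\<lambda>x. (-1) ^ Suc k * poly (bpoly (Suc k)) x)"
    unfolding D_def
    by (rule integral_diff) (auto intro!: integrable_continuous_real continuous_intros)
  ultimately have "D 0 = 0" using integral_bpoly_Suc[of k] by simp
  then show ?case using const[OF Suc.prems] by (simp add: D_def)
qed

text \<open>On a cell of length \<open>h\<close>, \<open>h ^ (k + 1) * em_right k\<close> multiplies the \<open>k\<close>-th derivative at the right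
  endpoint and \<open>- h ^ (k + 1) * em_left k\<close> the one at the left endpoint.\<close>

definition em_right :: "nat \<Rightarrow> real" where
  "em_right k = (-1) ^ k * poly (bpoly (Suc k)) 1"

definition em_left :: "nat \<Rightarrow> real" where
  "em_left k = (-1) ^ k * poly (bpoly (Suc k)) 0"

lemma em_right_eq: "em_right k = em_left k + (if k = 0 then 1 else 0)"
  using bpoly_jump[of k] by (auto simp: em_right_def em_left_def algebra_simps)

lemma em_left_reflect: "em_left k = - ((-1) ^ k * em_right k)"
  using bpoly_reflect[of 1 "Suc k"] by (simp add: em_right_def em_left_def)

text \<open>These are the Bernoulli numbers of odd index at least 3, up to a factor: reflection
  gives \<open>em_left k = - em_right k\<close>, while the jump is 0, so the value equals its own
  negative.\<close>

lemma em_left_even: "even k \<Longrightarrow> k > 0 \<Longrightarrow> em_left k = 0"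
  using em_left_reflect[of k] em_right_eq[of k] by simp

text \<open>Each step is one integration by parts against \<open>bpoly (Suc q)\<close>.
  Differentiability is asked in the open interval only, to suit functions whose derivatives merely
  extend continuously to an endpoint.\<close>

lemma euler_maclaurin_unit:
  fixes g :: "nat \<Rightarrow> real \<Rightarrow> complex"
  assumes "\<And>k. k \<le> q \<Longrightarrow> continuous_on {0..1} (g k)"
    and "\<And>k x. k < q \<Longrightarrow> 0 < x \<Longrightarrow> x < 1 \<Longrightarrow> (g k has_vector_derivative g (Suc k) x) (at x)"
  shows "integral {0..1} (g 0) =
      (\<Sum>k<q. em_right k *\<^sub>R g k 1 - em_left k *\<^sub>R g k 0)
      + (-1) ^ q *\<^sub>R integral {0..1} (\<lambda>x. poly (bpoly q) x *\<^sub>R g q x)"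
  using assms
proof (induction q)
  case 0
  then show ?case by simp
next
  case (Suc q)
  let ?P = "\<lambda>k. poly (bpoly k)"
  have "integral {0..1} (g 0) = (\<Sum>k<q. em_right k *\<^sub>R g k 1 - em_left k *\<^sub>R g k 0)
      + (-1) ^ q *\<^sub>R integral {0..1} (\<lambda>x. ?P q x *\<^sub>R g q x)"
    using Suc.prems by (intro Suc.IH) auto
  moreover have "((\<lambda>x. ?P q x *\<^sub>R g q x) has_integral
     (?P (Suc q) 1 *\<^sub>R g q 1 - ?P (Suc q) 0 *\<^sub>R g q 0
       - integral {0..1} (\<lambda>x. ?P (Suc q) x *\<^sub>R g (Suc q) x))) {0..1}"
  proof (rule integration_by_parts_interior[OF bounded_bilinear_scaleR, of 0 1 "?P (Suc q)" "g q" _ "g (Suc q)"])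
    have "(\<lambda>x. ?P (Suc q) x *\<^sub>R g (Suc q) x) integrable_on {0..1}"
      using Suc.prems(1)[of "Suc q"] by (intro integrable_continuous_real continuous_intros) auto
    then show "((\<lambda>x. ?P (Suc q) x *\<^sub>R g (Suc q) x) has_integral
      (?P (Suc q) 1 *\<^sub>R g q 1 - ?P (Suc q) 0 *\<^sub>R g q 0 -
       (?P (Suc q) 1 *\<^sub>R g q 1 - ?P (Suc q) 0 *\<^sub>R g q 0
       - integral {0..1} (\<lambda>x. ?P (Suc q) x *\<^sub>R g (Suc q) x)))) {0..1}"
      by (simp add: integrable_integral)
    show "continuous_on {0..1} (?P (Suc q))" by (intro continuous_intros)
    show "continuous_on {0..1} (g q)" using Suc.prems(1)[of q] by simp
    show "(?P (Suc q) has_vector_derivative ?P q x) (at x)" for x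
      by (rule bpoly_has_derivative)
    show "(g q has_vector_derivative g (Suc q) x) (at x)" if "x \<in> {0<..<1}" for x
      using Suc.prems(2)[of q x] that by simp
  qed simp
  ultimately show ?case
    by (simp add: integral_unique em_right_def em_left_def scaleR_diff_right)
qed

text \<open>A constant \<open>g q\<close> makes the two sides agree, hence only the variation of \<open>g q\<close> matters and
  no further derivative is needed.\<close>

lemma euler_maclaurin_unit_bound:
  "\<exists>C\<ge>0. \<forall>(g :: nat \<Rightarrow> real \<Rightarrow> complex) B.
     (\<forall>k\<le>q. continuous_on {0..1} (g k)) \<longrightarrow>
     (\<forall>k<q. \<forall>x. 0 < x \<and> x < 1 \<longrightarrow> (g k has_vector_derivative g (Suc k) x) (at x)) \<longrightarrow>
     (\<forall>x\<in>{0..1}. norm (g q x - g q 0) \<le> B) \<longrightarrow>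
     norm (integral {0..1} (g 0) - (\<Sum>k\<le>q. em_right k *\<^sub>R g k 1 - em_left k *\<^sub>R g k 0)) \<le> C * B"
proof -
  let ?P = "\<lambda>k. poly (bpoly k)"
  have "compact (?P q ` {0..1})"
    by (intro compact_continuous_image continuous_intros) auto
  then have "bounded (?P q ` {0..1})" by (rule compact_imp_bounded)
  then obtain M where M: "\<And>x. x \<in> {0..1} \<Longrightarrow> \<bar>?P q x\<bar> \<le> M" "M > 0"
    unfolding bounded_pos by (metis image_eqI real_norm_def)
  \<comment> \<open>\<open>M\<close> controls the kernel of the integral; the second summand is for
    the boundary term that remains once the constant \<open>g q 0\<close> is split off.\<close>
  define C where "C = M + \<bar>?P (Suc q) 1\<bar>"
  show ?thesis
  proof (intro exI[of _ C] conjI allI impI)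
    show "0 \<le> C" using M by (simp add: C_def)
    fix g :: "nat \<Rightarrow> real \<Rightarrow> complex" and B :: real
    assume c: "\<forall>k\<le>q. continuous_on {0..1} (g k)"
      and d: "\<forall>k<q. \<forall>x. 0 < x \<and> x < 1 \<longrightarrow> (g k has_vector_derivative g (Suc k) x) (at x)"
      and B: "\<forall>x\<in>{0..1}. norm (g q x - g q 0) \<le> B"
    have eq: "integral {0..1} (g 0) = (\<Sum>k<q. em_right k *\<^sub>R g k 1 - em_left k *\<^sub>R g k 0)
      + (-1) ^ q *\<^sub>R integral {0..1} (\<lambda>x. ?P q x *\<^sub>R g q x)"
      using c d by (intro euler_maclaurin_unit) auto
    have i1: "(\<lambda>x. ?P q x *\<^sub>R (g q x - g q 0)) integrable_on {0..1}"
      using c by (intro integrable_continuous_real continuous_intros) auto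
    have i2: "((\<lambda>x. ?P q x *\<^sub>R g q 0) has_integral (?P (Suc q) 1 - ?P (Suc q) 0) *\<^sub>R g q 0) {0..1}"
      by (intro has_integral_scaleR_left bpoly_has_integral)
    have "integral {0..1} (\<lambda>x. ?P q x *\<^sub>R g q x)
       = integral {0..1} (\<lambda>x. ?P q x *\<^sub>R (g q x - g q 0) + ?P q x *\<^sub>R g q 0)"
      by (simp add: algebra_simps)
    also have "\<dots> = integral {0..1} (\<lambda>x. ?P q x *\<^sub>R (g q x - g q 0))
        + (?P (Suc q) 1 - ?P (Suc q) 0) *\<^sub>R g q 0"
      using i1 i2 by (subst integral_add) (auto simp: integral_unique has_integral_integrable)
    finally have split: "integral {0..1} (\<lambda>x. ?P q x *\<^sub>R g q x)
       = integral {0..1} (\<lambda>x. ?P q x *\<^sub>R (g q x - g q 0))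
        + (?P (Suc q) 1 - ?P (Suc q) 0) *\<^sub>R g q 0" .
    \<comment> \<open>The integral of the constant part and the summand \<open>k = q\<close>
      combine, so that only increments of \<open>g q\<close> remain.\<close>
    have "integral {0..1} (g 0) - (\<Sum>k\<le>q. em_right k *\<^sub>R g k 1 - em_left k *\<^sub>R g k 0)
      = (-1) ^ q *\<^sub>R (integral {0..1} (\<lambda>x. ?P q x *\<^sub>R (g q x - g q 0))
           - ?P (Suc q) 1 *\<^sub>R (g q 1 - g q 0))"
      unfolding eq split
      by (simp add: lessThan_Suc_atMost[symmetric] em_right_def em_left_def
          scaleR_add_right scaleR_diff_right scaleR_diff_left)
    also have "norm \<dots> = norm (integral {0..1} (\<lambda>x. ?P q x *\<^sub>R (g q x - g q 0))
           - ?P (Suc q) 1 *\<^sub>R (g q 1 - g q 0))" by simp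
    also have "\<dots> \<le> norm (integral {0..1} (\<lambda>x. ?P q x *\<^sub>R (g q x - g q 0)))
        + norm (?P (Suc q) 1 *\<^sub>R (g q 1 - g q 0))" by (rule norm_triangle_ineq4)
    also have "\<dots> \<le> M * B + \<bar>?P (Suc q) 1\<bar> * B"
    proof (rule add_mono)
      have "norm (integral {0..1} (\<lambda>x. ?P q x *\<^sub>R (g q x - g q 0))) \<le> integral {0..1} (\<lambda>x::real. M * B)"
        using M B by (intro integral_norm_bound_integral[OF i1]) (auto intro!: mult_mono)
      then show "norm (integral {0..1} (\<lambda>x. ?P q x *\<^sub>R (g q x - g q 0))) \<le> M * B" by simp
      show "norm (?P (Suc q) 1 *\<^sub>R (g q 1 - g q 0)) \<le> \<bar>?P (Suc q) 1\<bar> * B"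
        using B by (auto intro: mult_left_mono)
    qed
    finally show "norm (integral {0..1} (g 0) - (\<Sum>k\<le>q. em_right k *\<^sub>R g k 1 - em_left k *\<^sub>R g k 0)) \<le> C * B"
      by (simp add: C_def algebra_simps)
  qed
qed

text \<open>Substitution of h t + l for x: in \<open>h ^ Suc q\<close>, \<open>q\<close> factors
  come from the q-th derivative and one from the integral. The constant depends on \<open>q\<close>
  alone, so that errors can be added over many cells and estimated uniformly in the exponent of a
  power.\<close>

lemma euler_maclaurin_cell:
  "\<exists>C\<ge>0. \<forall>(w :: nat \<Rightarrow> real \<Rightarrow> complex) l h B. 0 < h \<longrightarrow>
     (\<forall>k\<le>q. continuous_on {l..l+h} (w k)) \<longrightarrow>
     (\<forall>k<q. \<forall>x. l < x \<and> x < l + h \<longrightarrow> (w k has_vector_derivative w (Suc k) x) (at x)) \<longrightarrow>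
     (\<forall>x\<in>{l..l+h}. norm (w q x - w q l) \<le> B) \<longrightarrow>
     norm (integral {l..l+h} (w 0)
        - (\<Sum>k\<le>q. h ^ Suc k *\<^sub>R (em_right k *\<^sub>R w k (l + h) - em_left k *\<^sub>R w k l))) \<le> C * h ^ Suc q * B"
proof -
  obtain C where C: "C \<ge> 0" and CB: "\<forall>(g :: nat \<Rightarrow> real \<Rightarrow> complex) B.
     (\<forall>k\<le>q. continuous_on {0..1} (g k)) \<longrightarrow>
     (\<forall>k<q. \<forall>x. 0 < x \<and> x < 1 \<longrightarrow> (g k has_vector_derivative g (Suc k) x) (at x)) \<longrightarrow>
     (\<forall>x\<in>{0..1}. norm (g q x - g q 0) \<le> B) \<longrightarrow>
     norm (integral {0..1} (g 0) - (\<Sum>k\<le>q. em_right k *\<^sub>R g k 1 - em_left k *\<^sub>R g k 0)) \<le> C * B"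
    using euler_maclaurin_unit_bound[of q] by blast
  show ?thesis
  proof (intro exI[of _ C] conjI allI impI)
    show "0 \<le> C" by fact
    fix w :: "nat \<Rightarrow> real \<Rightarrow> complex" and l h B :: real
    assume h: "0 < h" and c: "\<forall>k\<le>q. continuous_on {l..l+h} (w k)"
      and d: "\<forall>k<q. \<forall>x. l < x \<and> x < l + h \<longrightarrow> (w k has_vector_derivative w (Suc k) x) (at x)"
      and B: "\<forall>x\<in>{l..l+h}. norm (w q x - w q l) \<le> B"
    define g where "g = (\<lambda>k t. h ^ k *\<^sub>R w k (h * t + l))"
    have mem: "h * t + l \<in> {l..l+h}" if "t \<in> {0..1}" for t
      using that h by (auto simp: mult_le_cancel_left1)
    have gbound: "norm (integral {0..1} (g 0) - (\<Sum>k\<le>q. em_right k *\<^sub>R g k 1 - em_left k *\<^sub>R g k 0)) \<le> C * (h ^ q * B)"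
    proof (rule CB[rule_format])
      fix k assume "k \<le> q"
      then have "continuous_on {l..l+h} (w k)" using c by blast
      then have "continuous_on {0..1} (\<lambda>t. w k (h * t + l))"
        by (rule continuous_on_compose2) (use mem in \<open>auto intro!: continuous_intros\<close>)
      then show "continuous_on {0..1} (g k)" unfolding g_def
        by (rule continuous_on_scaleR[OF continuous_on_const])
    next
      fix k and x :: real assume k: "k < q" and "0 < x \<and> x < 1"
      then have x: "0 < x" "x < 1" by auto
      then have "(w k has_vector_derivative w (Suc k) (h * x + l)) (at (h * x + l))"
        using d h k by (auto simp: mult_less_cancel_left2)
      moreover have "((\<lambda>t. h * t + l) has_real_derivative h) (at x)"
        by (auto intro!: derivative_eq_intros)
      ultimately have "((w k \<circ> (\<lambda>t. h * t + l)) has_vector_derivative h *\<^sub>R w (Suc k) (h * x + l)) (at x)"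
        by (intro vector_diff_chain_at) (auto simp: has_real_derivative_iff_has_vector_derivative)
      then have "((\<lambda>t. h ^ k *\<^sub>R (w k \<circ> (\<lambda>t. h * t + l)) t) has_vector_derivative
          h ^ k *\<^sub>R (h *\<^sub>R w (Suc k) (h * x + l))) (at x)"
        by (intro bounded_linear.has_vector_derivative[OF bounded_linear_scaleR_right])
      then show "(g k has_vector_derivative g (Suc k) x) (at x)"
        by (simp add: g_def o_def mult.commute)
    next
      fix x :: real assume x: "x \<in> {0..1}"
      have "norm (g q x - g q 0) = h ^ q * norm (w q (h * x + l) - w q l)"
        using h by (simp add: g_def flip: scaleR_diff_right)
      also have "\<dots> \<le> h ^ q * B"
        using B mem[OF x] h by (intro mult_left_mono) auto
      finally show "norm (g q x - g q 0) \<le> h ^ q * B" .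
    qed
    moreover have "integral {l..l+h} (w 0) = h *\<^sub>R integral {0..1} (g 0)"
    proof -
      have "w 0 integrable_on {l..l+h}" using c by (intro integrable_continuous_real) auto
      then have "(w 0 has_integral integral {l..l+h} (w 0)) (cbox l (l+h))"
        by (simp add: integrable_integral)
      then have "((\<lambda>x. w 0 (h * x + l)) has_integral (integral {l..l+h} (w 0) /\<^sub>R \<bar>h\<bar>)) (cbox ((l-l)/h) ((l+h-l)/h))"
        using has_integral_affinity'[of "w 0" _ l "l + h" h l] h by simp
      then show ?thesis using h by (simp add: g_def integral_unique)
    qed
    moreover have "(\<Sum>k\<le>q. h ^ Suc k *\<^sub>R (em_right k *\<^sub>R w k (l + h) - em_left k *\<^sub>R w k l))
       = h *\<^sub>R (\<Sum>k\<le>q. em_right k *\<^sub>R g k 1 - em_left k *\<^sub>R g k 0)"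
      by (simp add: g_def scaleR_sum_right algebra_simps)
    ultimately have "norm (integral {l..l+h} (w 0)
        - (\<Sum>k\<le>q. h ^ Suc k *\<^sub>R (em_right k *\<^sub>R w k (l + h) - em_left k *\<^sub>R w k l))) \<le> h * (C * (h ^ q * B))"
      using h by (simp flip: scaleR_diff_right)
    then show "norm (integral {l..l+h} (w 0)
        - (\<Sum>k\<le>q. h ^ Suc k *\<^sub>R (em_right k *\<^sub>R w k (l + h) - em_left k *\<^sub>R w k l))) \<le> C * h ^ Suc q * B"
      by (simp add: mult_ac)
  qed
qed

section \<open>Euler-Maclaurin summation on a grid and for powers\<close>

text \<open>The cell errors telescope because all increments of \<open>w q\<close> are dominated by
  those of one function \<open>V\<close>. At an interior node the coefficients of the two adjacent
  cells combine to 1 for k = 0 and to 0 otherwise, which gives the Riemann sum; the endpoint values,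
  with weight 1/2, stay in the sum over \<open>k\<close>.\<close>

lemma euler_maclaurin_grid:
  "\<exists>C\<ge>0. \<forall>(w :: nat \<Rightarrow> real \<Rightarrow> complex) V a b n. a < b \<longrightarrow> n \<ge> 1 \<longrightarrow>
     (\<forall>k\<le>q. continuous_on {a..b} (w k)) \<longrightarrow>
     (\<forall>k<q. \<forall>x. a < x \<and> x < b \<longrightarrow> (w k has_vector_derivative w (Suc k) x) (at x)) \<longrightarrow>
     (\<forall>x y. a \<le> x \<and> x \<le> y \<and> y \<le> b \<longrightarrow> norm (w q y - w q x) \<le> V y - V x) \<longrightarrow>
     norm (integral {a..b} (w 0)
        - ((b - a) / real n) *\<^sub>R (\<Sum>j=1..<n. w 0 (a + real j * ((b - a) / real n)))
        - (\<Sum>k\<le>q. ((b - a) / real n) ^ Suc k *\<^sub>R (em_right k *\<^sub>R w k b - em_left k *\<^sub>R w k a)))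
      \<le> C * ((b - a) / real n) ^ Suc q * (V b - V a)"
proof -
  obtain C where C: "C \<ge> 0" and CB: "\<forall>(w :: nat \<Rightarrow> real \<Rightarrow> complex) l h B. 0 < h \<longrightarrow>
     (\<forall>k\<le>q. continuous_on {l..l+h} (w k)) \<longrightarrow>
     (\<forall>k<q. \<forall>x. l < x \<and> x < l + h \<longrightarrow> (w k has_vector_derivative w (Suc k) x) (at x)) \<longrightarrow>
     (\<forall>x\<in>{l..l+h}. norm (w q x - w q l) \<le> B) \<longrightarrow>
     norm (integral {l..l+h} (w 0)
        - (\<Sum>k\<le>q. h ^ Suc k *\<^sub>R (em_right k *\<^sub>R w k (l + h) - em_left k *\<^sub>R w k l))) \<le> C * h ^ Suc q * B"
    using euler_maclaurin_cell[of q] by blast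
  show ?thesis
  proof (intro exI[of _ C] conjI allI impI)
    show "0 \<le> C" by fact
    fix w :: "nat \<Rightarrow> real \<Rightarrow> complex" and V a b and n :: nat
    assume ab: "a < b" and n: "n \<ge> 1" and c: "\<forall>k\<le>q. continuous_on {a..b} (w k)"
      and d: "\<forall>k<q. \<forall>x. a < x \<and> x < b \<longrightarrow> (w k has_vector_derivative w (Suc k) x) (at x)"
      and V: "\<forall>x y. a \<le> x \<and> x \<le> y \<and> y \<le> b \<longrightarrow> norm (w q y - w q x) \<le> V y - V x"
    define h where "h = (b - a) / real n"
    have h: "h > 0" using ab n by (simp add: h_def)
    define X where "X = (\<lambda>i. a + real i * h)"
    have Xn: "X n = b" using n by (simp add: X_def h_def)
    have X0: "X 0 = a" by (simp add: X_def)
    have XSuc: "X (Suc i) = X i + h" for i by (simp add: X_def algebra_simps)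
    have Xmono: "X i \<le> X j" if "i \<le> j" for i j using that h by (simp add: X_def)
    have cell: "norm (integral {X i..X (Suc i)} (w 0)
        - (\<Sum>k\<le>q. h ^ Suc k *\<^sub>R (em_right k *\<^sub>R w k (X (Suc i)) - em_left k *\<^sub>R w k (X i))))
        \<le> C * h ^ Suc q * (V (X (Suc i)) - V (X i))" if i: "i < n" for i
      unfolding XSuc
    proof (rule CB[rule_format, OF h])
      have sub: "{X i..X i + h} \<subseteq> {a..b}"
        using Xmono[of 0 i] Xmono[of "Suc i" n] i by (auto simp: Xn X0 XSuc)
      show "continuous_on {X i..X i + h} (w k)" if "k \<le> q" for k
        using c that sub by (blast intro: continuous_on_subset)
      show "(w k has_vector_derivative w (Suc k) x) (at x)"
        if "k < q" "X i < x \<and> x < X i + h" for k x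
        using d that Xmono[of 0 i] Xmono[of "Suc i" n] i by (auto simp: Xn X0 XSuc)
      fix x assume x: "x \<in> {X i..X i + h}"
      then have "norm (w q x - w q (X i)) \<le> V x - V (X i)"
        using V sub h by auto
      \<comment> \<open>Nonnegativity of this norm yields \<open>V x \<le> V (X i + h)\<close>, so
        one bound serves the whole cell.\<close>
      moreover have "norm (w q (X i + h) - w q x) \<le> V (X i + h) - V x"
        using V sub h x by auto
      ultimately show "norm (w q x - w q (X i)) \<le> V (X i + h) - V (X i)"
        using norm_ge_zero[of "w q (X i + h) - w q x"] by linarith
    qed
    have w0: "w 0 integrable_on {a..b}"
      using c by (intro integrable_continuous_real) auto
    \<comment> \<open>The induction adds one cell at a time and starts with a single cell;
      \<open>i\<close> is one less than the number of cells.\<close>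
    have "i < n \<Longrightarrow> norm (integral {a..X (Suc i)} (w 0) - h *\<^sub>R (\<Sum>j=1..<Suc i. w 0 (X j))
        - (\<Sum>k\<le>q. h ^ Suc k *\<^sub>R (em_right k *\<^sub>R w k (X (Suc i)) - em_left k *\<^sub>R w k a)))
      \<le> C * h ^ Suc q * (V (X (Suc i)) - V a)" for i
    proof (induction i)
      case 0
      then show ?case using cell[of 0] by (simp add: X0)
    next
      case (Suc i)
      let ?S = "\<lambda>x y. \<Sum>k\<le>q. h ^ Suc k *\<^sub>R (em_right k *\<^sub>R w k y - em_left k *\<^sub>R w k x)"
      have "integral {a..X (Suc i)} (w 0) + integral {X (Suc i)..X (Suc (Suc i))} (w 0)
          = integral {a..X (Suc (Suc i))} (w 0)"
        using Xmono[of 0 "Suc i"] Xmono[of "Suc i" "Suc (Suc i)"] Xmono[of "Suc (Suc i)" n] Suc.prems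
        by (intro Henstock_Kurzweil_Integration.integral_combine integrable_subinterval_real[OF w0]) (auto simp: Xn X0)
      moreover have "(\<Sum>k\<le>q. h ^ Suc k *\<^sub>R ((em_right k - em_left k) *\<^sub>R w k (X (Suc i)))) = h *\<^sub>R w 0 (X (Suc i))"
        by (subst sum.remove[of _ 0]) (auto simp: em_right_eq)
      moreover have "?S a (X (Suc (Suc i))) = ?S a (X (Suc i)) + ?S (X (Suc i)) (X (Suc (Suc i)))
            - (\<Sum>k\<le>q. h ^ Suc k *\<^sub>R ((em_right k - em_left k) *\<^sub>R w k (X (Suc i))))"
        unfolding sum.distrib[symmetric] sum_subtractf[symmetric]
        by (rule sum.cong[OF refl]) (simp only: scaleR_diff_left scaleR_diff_right, simp)
      ultimately have "integral {a..X (Suc (Suc i))} (w 0) - h *\<^sub>R (\<Sum>j=1..<Suc (Suc i). w 0 (X j))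
        - ?S a (X (Suc (Suc i)))
        = (integral {a..X (Suc i)} (w 0) - h *\<^sub>R (\<Sum>j=1..<Suc i. w 0 (X j)) - ?S a (X (Suc i)))
        + (integral {X (Suc i)..X (Suc (Suc i))} (w 0) - ?S (X (Suc i)) (X (Suc (Suc i))))"
        by (simp add: scaleR_add_right)
      also have "norm \<dots> \<le> C * h ^ Suc q * (V (X (Suc i)) - V a)
          + C * h ^ Suc q * (V (X (Suc (Suc i))) - V (X (Suc i)))"
        using Suc by (intro norm_triangle_le add_mono cell) auto
      finally show ?case by (simp add: algebra_simps)
    qed
    from this[of "n - 1"] n
    show "norm (integral {a..b} (w 0)
        - ((b - a) / real n) *\<^sub>R (\<Sum>j=1..<n. w 0 (a + real j * ((b - a) / real n)))
        - (\<Sum>k\<le>q. ((b - a) / real n) ^ Suc k *\<^sub>R (em_right k *\<^sub>R w k b - em_left k *\<^sub>R w k a)))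
      \<le> C * ((b - a) / real n) ^ Suc q * (V b - V a)"
      by (simp add: Xn) (simp add: X_def h_def)
  qed
qed

text \<open>The bound has the shape \<open>V y - V x\<close> with \<open>V t = M * t\<close>, so
  that it can act as an increment of a variation function.\<close>

lemma norm_diff_le_vector_derivative_bound:
  fixes f :: "real \<Rightarrow> 'a::real_normed_vector"
  assumes "x \<le> y" "continuous_on {x..y} f"
    and "\<And>t. x < t \<Longrightarrow> t < y \<Longrightarrow> (f has_vector_derivative f' t) (at t)"
    and "\<And>t. x < t \<Longrightarrow> t < y \<Longrightarrow> norm (f' t) \<le> M"
  shows "norm (f y - f x) \<le> M * y - M * x"
proof (cases "x = y")
  case False
  show ?thesis
  proof (rule differentiable_bound_general[where f' = f' and \<phi> = "\<lambda>t. M * t" and \<phi>' = "\<lambda>_. M"])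
    show "((*) M has_vector_derivative M) (at t)" for t
      by (auto intro!: derivative_eq_intros simp flip: has_real_derivative_iff_has_vector_derivative)
  qed (use assms False in \<open>auto intro!: continuous_intros\<close>)
qed simp

section \<open>Euler-Maclaurin sums of a single power\<close>

text \<open>The falling factorial.\<close>

definition ff :: "complex \<Rightarrow> nat \<Rightarrow> complex" where
  "ff z k = (\<Prod>i<k. z - of_nat i)"

lemma ff_0 [simp]: "ff z 0 = 1"
  and ff_Suc: "ff z (Suc k) = ff z k * (z - of_nat k)"
  by (simp_all add: ff_def)

lemma ff_of_nat_eq_0: "m < k \<Longrightarrow> ff (of_nat m) k = 0"
  by (auto simp: ff_def)

lemma holomorphic_on_ff [holomorphic_intros]:
  "f holomorphic_on S \<Longrightarrow> (\<lambda>z. ff (f z) k) holomorphic_on S"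
  unfolding ff_def by (intro holomorphic_intros)

definition pow_deriv :: "complex \<Rightarrow> nat \<Rightarrow> real \<Rightarrow> complex" where
  "pow_deriv z k x = ff z k * of_real x powr (z - of_nat k)"

text \<open>The constant of integration is chosen such that the behaviour at 0 is a pure logarithm
  or a pure power, without constant term. The value at the other end of an interval is then itself
  the finite part of the integral of the power.\<close>

definition pow_prim :: "complex \<Rightarrow> real \<Rightarrow> complex" where
  "pow_prim z x = (if z = -1 then of_real (ln x) else of_real x powr (z + 1) / (z + 1))"

lemma has_vector_derivative_of_real_powr:
  fixes z :: complex
  assumes "x > 0"
  shows "((\<lambda>x. of_real x powr z) has_vector_derivative (z * of_real x powr (z - 1))) (at x within S)"
proof -
  have "((\<lambda>w. w powr z) has_field_derivative (z * of_real x powr (z - 1))) (at (of_real x))"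
    using assms by (intro has_field_derivative_powr) (auto simp: complex_nonpos_Reals_iff)
  then show ?thesis by (rule has_vector_derivative_real_field)
qed

lemma pow_deriv_has_vector_derivative:
  assumes "x > 0"
  shows "(pow_deriv z k has_vector_derivative pow_deriv z (Suc k) x) (at x within S)"
proof -
  have "((\<lambda>x. ff z k * of_real x powr (z - of_nat k)) has_vector_derivative
     ff z k * ((z - of_nat k) * of_real x powr (z - of_nat k - 1))) (at x within S)"
    using assms by (intro has_vector_derivative_mult_right has_vector_derivative_of_real_powr)
  then show ?thesis
    by (simp add: pow_deriv_def[abs_def] ff_Suc algebra_simps)
qed

lemma continuous_on_pow_deriv [continuous_intros]:
  assumes "\<And>x. x \<in> S \<Longrightarrow> x > 0"
  shows "continuous_on S (pow_deriv z k)"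
  using pow_deriv_has_vector_derivative assms
  by (intro continuous_on_vector_derivative) blast

lemma pow_prim_has_vector_derivative:
  assumes "x > 0"
  shows "(pow_prim z has_vector_derivative pow_deriv z 0 x) (at x within S)"
proof (cases "z = -1")
  case True
  have "((\<lambda>x. complex_of_real (ln x)) has_vector_derivative complex_of_real (1 / x)) (at x within S)"
    using assms
    by (intro bounded_linear.has_vector_derivative[OF bounded_linear_of_real])
      (auto intro!: derivative_eq_intros simp flip: has_real_derivative_iff_has_vector_derivative)
  then show ?thesis using True assms
    by (simp add: pow_prim_def[abs_def] pow_deriv_def powr_minus_divide)
next
  case False
  then have nz: "z + 1 \<noteq> 0" by (simp add: eq_neg_iff_add_eq_0)
  have "((\<lambda>x. of_real x powr (z + 1) / (z + 1)) has_vector_derivative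
     ((z + 1) * of_real x powr (z + 1 - 1)) / (z + 1)) (at x within S)"
    using assms by (intro has_vector_derivative_divide has_vector_derivative_of_real_powr)
  then show ?thesis using False nz by (simp add: pow_prim_def[abs_def] pow_deriv_def)
qed

lemma has_integral_pow_prim:
  assumes "0 < l" "l \<le> r"
  shows "(pow_deriv z 0 has_integral pow_prim z r - pow_prim z l) {l..r}"
  using assms by (intro fundamental_theorem_of_calculus pow_prim_has_vector_derivative) auto

lemma norm_of_nat_powr: "n \<ge> 1 \<Longrightarrow> norm (of_nat n powr z) = real n powr Re z"
  using norm_powr_real_powr[of "of_nat n" z] by simp

text \<open>The partial sum minus the Euler-Maclaurin terms at its upper end. The node
  \<open>n\<close> is not summed, hence the plus sign at \<open>em_right\<close>, whose first value
  is 1/2. For order \<open>q\<close> large enough the rest converges, to the zeta value at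
  \<open>- z\<close> or, for \<open>z = -1\<close>, to Euler's constant.\<close>

definition em_power_sum :: "nat \<Rightarrow> nat \<Rightarrow> complex \<Rightarrow> complex" where
  "em_power_sum q n z = (\<Sum>j=1..<n. of_nat j powr z) - pow_prim z (real n)
     + (\<Sum>k\<le>q. em_right k *\<^sub>R pow_deriv z k (real n))"

text \<open>The increment is, up to sign, the error on the cell [n, n + 1], where the q-th
  derivative varies by at most the maximum of the next one; the condition on \<open>Re z\<close>
  lets the left end \<open>n\<close> bound it. The factor \<open>ff z (Suc q)\<close> stays
  explicit: it is bounded for z in a compact set and 0 for natural exponents up to
  \<open>q\<close>.\<close>

lemma em_power_sum_step:
  "\<exists>C\<ge>0. \<forall>n z. n \<ge> 1 \<longrightarrow> Re z \<le> real q + 1 \<longrightarrow>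
     norm (em_power_sum q (Suc n) z - em_power_sum q n z)
       \<le> C * norm (ff z (Suc q)) * real n powr (Re z - real q - 1)"
proof -
  obtain C where C: "C \<ge> 0" and CB: "\<forall>(w :: nat \<Rightarrow> real \<Rightarrow> complex) l h B. 0 < h \<longrightarrow>
     (\<forall>k\<le>q. continuous_on {l..l+h} (w k)) \<longrightarrow>
     (\<forall>k<q. \<forall>x. l < x \<and> x < l + h \<longrightarrow> (w k has_vector_derivative w (Suc k) x) (at x)) \<longrightarrow>
     (\<forall>x\<in>{l..l+h}. norm (w q x - w q l) \<le> B) \<longrightarrow>
     norm (integral {l..l+h} (w 0)
        - (\<Sum>k\<le>q. h ^ Suc k *\<^sub>R (em_right k *\<^sub>R w k (l + h) - em_left k *\<^sub>R w k l))) \<le> C * h ^ Suc q * B"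
    using euler_maclaurin_cell[of q] by blast
  show ?thesis
  proof (intro exI[of _ C] conjI allI impI)
    show "0 \<le> C" by fact
    fix n :: nat and z assume n: "n \<ge> 1" and z: "Re z \<le> real q + 1"
    let ?B = "norm (ff z (Suc q)) * real n powr (Re z - real q - 1)"
    let ?w = "pow_deriv z"
    have "norm (integral {real n..real n+1} (?w 0)
        - (\<Sum>k\<le>q. 1 ^ Suc k *\<^sub>R (em_right k *\<^sub>R ?w k (real n + 1) - em_left k *\<^sub>R ?w k (real n)))) \<le> C * 1 ^ Suc q * ?B"
    proof (rule CB[rule_format])
      show "continuous_on {real n..real n + 1} (pow_deriv z k)" for k
        using n by (intro continuous_intros) auto
      show "(pow_deriv z k has_vector_derivative pow_deriv z (Suc k) x) (at x)"
        if "real n < x \<and> x < real n + 1" for k x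
        using that n by (intro pow_deriv_has_vector_derivative) auto
      fix x assume x: "x \<in> {real n..real n + 1}"
      have B0: "?B \<ge> 0" by simp
      have "norm (?w q x - ?w q (real n)) \<le> ?B * x - ?B * real n"
      proof (rule norm_diff_le_vector_derivative_bound[where f' = "pow_deriv z (Suc q)"])
        show "real n \<le> x" using x by simp
        show "continuous_on {real n..x} (pow_deriv z q)"
          using n by (intro continuous_intros) auto
        fix t assume t: "real n < t" "t < x"
        then have t0: "t > 0" by linarith
        then show "(pow_deriv z q has_vector_derivative pow_deriv z (Suc q) t) (at t)"
          by (rule pow_deriv_has_vector_derivative)
        have "norm (pow_deriv z (Suc q) t) = norm (ff z (Suc q)) * t powr (Re z - real q - 1)"
          using t0 norm_powr_real_powr[of "of_real t" "z - of_nat (Suc q)"]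
          by (simp add: pow_deriv_def norm_mult algebra_simps)
        also have "\<dots> \<le> ?B"
          using t z n by (intro mult_left_mono powr_mono2') auto
        finally show "norm (pow_deriv z (Suc q) t) \<le> ?B" .
      qed
      also have "\<dots> = ?B * (x - real n)" by (simp add: algebra_simps)
      also have "\<dots> \<le> ?B * 1"
        using x B0 by (intro mult_left_mono) auto
      finally show "norm (?w q x - ?w q (real n)) \<le> ?B" by simp
    qed auto
    moreover have "integral {real n..real n+1} (?w 0) = pow_prim z (real n + 1) - pow_prim z (real n)"
      using n by (intro integral_unique has_integral_pow_prim) auto
    moreover have "(\<Sum>k\<le>q. (em_right k - em_left k) *\<^sub>R ?w k (real n)) = of_nat n powr z"
      by (subst sum.remove[of _ 0]) (auto simp: em_right_eq pow_deriv_def)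
    then have jump: "of_nat n powr z = (\<Sum>k\<le>q. em_right k *\<^sub>R ?w k (real n)) - (\<Sum>k\<le>q. em_left k *\<^sub>R ?w k (real n))"
      by (simp add: sum_subtractf scaleR_diff_left)
    have "(\<Sum>k\<le>q. em_right k *\<^sub>R ?w k (real n + 1) - em_left k *\<^sub>R ?w k (real n))
       = (\<Sum>k\<le>q. em_right k *\<^sub>R ?w k (real n + 1)) - (\<Sum>k\<le>q. em_right k *\<^sub>R ?w k (real n)) + of_nat n powr z"
      unfolding jump by (simp add: sum_subtractf)
    ultimately have "norm (pow_prim z (real n + 1) - pow_prim z (real n) -
        ((\<Sum>k\<le>q. em_right k *\<^sub>R ?w k (real n + 1)) - (\<Sum>k\<le>q. em_right k *\<^sub>R ?w k (real n)) + of_nat n powr z))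
      \<le> C * ?B"
      by simp
    also have "pow_prim z (real n + 1) - pow_prim z (real n) -
        ((\<Sum>k\<le>q. em_right k *\<^sub>R ?w k (real n + 1)) - (\<Sum>k\<le>q. em_right k *\<^sub>R ?w k (real n)) + of_nat n powr z)
       = - (em_power_sum q (Suc n) z - em_power_sum q n z)"
      using n by (simp add: em_power_sum_def add.commute)
    finally show "norm (em_power_sum q (Suc n) z - em_power_sum q n z)
       \<le> C * norm (ff z (Suc q)) * real n powr (Re z - real q - 1)" by (simp add: norm_minus_commute mult.assoc)
  qed
qed

text \<open>The step bound at \<open>j\<close> is split into j^(Re z - q + 1), which decreases and
  is replaced by its value at \<open>n\<close>, and the summable j^(-2). This loses one power of
  \<open>n\<close> against the true tail, which is harmless since \<open>q\<close> can be
  raised.\<close>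

lemma em_power_sum_Cauchy:
  "\<exists>C\<ge>0. \<forall>m n z. n \<ge> 1 \<longrightarrow> n \<le> m \<longrightarrow> Re z + 2 \<le> real q \<longrightarrow>
     norm (em_power_sum q m z - em_power_sum q n z)
       \<le> C * norm (ff z (Suc q)) * real n powr (Re z - real q + 1)"
proof -
  obtain C where C: "C \<ge> 0" and step: "\<forall>n z. n \<ge> 1 \<longrightarrow> Re z \<le> real q + 1 \<longrightarrow>
     norm (em_power_sum q (Suc n) z - em_power_sum q n z)
       \<le> C * norm (ff z (Suc q)) * real n powr (Re z - real q - 1)"
    using em_power_sum_step[of q] by blast
  \<comment> \<open>The summand at index 0 is 1 / 0 = 0.\<close>
  define S where "S = (\<Sum>n. 1 / real n ^ 2)"
  have summable: "summable (\<lambda>n. 1 / real n ^ 2)"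
    using inverse_power_summable[of 2, where ?'a = real] by (simp add: inverse_eq_divide)
  show ?thesis
  proof (intro exI[of _ "C * S"] conjI allI impI)
    show "0 \<le> C * S" using C summable by (auto simp: S_def intro!: suminf_nonneg mult_nonneg_nonneg)
    fix m n :: nat and z assume n: "n \<ge> 1" and m: "n \<le> m" and z: "Re z + 2 \<le> real q"
    define D where "D = C * norm (ff z (Suc q)) * real n powr (Re z - real q + 1)"
    have D: "D \<ge> 0" using C by (simp add: D_def)
    have "norm (em_power_sum q m z - em_power_sum q n z) \<le> D * (\<Sum>j=n..<m. 1 / real j ^ 2)"
      using m
    proof (induction m rule: dec_induct)
      case (step j)
      have j: "j \<ge> 1" using step n by simp
      have "real j powr (Re z - real q - 1) = real j powr (Re z - real q + 1) * (1 / real j ^ 2)"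
        using j powr_add[of "real j" "Re z - real q + 1" "-2"]
        by (simp add: powr_minus_divide powr_numeral)
      also have "\<dots> \<le> real n powr (Re z - real q + 1) * (1 / real j ^ 2)"
        using step z n by (intro mult_right_mono powr_mono2') auto
      finally have "C * norm (ff z (Suc q)) * real j powr (Re z - real q - 1)
          \<le> C * norm (ff z (Suc q)) * (real n powr (Re z - real q + 1) * (1 / real j ^ 2))"
        using C by (intro mult_left_mono) auto
      moreover have "norm (em_power_sum q (Suc j) z - em_power_sum q j z)
          \<le> C * norm (ff z (Suc q)) * real j powr (Re z - real q - 1)"
        using \<open>\<forall>n z. _\<close> j z by auto
      ultimately have "norm (em_power_sum q (Suc j) z - em_power_sum q j z) \<le> D * (1 / real j ^ 2)"
        by (simp add: D_def mult.assoc)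
      then have "norm ((em_power_sum q (Suc j) z - em_power_sum q j z) + (em_power_sum q j z - em_power_sum q n z))
          \<le> D * (1 / real j ^ 2) + D * (\<Sum>j=n..<j. 1 / real j ^ 2)"
        using step.IH by (intro norm_triangle_le add_mono) auto
      then show ?case using step by (simp add: algebra_simps)
    qed simp
    also have "\<dots> \<le> D * S"
      unfolding S_def using summable D by (intro mult_left_mono sum_le_suminf) auto
    finally show "norm (em_power_sum q m z - em_power_sum q n z)
       \<le> C * S * norm (ff z (Suc q)) * real n powr (Re z - real q + 1)"
      by (simp add: D_def mult_ac)
  qed
qed

lemma tendsto_of_nat_powr_neg:
  assumes "Re z < 0"
  shows "(\<lambda>n. of_nat n powr z :: complex) \<longlonglongrightarrow> 0"
proof (rule tendsto_norm_zero_cancel, rule Lim_transform_eventually)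
  show "(\<lambda>n. real n powr Re z) \<longlonglongrightarrow> 0"
    using assms by (intro tendsto_neg_powr filterlim_real_sequentially)
  show "\<forall>\<^sub>F n in sequentially. real n powr Re z = norm (of_nat n powr z :: complex)"
    using eventually_ge_at_top[of 1] by eventually_elim (simp add: norm_of_nat_powr)
qed

lemma tendsto_pow_deriv_of_nat:
  assumes "Re z < real k"
  shows "(\<lambda>n. pow_deriv z k (real n)) \<longlonglongrightarrow> 0"
  unfolding pow_deriv_def
  using tendsto_mult_left[OF tendsto_of_nat_powr_neg[of "z - of_nat k"], of "ff z k"] assms by simp

text \<open>The order \<open>nat \<lceil>Re z + 2\<rceil>\<close> is the smallest one covered by the Cauchy estimate; every larger order
  has the same limit.\<close>

definition power_sum_constant :: "complex \<Rightarrow> complex" where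
  "power_sum_constant z = lim (\<lambda>n. em_power_sum (nat \<lceil>Re z + 2\<rceil>) n z)"

text \<open>The Cauchy estimate gives the limit at the least order; raising \<open>q\<close> by one
  adds a multiple of \<open>pow_deriv z (Suc q) (real n)\<close>, which tends to 0.\<close>

lemma em_power_sum_tendsto:
  assumes "Re z + 2 \<le> real q"
  shows "(\<lambda>n. em_power_sum q n z) \<longlonglongrightarrow> power_sum_constant z"
proof -
  let ?q = "nat \<lceil>Re z + 2\<rceil>"
  have q0: "Re z + 2 \<le> real ?q" by linarith
  obtain C where C: "C \<ge> 0" and CB: "\<forall>m n z. n \<ge> 1 \<longrightarrow> n \<le> m \<longrightarrow> Re z + 2 \<le> real ?q \<longrightarrow>
     norm (em_power_sum ?q m z - em_power_sum ?q n z)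
       \<le> C * norm (ff z (Suc ?q)) * real n powr (Re z - real ?q + 1)"
    using em_power_sum_Cauchy[of ?q] by blast
  have "Cauchy (\<lambda>n. em_power_sum ?q n z)"
  proof (rule CauchyI')
    fix e :: real assume e: "e > 0"
    have "(\<lambda>n. C * norm (ff z (Suc ?q)) * real n powr (Re z - real ?q + 1)) \<longlonglongrightarrow> C * norm (ff z (Suc ?q)) * 0"
      using q0 by (intro tendsto_intros tendsto_neg_powr filterlim_real_sequentially) linarith
    then have "\<forall>\<^sub>F n in sequentially. C * norm (ff z (Suc ?q)) * real n powr (Re z - real ?q + 1) < e"
      using e by (intro order_tendstoD) auto
    then obtain M where M: "\<And>n. n \<ge> M \<Longrightarrow> C * norm (ff z (Suc ?q)) * real n powr (Re z - real ?q + 1) < e"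
      by (auto simp: eventually_at_top_linorder)
    show "\<exists>M. \<forall>m\<ge>M. \<forall>n>m. dist (em_power_sum ?q m z) (em_power_sum ?q n z) < e"
    proof (intro exI[of _ "max 1 M"] allI impI)
      fix m n assume "max 1 M \<le> m" "m < n"
      then show "dist (em_power_sum ?q m z) (em_power_sum ?q n z) < e"
        using CB[rule_format, of m n z] M[of m] q0 by (simp add: dist_norm norm_minus_commute)
    qed
  qed
  then have lim0: "(\<lambda>n. em_power_sum ?q n z) \<longlonglongrightarrow> power_sum_constant z"
    unfolding power_sum_constant_def by (simp add: Cauchy_convergent_iff convergent_LIMSEQ_iff)
  have "?q \<le> q" using assms by linarith
  then show ?thesis
  proof (induction q rule: dec_induct)
    case (step q)
    have "(\<lambda>n. em_power_sum q n z + em_right (Suc q) *\<^sub>R pow_deriv z (Suc q) (real n))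
       \<longlonglongrightarrow> power_sum_constant z + em_right (Suc q) *\<^sub>R 0"
      using step q0 by (intro tendsto_intros tendsto_pow_deriv_of_nat) linarith+
    then show ?case by (simp add: em_power_sum_def add_ac)
  qed (rule lim0)
qed

lemma em_power_sum_error:
  "\<exists>C\<ge>0. \<forall>n z. n \<ge> 1 \<longrightarrow> Re z + 2 \<le> real q \<longrightarrow>
     norm (em_power_sum q n z - power_sum_constant z)
       \<le> C * norm (ff z (Suc q)) * real n powr (Re z - real q + 1)"
proof -
  obtain C where C: "C \<ge> 0" and CB: "\<forall>m n z. n \<ge> 1 \<longrightarrow> n \<le> m \<longrightarrow> Re z + 2 \<le> real q \<longrightarrow>
     norm (em_power_sum q m z - em_power_sum q n z)
       \<le> C * norm (ff z (Suc q)) * real n powr (Re z - real q + 1)"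
    using em_power_sum_Cauchy[of q] by blast
  show ?thesis
  proof (intro exI[of _ C] conjI allI impI)
    show "0 \<le> C" by fact
    fix n :: nat and z assume n: "n \<ge> 1" and z: "Re z + 2 \<le> real q"
    have "(\<lambda>m. norm (em_power_sum q m z - em_power_sum q n z)) \<longlonglongrightarrow>
        norm (power_sum_constant z - em_power_sum q n z)"
      by (intro tendsto_intros em_power_sum_tendsto z)
    then have "norm (power_sum_constant z - em_power_sum q n z)
        \<le> C * norm (ff z (Suc q)) * real n powr (Re z - real q + 1)"
      using CB n z by (intro LIMSEQ_le_const2) auto
    then show "norm (em_power_sum q n z - power_sum_constant z)
       \<le> C * norm (ff z (Suc q)) * real n powr (Re z - real q + 1)"
      by (simp add: norm_minus_commute)
  qed
qed

section \<open>The Riemann zeta function\<close>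

text \<open>In this half-plane the primitive and all derivative terms tend to 0, so the limit is
  that of the bare partial sums; order 1 is already admissible.\<close>

lemma power_sum_constant_sums:
  assumes "Re z < -1"
  shows "(\<lambda>n. of_nat (Suc n) powr z) sums power_sum_constant z"
proof -
  have z: "z \<noteq> -1" using assms by auto
  have "(\<lambda>n. of_nat n powr (z + 1) / (z + 1)) \<longlonglongrightarrow> 0 / (z + 1)"
    using z assms by (intro tendsto_intros tendsto_of_nat_powr_neg) (auto simp: eq_neg_iff_add_eq_0)
  then have prim: "(\<lambda>n. pow_prim z (real n)) \<longlonglongrightarrow> 0"
    using z by (simp add: pow_prim_def)
  have "(\<lambda>n. em_power_sum 1 n z + pow_prim z (real n)
      - (\<Sum>k\<le>1. em_right k *\<^sub>R pow_deriv z k (real n))) \<longlonglongrightarrow>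
      power_sum_constant z + 0 - (\<Sum>k\<le>1. em_right k *\<^sub>R 0)"
    using assms by (intro tendsto_diff tendsto_add tendsto_sum tendsto_scaleR tendsto_const
        em_power_sum_tendsto prim tendsto_pow_deriv_of_nat) auto
  then have "(\<lambda>n. \<Sum>j=1..<n. of_nat j powr z) \<longlonglongrightarrow> power_sum_constant z"
    by (simp add: em_power_sum_def)
  then have "(\<lambda>n. \<Sum>j=1..<Suc n. of_nat j powr z) \<longlonglongrightarrow> power_sum_constant z"
    by (rule LIMSEQ_Suc)
  moreover have "(\<Sum>j=1..<Suc n. of_nat j powr z) = (\<Sum>j<n. of_nat (Suc j) powr z)" for n
    by (induction n) auto
  ultimately show ?thesis by (simp add: sums_def)
qed

text \<open>The primitive is now the logarithm, and the sum is the harmonic number without its last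
  term 1/n, as it stops before \<open>n\<close>. This is the origin of Euler's constant in the
  contribution of a simple pole.\<close>

lemma power_sum_constant_minus_one: "power_sum_constant (-1) = euler_mascheroni"
proof (rule LIMSEQ_unique)
  show "(\<lambda>n. em_power_sum 1 n (-1)) \<longlonglongrightarrow> power_sum_constant (-1)"
    by (rule em_power_sum_tendsto) simp
  have "(\<lambda>n. of_real (harm n - ln (of_nat n)) - of_nat n powr (-1)
      + (\<Sum>k\<le>1. em_right k *\<^sub>R pow_deriv (-1) k (real n))) \<longlonglongrightarrow>
      euler_mascheroni - 0 + (\<Sum>k\<le>1. em_right k *\<^sub>R (0::complex))"
    by (intro tendsto_diff tendsto_add tendsto_sum tendsto_scaleR tendsto_const
        tendsto_pow_deriv_of_nat tendsto_of_nat_powr_neg euler_mascheroni_LIMSEQ_of_real) auto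
  then have "(\<lambda>n. of_real (harm n - ln (of_nat n)) - of_nat n powr (-1)
      + (\<Sum>k\<le>1. em_right k *\<^sub>R pow_deriv (-1) k (real n))) \<longlonglongrightarrow> (euler_mascheroni :: complex)"
    by simp
  moreover have "\<forall>\<^sub>F n in sequentially. of_real (harm n - ln (of_nat n)) - of_nat n powr (-1)
      + (\<Sum>k\<le>1. em_right k *\<^sub>R pow_deriv (-1) k (real n)) = em_power_sum 1 n (-1)"
    using eventually_ge_at_top[of 1]
  proof eventually_elim
    case (elim n)
    have "of_real (harm n) = (\<Sum>j=1..n. of_nat j powr (-1) :: complex)"
      unfolding harm_def of_real_sum by (rule sum.cong) (auto simp: powr_minus)
    also have "\<dots> = (\<Sum>j=1..<n. of_nat j powr (-1)) + of_nat n powr (-1)"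
      using elim by (simp add: sum.last_plus add.commute)
    finally show ?case by (simp add: em_power_sum_def pow_prim_def)
  qed
  ultimately show "(\<lambda>n. em_power_sum 1 n (-1)) \<longlonglongrightarrow> euler_mascheroni"
    by (rule Lim_transform_eventually)
qed

text \<open>For a polynomial of even degree the Euler-Maclaurin formula is exact down to the cell
  $[0,1]$, and the derivatives at \<open>0\<close> only meet vanishing coefficients.\<close>

lemma power_sum_constant_even:
  assumes "r \<ge> 1"
  shows "power_sum_constant (of_nat (2 * r)) = 0"
proof -
  \<comment> \<open>The order \<open>2 * r + 2\<close> is the least one allowed by
    \<open>em_power_sum_error\<close>, and it exceeds the degree, so the cell error is 0.\<close>
  let ?z = "of_nat (2 * r) :: complex" and ?q = "2 * r + 2"
  \<comment> \<open>For \<open>k > 2 * r\<close> the natural subtraction gives exponent 0, but the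
    falling factorial is 0 there.\<close>
  define w where "w = (\<lambda>k x. ff ?z k * of_real x ^ (2 * r - k))"
  have w_high: "w k x = 0" if "k > 2 * r" for k x
    using ff_of_nat_eq_0[OF that] by (simp add: w_def)
  obtain C where CB: "\<forall>(w :: nat \<Rightarrow> real \<Rightarrow> complex) l h B. 0 < h \<longrightarrow>
     (\<forall>k\<le>?q. continuous_on {l..l+h} (w k)) \<longrightarrow>
     (\<forall>k<?q. \<forall>x. l < x \<and> x < l + h \<longrightarrow> (w k has_vector_derivative w (Suc k) x) (at x)) \<longrightarrow>
     (\<forall>x\<in>{l..l+h}. norm (w ?q x - w ?q l) \<le> B) \<longrightarrow>
     norm (integral {l..l+h} (w 0)
        - (\<Sum>k\<le>?q. h ^ Suc k *\<^sub>R (em_right k *\<^sub>R w k (l + h) - em_left k *\<^sub>R w k l))) \<le> C * h ^ Suc ?q * B"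
    using euler_maclaurin_cell[of ?q] by blast
  have der: "(w k has_vector_derivative w (Suc k) x) (at x)" for k x
  proof -
    have "((\<lambda>y. y ^ (2 * r - k)) has_field_derivative of_nat (2 * r - k) * of_real x ^ (2 * r - k - 1))
       (at (of_real x :: complex))"
      by (auto intro!: derivative_eq_intros)
    then have "((\<lambda>y. of_real y ^ (2 * r - k)) has_vector_derivative
       (of_nat (2 * r - k) * of_real x ^ (2 * r - k - 1) :: complex)) (at x)"
      by (rule has_vector_derivative_real_field)
    from has_vector_derivative_mult_right[OF this, of "ff ?z k"]
    have "(w k has_vector_derivative ff ?z k * (of_nat (2 * r - k) * of_real x ^ (2 * r - k - 1))) (at x)"
      by (simp add: w_def)
    moreover have "ff ?z k * (of_nat (2 * r - k) * of_real x ^ (2 * r - k - 1)) = w (Suc k) x"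
    proof (cases "k \<le> 2 * r")
      case True
      then show ?thesis by (simp add: w_def ff_Suc of_nat_diff)
    next
      case False
      then show ?thesis using ff_of_nat_eq_0[of "2 * r" k] w_high[of "Suc k" x] by simp
    qed
    ultimately show ?thesis by simp
  qed
  have "norm (integral {0..0+1} (w 0)
     - (\<Sum>k\<le>?q. 1 ^ Suc k *\<^sub>R (em_right k *\<^sub>R w k (0 + 1) - em_left k *\<^sub>R w k 0))) \<le> C * 1 ^ Suc ?q * 0"
  proof (rule CB[rule_format])
    show "continuous_on {0..0 + 1} (w k)" for k
      by (rule continuous_on_vector_derivative[OF has_vector_derivative_at_within[OF der]])
    show "norm (w ?q x - w ?q 0) \<le> 0" for x using w_high[of ?q] by simp
    show "(w k has_vector_derivative w (Suc k) x) (at x)" for k x by (rule der)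
  qed simp
  then have "integral {0..1} (w 0) = (\<Sum>k\<le>?q. em_right k *\<^sub>R w k 1) - (\<Sum>k\<le>?q. em_left k *\<^sub>R w k 0)"
    by (simp add: sum_subtractf)
  moreover have "(\<Sum>k\<le>?q. em_left k *\<^sub>R w k 0) = 0"
  proof (rule sum.neutral, safe)
    fix k
    consider "k < 2 * r" | "k = 2 * r" | "k > 2 * r" by linarith
    then show "em_left k *\<^sub>R w k 0 = 0"
      using assms em_left_even[of "2 * r"] w_high by cases (auto simp: w_def)
  qed
  moreover have "(w 0 has_integral (of_real 1 ^ (2 * r + 1) / of_nat (2 * r + 1)
      - of_real 0 ^ (2 * r + 1) / of_nat (2 * r + 1))) {0..1}"
  proof (rule fundamental_theorem_of_calculus)
    fix x :: real
    have "((\<lambda>y. y ^ (2 * r + 1) / of_nat (2 * r + 1)) has_field_derivative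
        of_nat (2 * r + 1) * of_real x ^ (2 * r) / of_nat (2 * r + 1)) (at (of_real x :: complex))"
      using DERIV_power_Suc[OF DERIV_ident, of "2 * r" "of_real x :: complex" UNIV]
      by (intro DERIV_cdivide) simp
    then have "((\<lambda>y. y ^ (2 * r + 1) / of_nat (2 * r + 1)) has_field_derivative w 0 x) (at (of_real x :: complex))"
      by (simp add: w_def del: of_nat_Suc of_nat_add)
    then show "((\<lambda>y. of_real y ^ (2 * r + 1) / of_nat (2 * r + 1)) has_vector_derivative w 0 x) (at x within {0..1})"
      by (rule has_vector_derivative_real_field)
  qed simp
  ultimately have "(\<Sum>k\<le>?q. em_right k *\<^sub>R w k 1) = 1 / of_nat (2 * r + 1)"
    by (simp add: integral_unique)
  moreover have "w k 1 = pow_deriv ?z k 1" for k by (simp add: w_def pow_deriv_def)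
  moreover have "pow_prim ?z 1 = 1 / of_nat (2 * r + 1)"
  proof -
    have "?z \<noteq> -1"
    proof
      assume "?z = -1"
      then have "Re ?z = Re (-1)" by (rule arg_cong)
      then show False by simp
    qed
    then show ?thesis by (simp add: pow_prim_def add.commute)
  qed
  ultimately have "em_power_sum ?q 1 ?z = 0" by (simp add: em_power_sum_def)
  \<comment> \<open>The error bound contains \<open>ff ?z (Suc ?q)\<close>, which is 0 at this
    natural exponent, so the value at \<open>n = 1\<close> is already the limit.\<close>
  moreover have "em_power_sum ?q 1 ?z = power_sum_constant ?z"
  proof -
    obtain C where "\<forall>n z. n \<ge> 1 \<longrightarrow> Re z + 2 \<le> real ?q \<longrightarrow>
       norm (em_power_sum ?q n z - power_sum_constant z)
       \<le> C * norm (ff z (Suc ?q)) * real n powr (Re z - real ?q + 1)"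
      using em_power_sum_error[of ?q] by blast
    from this[rule_format, of 1 ?z] ff_of_nat_eq_0[of "2 * r" "Suc ?q"] show ?thesis by simp
  qed
  ultimately show ?thesis by simp
qed

lemma holomorphic_on_em_power_sum:
  assumes "n \<ge> 1" "S \<subseteq> - {-1}"
  shows "em_power_sum q n holomorphic_on S"
proof -
  have "z + 1 \<noteq> 0" if "z \<in> S" for z
  proof
    assume "z + 1 = 0"
    then have "z = -1" by (simp add: eq_neg_iff_add_eq_0)
    then show False using that assms(2) by auto
  qed
  then have "(\<lambda>z. (\<Sum>j=1..<n. of_nat j powr z) - of_nat n powr (z + 1) / (z + 1)
     + (\<Sum>k\<le>q. of_real (em_right k) * (ff z k * of_nat n powr (z - of_nat k)))) holomorphic_on S"
    using assms by (intro holomorphic_intros)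
  then show ?thesis
    using assms(2)
    by (elim holomorphic_transform)
      (auto simp: em_power_sum_def pow_prim_def pow_deriv_def scaleR_conv_of_real)
qed

text \<open>A locally uniform limit of holomorphic functions: on Re z < q the order
  \<open>q + 2\<close> gives an error O(1/n), uniformly on closed balls, where the falling factorial
  is bounded. These half-planes, without the point -1 at which \<open>pow_prim\<close> has its pole
  in z, exhaust the domain.\<close>

lemma holomorphic_on_power_sum_constant: "power_sum_constant holomorphic_on - {-1}"
proof -
  define S where "S = (\<lambda>q. {z. Re z < real q} - {-1 :: complex})"
  have S_open: "open (S q)" for q
    unfolding S_def by (intro open_Diff open_halfspace_Re_lt) auto
  have "power_sum_constant holomorphic_on S q" for q
  proof (rule holomorphic_uniform_sequence[OF S_open, of "\<lambda>n. em_power_sum (q + 2) (Suc n)"])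
    show "em_power_sum (q + 2) (Suc n) holomorphic_on S q" for n
      by (rule holomorphic_on_em_power_sum) (auto simp: S_def)
    fix z assume "z \<in> S q"
    then obtain d where d: "d > 0" "cball z d \<subseteq> S q"
      using S_open open_contains_cball by blast
    obtain C where C: "C \<ge> 0" and CB: "\<forall>n z. n \<ge> 1 \<longrightarrow> Re z + 2 \<le> real (q + 2) \<longrightarrow>
       norm (em_power_sum (q + 2) n z - power_sum_constant z)
       \<le> C * norm (ff z (Suc (q + 2))) * real n powr (Re z - real (q + 2) + 1)"
      using em_power_sum_error[of "q + 2"] by blast
    have "continuous_on (cball z d) (\<lambda>z. ff z (Suc (q + 2)))"
      by (intro holomorphic_on_imp_continuous_on holomorphic_intros)
    then have "bounded ((\<lambda>z. ff z (Suc (q + 2))) ` cball z d)"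
      by (intro compact_imp_bounded compact_continuous_image) auto
    then obtain M where M: "M > 0" "\<And>y. y \<in> cball z d \<Longrightarrow> norm (ff y (Suc (q + 2))) \<le> M"
      unfolding bounded_pos by blast
    have "uniform_limit (cball z d) (\<lambda>n. em_power_sum (q + 2) (Suc n)) power_sum_constant sequentially"
    proof (rule uniform_limitI)
      fix e :: real assume e: "e > 0"
      have "(\<lambda>n. C * M * real (Suc n) powr -1) \<longlonglongrightarrow> C * M * 0"
        by (intro tendsto_intros tendsto_neg_powr LIMSEQ_Suc filterlim_real_sequentially
            filterlim_compose[OF filterlim_real_sequentially filterlim_Suc]) simp
      then have "\<forall>\<^sub>F n in sequentially. C * M * real (Suc n) powr -1 < e"
        using e by (intro order_tendstoD) auto
      then show "\<forall>\<^sub>F n in sequentially. \<forall>y\<in>cball z d.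
          dist (em_power_sum (q + 2) (Suc n) y) (power_sum_constant y) < e"
      proof eventually_elim
        case (elim n)
        show ?case
        proof
          fix y assume y: "y \<in> cball z d"
          then have Re_y: "Re y < real q" using d by (auto simp: S_def)
          have "dist (em_power_sum (q + 2) (Suc n) y) (power_sum_constant y)
             \<le> C * norm (ff y (Suc (q + 2))) * real (Suc n) powr (Re y - real (q + 2) + 1)"
            using CB[rule_format, of "Suc n" y] Re_y by (simp add: dist_norm)
          also have "\<dots> \<le> C * M * real (Suc n) powr -1"
            using C M y Re_y by (intro mult_mono powr_mono mult_nonneg_nonneg) auto
          finally show "dist (em_power_sum (q + 2) (Suc n) y) (power_sum_constant y) < e"
            using elim by simp
        qed
      qed
    qed
    then show "\<exists>d>0. cball z d \<subseteq> S q \<and>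
      uniform_limit (cball z d) (\<lambda>n. em_power_sum (q + 2) (Suc n)) power_sum_constant sequentially"
      using d by blast
  qed
  then have "power_sum_constant holomorphic_on (\<Union>q. S q)"
    by (intro holomorphic_on_UN_open S_open) auto
  moreover have "(\<Union>q. S q) = - {-1}"
    using reals_Archimedean2 by (auto simp: S_def)
  ultimately show ?thesis by simp
qed

text \<open>The limit constants satisfy the description that defines \<open>riemann_zeta\<close>.
  Any other solution agrees with them where the Dirichlet series converges, hence by the identity
  theorem on the connected punctured plane, and at 1 by the prescribed value.\<close>

lemma riemann_zeta_minus:
  assumes "z \<noteq> -1"
  shows "riemann_zeta (- z) = power_sum_constant z"
proof -
  let ?P = "\<lambda>f. f holomorphic_on (- {1}) \<and> f 1 = 0 \<and>
     (\<forall>s. Re s > 1 \<longrightarrow> (\<lambda>n. 1 / (of_nat (Suc n) powr s)) sums f s)"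
  define f where "f = (\<lambda>s. if s = 1 then 0 else power_sum_constant (- s))"
  have "(power_sum_constant \<circ> uminus) holomorphic_on - {1}"
    by (rule holomorphic_on_compose_gen[OF _ holomorphic_on_power_sum_constant])
      (auto intro: holomorphic_intros)
  then have hol: "f holomorphic_on - {1}"
    by (rule holomorphic_transform) (auto simp: f_def)
  have sums: "(\<lambda>n. 1 / (of_nat (Suc n) powr s)) sums f s" if "Re s > 1" for s
    using power_sum_constant_sums[of "- s"] that
    by (auto simp: f_def powr_minus inverse_eq_divide simp del: of_nat_Suc)
  have "riemann_zeta = f"
    unfolding riemann_zeta_def
  proof (rule the_equality)
    show "?P f" using hol sums by (simp add: f_def del: of_nat_Suc)
    fix g assume g: "?P g"
    show "g = f"
    proof
      fix s
      show "g s = f s"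
      proof (cases "s = 1")
        case False
        have conn: "connected (- {1 :: complex})"
          by (rule connected_punctured_universe) simp
        show ?thesis
        proof (rule analytic_continuation_open[of "{s. Re s > 1}" "- {1}" g f])
          show "open {s. 1 < Re s}" by (rule open_halfspace_Re_gt)
          have "2 \<in> {s. 1 < Re s}" by simp
          then show "{s. 1 < Re s} \<noteq> {}" by blast
          show "g z = f z" if "z \<in> {s. 1 < Re s}" for z
            using that g sums by (auto intro: sums_unique2)
        qed (use g hol conn False in auto)
      qed (use g in \<open>auto simp: f_def\<close>)
    qed
  qed
  then have "riemann_zeta (- z) = f (- z)" by (rule fun_cong)
  moreover have "- z \<noteq> 1" using assms by (metis minus_minus)
  ultimately show ?thesis by (simp add: f_def)
qed

lemma riemann_zeta_trivial_zero: "z \<in> positive_even \<Longrightarrow> riemann_zeta (- z) = 0"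
proof -
  assume "z \<in> positive_even"
  then obtain m where m: "z = of_nat (2 * m)" "m \<ge> 1" by (auto simp: positive_even_def)
  have "z \<noteq> -1"
  proof
    assume "z = -1"
    then have "Re z = -1" by simp
    then show False using m by simp
  qed
  then show ?thesis using riemann_zeta_minus power_sum_constant_even m by simp
qed

section \<open>Finite parts\<close>

text \<open>The operator \<open>f \<mapsto> (\<lambda>t. f (t + \<tau>) - exp (z * \<tau>) * f t)\<close> removes the exponential \<open>z\<close> and
  multiplies the constant term by \<open>1 - exp (z * \<tau>)\<close>.\<close>

lemma exponential_sum_tendsto_0:
  fixes A :: "complex \<Rightarrow> complex"
  assumes "finite Z" "0 \<notin> Z"
    and "((\<lambda>t::real. (\<Sum>z\<in>Z. A z * exp (z * of_real t)) + B * of_real t + I) \<longlongrightarrow> 0) at_top"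
  shows "B = 0 \<and> I = 0"
  using assms
proof (induction Z arbitrary: A B I rule: finite_induct)
  case empty
  let ?f = "\<lambda>t::real. B * of_real t + I"
  have lim: "(?f \<longlongrightarrow> 0) at_top" using empty by simp
  moreover have "((\<lambda>t. ?f (t + 1)) \<longlongrightarrow> 0) at_top"
    by (rule filterlim_compose[OF lim filterlim_tendsto_add_at_top[OF _ filterlim_ident, of "\<lambda>_. 1" 1, unfolded add.commute[of 1]]]) simp
  \<comment> \<open>This difference is the constant \<open>B\<close>.\<close>
  ultimately have "((\<lambda>t. ?f (t + 1) - ?f t) \<longlongrightarrow> 0 - 0) at_top" by (intro tendsto_diff)
  then have B: "B = 0" by (simp add: algebra_simps tendsto_const_iff)
  then show ?case using lim by (simp add: tendsto_const_iff)
next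
  case (insert z Z)
  let ?f = "\<lambda>t::real. (\<Sum>z\<in>insert z Z. A z * exp (z * of_real t)) + B * of_real t + I"
  \<comment> \<open>With this shift \<open>z * \<tau>\<close> has modulus 1, so it is not a multiple
    of 2 pi i and the factor \<open>1 - e\<close> is nonzero.\<close>
  define \<tau> where "\<tau> = 1 / norm z"
  define e where "e = exp (z * of_real \<tau>)"
  have z: "z \<noteq> 0" using insert.prems by auto
  have "e \<noteq> 1"
  proof
    assume "e = 1"
    then obtain n :: int where n: "Re (z * of_real \<tau>) = 0" "Im (z * of_real \<tau>) = of_int (2 * n) * pi"
      unfolding e_def exp_eq_1 by blast
    have "norm (z * of_real \<tau>) = 1" unfolding norm_mult norm_of_real using z by (simp add: \<tau>_def)
    then have abs_1: "\<bar>of_int (2 * n) * pi\<bar> = 1" using cmod_eq_Im[OF n(1)] n(2) by simp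
    then have "n \<noteq> 0" by auto
    then have "1 \<le> \<bar>of_int (2 * n) :: real\<bar>" by linarith
    then have "pi \<le> \<bar>of_int (2 * n)\<bar> * pi"
      using mult_right_mono[of 1 "\<bar>of_int (2 * n)\<bar>" pi] by simp
    moreover have "\<bar>of_int (2 * n)\<bar> * pi = 1" using abs_1 by (simp add: abs_mult)
    ultimately show False using pi_gt3 by linarith
  qed
  have lim: "(?f \<longlongrightarrow> 0) at_top" using insert.prems by blast
  moreover have "((\<lambda>t. ?f (t + \<tau>)) \<longlongrightarrow> 0) at_top"
    by (rule filterlim_compose[OF lim filterlim_tendsto_add_at_top[OF _ filterlim_ident, of "\<lambda>_. \<tau>" \<tau>, unfolded add.commute[of \<tau>]]]) simp
  ultimately have "((\<lambda>t. ?f (t + \<tau>) - e * ?f t) \<longlongrightarrow> 0 - e * 0) at_top"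
    by (intro tendsto_diff tendsto_mult tendsto_const)
  also have "(\<lambda>t. ?f (t + \<tau>) - e * ?f t) =
     (\<lambda>t. (\<Sum>y\<in>Z. (A y * (exp (y * of_real \<tau>) - e)) * exp (y * of_real t)) + ((1 - e) * B) * of_real t
        + (B * of_real \<tau> + (1 - e) * I))" (is "_ = ?g")
  proof
    fix t
    have "(\<Sum>y\<in>Z. A y * exp (y * of_real (t + \<tau>))) - e * (\<Sum>y\<in>Z. A y * exp (y * of_real t))
       = (\<Sum>y\<in>Z. (A y * (exp (y * of_real \<tau>) - e)) * exp (y * of_real t))"
      unfolding sum_distrib_left sum_subtractf[symmetric]
      by (rule sum.cong) (simp_all add: exp_add algebra_simps)
    moreover have "exp (z * of_real (t + \<tau>)) = e * exp (z * of_real t)"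
      by (simp add: e_def exp_add algebra_simps)
    ultimately show "?f (t + \<tau>) - e * ?f t = ?g t"
      using insert.hyps by (simp add: algebra_simps)
  qed
  \<comment> \<open>The linear term leaks \<open>B * \<tau>\<close> into the new constant, so
    \<open>I = 0\<close> follows only after \<open>B = 0\<close>.\<close>
  finally have "(1 - e) * B = 0 \<and> B * of_real \<tau> + (1 - e) * I = 0"
    using insert.prems by (intro insert.IH) auto
  then show ?case using \<open>e \<noteq> 1\<close> by auto
qed

lemma sum_extend_union:
  fixes A :: "'a \<Rightarrow> 'b::comm_ring_1"
  assumes "finite Y" "finite Z"
  shows "(\<Sum>z\<in>Y. A z * f z) + (\<Sum>z\<in>Z. B z * f z)
     = (\<Sum>z\<in>Y \<union> Z. ((if z \<in> Y then A z else 0) + (if z \<in> Z then B z else 0)) * f z)"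
proof -
  have "(\<Sum>z\<in>Y. A z * f z) = (\<Sum>z\<in>Y \<union> Z. (if z \<in> Y then A z else 0) * f z)"
    using assms by (intro sum.mono_neutral_cong_left) auto
  moreover have "(\<Sum>z\<in>Z. B z * f z) = (\<Sum>z\<in>Y \<union> Z. (if z \<in> Z then B z else 0) * f z)"
    using assms by (intro sum.mono_neutral_cong_left) auto
  ultimately show ?thesis by (simp add: sum.distrib distrib_right)
qed

text \<open>The substitution of exp (- t) for the cut-off turns its powers into exponentials and its
  logarithm into - t. The difference of two regularisations becomes an exponential sum with limit 0
  at infinity; the exponents are nonzero, so its constant term \<open>J - I\<close> is 0, even if
  some terms oscillate.\<close>

lemma has_finite_part_unique:
  assumes "has_finite_part f a b I" "has_finite_part f a b J"
  shows "I = J"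
proof -
  obtain Y A B where Y: "finite Y" "\<forall>z\<in>Y. Re z \<le> 0 \<and> z \<noteq> 0"
    and limI: "((\<lambda>\<epsilon>. integral {a + \<epsilon>..b - \<epsilon>} f - (\<Sum>z\<in>Y. A z * of_real \<epsilon> powr z) - B * of_real (ln \<epsilon>)) \<longlongrightarrow> I) (at_right 0)"
    using assms(1) unfolding has_finite_part_def by blast
  obtain Z A' B' where Z: "finite Z" "\<forall>z\<in>Z. Re z \<le> 0 \<and> z \<noteq> 0"
    and limJ: "((\<lambda>\<epsilon>. integral {a + \<epsilon>..b - \<epsilon>} f - (\<Sum>z\<in>Z. A' z * of_real \<epsilon> powr z) - B' * of_real (ln \<epsilon>)) \<longlongrightarrow> J) (at_right 0)"
    using assms(2) unfolding has_finite_part_def by blast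
  define D where "D = (\<lambda>z. (if z \<in> Y then A z else 0) + (if z \<in> Z then - A' z else 0))"
  have to_0: "filterlim (\<lambda>t::real. exp (- t)) (at_right 0) at_top"
    unfolding filterlim_at
    by (auto intro!: filterlim_compose[OF exp_at_bot filterlim_uminus_at_bot_at_top])
  have "((\<lambda>\<epsilon>. J - I + (integral {a + \<epsilon>..b - \<epsilon>} f - (\<Sum>z\<in>Y. A z * of_real \<epsilon> powr z) - B * of_real (ln \<epsilon>))
        - (integral {a + \<epsilon>..b - \<epsilon>} f - (\<Sum>z\<in>Z. A' z * of_real \<epsilon> powr z) - B' * of_real (ln \<epsilon>))) \<longlongrightarrow> J - I + I - J)
      (at_right 0)"
    by (intro tendsto_intros limI limJ)
  then have "((\<lambda>\<epsilon>. J - I - (\<Sum>z\<in>Y \<union> Z. D z * of_real \<epsilon> powr z) - (B - B') * of_real (ln \<epsilon>)) \<longlongrightarrow> 0) (at_right 0)"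
    unfolding D_def sum_extend_union[OF Y(1) Z(1), symmetric]
    by (simp add: sum_negf algebra_simps)
  from filterlim_compose[OF this to_0]
  have lim: "((\<lambda>t. J - I - (\<Sum>z\<in>Y \<union> Z. D z * exp (- (z * of_real t))) + (B - B') * of_real t) \<longlongrightarrow> 0) at_top"
    by (simp add: powr_def Ln_of_real)
  have "((\<lambda>t. (\<Sum>z\<in>uminus ` (Y \<union> Z). (- D (- z)) * exp (z * of_real t)) + (B - B') * of_real t + (J - I)) \<longlongrightarrow> 0) at_top"
    using lim by (subst sum.reindex) (auto simp: sum_negf algebra_simps)
  then have "B - B' = 0 \<and> J - I = 0"
    using Y Z by (intro exponential_sum_tendsto_0[of "uminus ` (Y \<union> Z)" "\<lambda>z. - D (- z)"]) auto
  then show ?thesis by simp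
qed

lemma finite_part_eq: "has_finite_part f a b I \<Longrightarrow> finite_part f a b = I"
  unfolding finite_part_def by (rule the_equality) (auto intro: has_finite_part_unique)

lemma has_finite_part_add:
  assumes "has_finite_part f a b I" "has_finite_part g a b J"
    and int: "\<And>\<epsilon>. \<epsilon> > 0 \<Longrightarrow> f integrable_on {a + \<epsilon>..b - \<epsilon>}" "\<And>\<epsilon>. \<epsilon> > 0 \<Longrightarrow> g integrable_on {a + \<epsilon>..b - \<epsilon>}"
  shows "has_finite_part (\<lambda>x. f x + g x) a b (I + J)"
proof -
  obtain Y A B where Y: "finite Y" "\<forall>z\<in>Y. Re z \<le> 0 \<and> z \<noteq> 0"
    and limI: "((\<lambda>\<epsilon>. integral {a + \<epsilon>..b - \<epsilon>} f - (\<Sum>z\<in>Y. A z * of_real \<epsilon> powr z) - B * of_real (ln \<epsilon>)) \<longlongrightarrow> I) (at_right 0)"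
    using assms(1) unfolding has_finite_part_def by blast
  obtain Z A' B' where Z: "finite Z" "\<forall>z\<in>Z. Re z \<le> 0 \<and> z \<noteq> 0"
    and limJ: "((\<lambda>\<epsilon>. integral {a + \<epsilon>..b - \<epsilon>} g - (\<Sum>z\<in>Z. A' z * of_real \<epsilon> powr z) - B' * of_real (ln \<epsilon>)) \<longlongrightarrow> J) (at_right 0)"
    using assms(2) unfolding has_finite_part_def by blast
  define D where "D = (\<lambda>z. (if z \<in> Y then A z else 0) + (if z \<in> Z then A' z else 0))"
  have "((\<lambda>\<epsilon>. (integral {a + \<epsilon>..b - \<epsilon>} f - (\<Sum>z\<in>Y. A z * of_real \<epsilon> powr z) - B * of_real (ln \<epsilon>))
      + (integral {a + \<epsilon>..b - \<epsilon>} g - (\<Sum>z\<in>Z. A' z * of_real \<epsilon> powr z) - B' * of_real (ln \<epsilon>))) \<longlongrightarrow> I + J)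
    (at_right 0)" (is "(?F \<longlongrightarrow> _) _")
    by (intro tendsto_intros limI limJ)
  moreover have "\<forall>\<^sub>F \<epsilon> in at_right 0. ?F \<epsilon> = integral {a + \<epsilon>..b - \<epsilon>} (\<lambda>x. f x + g x)
      - (\<Sum>z\<in>Y \<union> Z. D z * of_real \<epsilon> powr z) - (B + B') * of_real (ln \<epsilon>)"
    using eventually_at_right_less[of 0]
  proof eventually_elim
    case (elim \<epsilon>)
    then have "integral {a + \<epsilon>..b - \<epsilon>} (\<lambda>x. f x + g x) = integral {a + \<epsilon>..b - \<epsilon>} f + integral {a + \<epsilon>..b - \<epsilon>} g"
      by (intro Henstock_Kurzweil_Integration.integral_add int)
    then show ?case
      unfolding D_def sum_extend_union[OF Y(1) Z(1), symmetric] by (simp add: algebra_simps)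
  qed
  ultimately have "((\<lambda>\<epsilon>. integral {a + \<epsilon>..b - \<epsilon>} (\<lambda>x. f x + g x)
      - (\<Sum>z\<in>Y \<union> Z. D z * of_real \<epsilon> powr z) - (B + B') * of_real (ln \<epsilon>)) \<longlongrightarrow> I + J) (at_right 0)"
    by (rule Lim_transform_eventually)
  then show ?thesis
    unfolding has_finite_part_def using Y Z
    by (intro exI[of _ "Y \<union> Z"] exI[of _ D] exI[of _ "B + B'"]) auto
qed

lemma has_finite_part_mult_left:
  assumes "has_finite_part f a b I"
  shows "has_finite_part (\<lambda>x. c * f x) a b (c * I)"
proof -
  obtain Y A B where Y: "finite Y" "\<forall>z\<in>Y. Re z \<le> 0 \<and> z \<noteq> 0"
    and limI: "((\<lambda>\<epsilon>. integral {a + \<epsilon>..b - \<epsilon>} f - (\<Sum>z\<in>Y. A z * of_real \<epsilon> powr z) - B * of_real (ln \<epsilon>)) \<longlongrightarrow> I) (at_right 0)"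
    using assms(1) unfolding has_finite_part_def by blast
  have "((\<lambda>\<epsilon>. integral {a + \<epsilon>..b - \<epsilon>} (\<lambda>x. c * f x) - (\<Sum>z\<in>Y. (c * A z) * of_real \<epsilon> powr z)
      - (c * B) * of_real (ln \<epsilon>)) \<longlongrightarrow> c * I) (at_right 0)"
    using tendsto_mult_left[OF limI, of c]
    by (simp add: right_diff_distrib sum_distrib_left mult.assoc)
  then show ?thesis unfolding has_finite_part_def using Y
    by (intro exI[of _ Y] exI[of _ "\<lambda>z. c * A z"] exI[of _ "c * B"] conjI)
qed

lemma has_finite_part_0: "has_finite_part (\<lambda>x. 0) a b 0"
  unfolding has_finite_part_def by (intro exI[of _ "{}"] exI[of _ "\<lambda>_. 0"] exI[of _ 0]) simp

lemma has_finite_part_sum: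
  assumes "finite S" "\<And>s. s \<in> S \<Longrightarrow> has_finite_part (f s) a b (I s)"
    and "\<And>s \<epsilon>. s \<in> S \<Longrightarrow> \<epsilon> > 0 \<Longrightarrow> f s integrable_on {a + \<epsilon>..b - \<epsilon>}"
  shows "has_finite_part (\<lambda>x. \<Sum>s\<in>S. f s x) a b (\<Sum>s\<in>S. I s)"
  using assms
proof (induction S rule: finite_induct)
  case (insert s S)
  have "has_finite_part (\<lambda>x. f s x + (\<Sum>s\<in>S. f s x)) a b (I s + (\<Sum>s\<in>S. I s))"
    using insert by (intro has_finite_part_add integrable_sum) auto
  then show ?case using insert.hyps by simp
qed (simp add: has_finite_part_0)

lemma has_finite_part_cong:
  assumes "has_finite_part f a b I" "\<And>x. a < x \<Longrightarrow> x < b \<Longrightarrow> f x = g x"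
  shows "has_finite_part g a b I"
proof -
  obtain Y A B where Y: "finite Y" "\<forall>z\<in>Y. Re z \<le> 0 \<and> z \<noteq> 0"
    and limI: "((\<lambda>\<epsilon>. integral {a + \<epsilon>..b - \<epsilon>} f - (\<Sum>z\<in>Y. A z * of_real \<epsilon> powr z) - B * of_real (ln \<epsilon>)) \<longlongrightarrow> I) (at_right 0)"
    using assms(1) unfolding has_finite_part_def by blast
  have "\<forall>\<^sub>F \<epsilon> in at_right 0. integral {a + \<epsilon>..b - \<epsilon>} f - (\<Sum>z\<in>Y. A z * of_real \<epsilon> powr z) - B * of_real (ln \<epsilon>)
     = integral {a + \<epsilon>..b - \<epsilon>} g - (\<Sum>z\<in>Y. A z * of_real \<epsilon> powr z) - B * of_real (ln \<epsilon>)"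
    using eventually_at_right_less[of 0]
  proof eventually_elim
    case (elim \<epsilon>)
    then have "integral {a + \<epsilon>..b - \<epsilon>} f = integral {a + \<epsilon>..b - \<epsilon>} g"
      using assms(2) by (intro Henstock_Kurzweil_Integration.integral_cong) auto
    then show ?case by simp
  qed
  then have "((\<lambda>\<epsilon>. integral {a + \<epsilon>..b - \<epsilon>} g - (\<Sum>z\<in>Y. A z * of_real \<epsilon> powr z) - B * of_real (ln \<epsilon>)) \<longlongrightarrow> I) (at_right 0)"
    using limI by (rule Lim_transform_eventually[rotated])
  then show ?thesis unfolding has_finite_part_def using Y by blast
qed

lemma has_finite_part_continuous:
  assumes "a < b" "continuous_on {a..b} f"
  shows "has_finite_part f a b (integral {a..b} f)"
proof -
  have f: "f integrable_on {a..b}" using assms by (intro integrable_continuous_real)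
  let ?F = "\<lambda>x. integral {a..x} f"
  have "continuous_on {a..b} ?F" by (rule indefinite_integral_continuous_1[OF f])
  note lim = continuous_on_Icc_at_rightD[OF this assms(1)] continuous_on_Icc_at_leftD[OF this assms(1)]
  have "filterlim (\<lambda>\<epsilon>. a + \<epsilon>) (at_right a) (at_right 0)"
    using eventually_at_right_less[of 0]
    by (auto simp: filterlim_at intro!: tendsto_eq_intros elim: eventually_mono)
  then have "((\<lambda>\<epsilon>. ?F (a + \<epsilon>)) \<longlongrightarrow> ?F a) (at_right 0)" by (rule filterlim_compose[OF lim(1)])
  moreover have "filterlim (\<lambda>\<epsilon>. b - \<epsilon>) (at_left b) (at_right 0)"
    using eventually_at_right_less[of 0]
    by (auto simp: filterlim_at intro!: tendsto_eq_intros elim: eventually_mono)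
  then have "((\<lambda>\<epsilon>. ?F (b - \<epsilon>)) \<longlongrightarrow> ?F b) (at_right 0)" by (rule filterlim_compose[OF lim(2)])
  ultimately have "((\<lambda>\<epsilon>. ?F (b - \<epsilon>) - ?F (a + \<epsilon>)) \<longlongrightarrow> ?F b - ?F a) (at_right 0)"
    by (intro tendsto_diff)
  moreover have "\<forall>\<^sub>F \<epsilon> in at_right 0. ?F (b - \<epsilon>) - ?F (a + \<epsilon>) = integral {a + \<epsilon>..b - \<epsilon>} f"
  proof -
    have "\<forall>\<^sub>F \<epsilon> in at_right 0. \<epsilon> < (b - a) / 2"
      using assms(1) by (intro eventually_at_rightI[of 0 "(b - a) / 2"]) auto
    then show ?thesis using eventually_at_right_less[of 0]
    proof eventually_elim
      case (elim \<epsilon>)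
      have "?F (a + \<epsilon>) + integral {a + \<epsilon>..b - \<epsilon>} f = ?F (b - \<epsilon>)"
        using elim by (intro Henstock_Kurzweil_Integration.integral_combine integrable_subinterval_real[OF f])
          (auto simp: field_simps)
      then show ?case by (simp add: algebra_simps)
    qed
  qed
  ultimately have "((\<lambda>\<epsilon>. integral {a + \<epsilon>..b - \<epsilon>} f) \<longlongrightarrow> ?F b - ?F a) (at_right 0)"
    by (rule Lim_transform_eventually)
  then show ?thesis
    unfolding has_finite_part_def by (intro exI[of _ "{}"] exI[of _ "\<lambda>_. 0"] exI[of _ 0]) simp
qed

text \<open>Only the value of \<open>pow_prim z\<close> at the cut-off can misbehave: it is the
  logarithm for \<open>z = -1\<close>, an admissible singular power if Re (z + 1) is at most 0, and
  tends to 0 otherwise. The hypothesis is phrased so that a singularity at either end fits.\<close>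

lemma has_finite_part_pow_prim:
  assumes "a < b"
    and f: "\<And>\<epsilon>. 0 < \<epsilon> \<Longrightarrow> \<epsilon> < (b - a) / 2 \<Longrightarrow> (f has_integral pow_prim z (b - a - \<epsilon>) - pow_prim z \<epsilon>) {a + \<epsilon>..b - \<epsilon>}"
  shows "has_finite_part f a b (pow_prim z (b - a))"
proof -
  have "isCont (pow_prim z) (b - a)"
    using assms(1) pow_prim_has_vector_derivative[of "b - a" z UNIV]
    by (auto intro: has_vector_derivative_continuous)
  moreover have "((\<lambda>\<epsilon>. b - a - \<epsilon>) \<longlongrightarrow> b - a) (at_right 0)" by (auto intro!: tendsto_eq_intros)
  ultimately have top: "((\<lambda>\<epsilon>. pow_prim z (b - a - \<epsilon>)) \<longlongrightarrow> pow_prim z (b - a)) (at_right 0)"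
    by (rule isCont_tendsto_compose)
  have "\<forall>\<^sub>F \<epsilon> in at_right 0. \<epsilon> < (b - a) / 2"
    using assms(1) by (intro eventually_at_rightI[of 0 "(b - a) / 2"]) auto
  then have ev: "\<forall>\<^sub>F \<epsilon> in at_right 0. 0 < \<epsilon> \<and> integral {a + \<epsilon>..b - \<epsilon>} f = pow_prim z (b - a - \<epsilon>) - pow_prim z \<epsilon>"
    using eventually_at_right_less[of 0] by eventually_elim (use f in \<open>auto intro: integral_unique\<close>)
  consider "z = -1" | "z \<noteq> -1" "Re (z + 1) \<le> 0" | "z \<noteq> -1" "Re (z + 1) > 0" by linarith
  then show ?thesis
  proof cases
    case 1
    have "((\<lambda>\<epsilon>. integral {a + \<epsilon>..b - \<epsilon>} f - (\<Sum>z\<in>{}. 0 * of_real \<epsilon> powr z) - (-1) * of_real (ln \<epsilon>)) \<longlongrightarrow> pow_prim z (b - a)) (at_right 0)"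
      using top by (rule Lim_transform_eventually)
        (use ev in \<open>eventually_elim, simp add: pow_prim_def 1\<close>)
    then show ?thesis
      unfolding has_finite_part_def by (intro exI[of _ "{}"] exI[of _ "\<lambda>_. 0"] exI[of _ "-1"]) simp
  next
    case 2
    have "((\<lambda>\<epsilon>. integral {a + \<epsilon>..b - \<epsilon>} f - (\<Sum>w\<in>{z + 1}. (- 1 / (z + 1)) * of_real \<epsilon> powr w) - 0 * of_real (ln \<epsilon>)) \<longlongrightarrow> pow_prim z (b - a)) (at_right 0)"
      using top by (rule Lim_transform_eventually)
        (use ev in \<open>eventually_elim, simp add: pow_prim_def 2\<close>)
    then show ?thesis
      unfolding has_finite_part_def using 2
      by (intro exI[of _ "{z + 1}"] exI[of _ "\<lambda>_. - 1 / (z + 1)"] exI[of _ 0]) (auto simp: eq_neg_iff_add_eq_0)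
  next
    case 3
    have "((\<lambda>\<epsilon>::real. \<epsilon>) \<longlongrightarrow> 0) (at_right 0)" by simp
    then have "((\<lambda>\<epsilon>. \<epsilon> powr Re (z + 1)) \<longlongrightarrow> 0) (at_right (0::real))"
      by (rule tendsto_zero_powrI[OF _ tendsto_const])
        (use 3 in \<open>auto intro: eventually_mono[OF eventually_at_right_less[of 0]]\<close>)
    then have "((\<lambda>\<epsilon>. \<epsilon> powr Re (z + 1) / norm (z + 1)) \<longlongrightarrow> 0 / norm (z + 1)) (at_right (0::real))"
      using 3 by (intro tendsto_divide tendsto_const) (auto simp: eq_neg_iff_add_eq_0)
    moreover have "\<forall>\<^sub>F \<epsilon> in at_right 0. \<epsilon> powr Re (z + 1) / norm (z + 1) = norm (pow_prim z \<epsilon>)"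
      using eventually_at_right_less[of 0]
    proof eventually_elim
      case (elim \<epsilon>)
      then show ?case
        using 3 norm_powr_real_powr[of "of_real \<epsilon>" "z + 1"] by (simp add: pow_prim_def norm_divide)
    qed
    ultimately have "((\<lambda>\<epsilon>. norm (pow_prim z \<epsilon>)) \<longlongrightarrow> 0 / norm (z + 1)) (at_right 0)"
      by (rule Lim_transform_eventually)
    then have "((\<lambda>\<epsilon>. norm (pow_prim z \<epsilon>)) \<longlongrightarrow> 0) (at_right 0)" by simp
    then have "(pow_prim z \<longlongrightarrow> 0) (at_right 0)" by (rule tendsto_norm_zero_cancel)
    then have lim: "((\<lambda>\<epsilon>. pow_prim z (b - a - \<epsilon>) - pow_prim z \<epsilon>) \<longlongrightarrow> pow_prim z (b - a) - 0) (at_right 0)"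
      by (intro tendsto_diff top)
    have "((\<lambda>\<epsilon>. integral {a + \<epsilon>..b - \<epsilon>} f) \<longlongrightarrow> pow_prim z (b - a) - 0) (at_right 0)"
      using lim by (rule Lim_transform_eventually) (use ev in \<open>eventually_elim, simp\<close>)
    then show ?thesis
      unfolding has_finite_part_def by (intro exI[of _ "{}"] exI[of _ "\<lambda>_. 0"] exI[of _ 0]) simp
  qed
qed

text \<open>For each \<open>n\<close> take the largest index up to \<open>n\<close> whose approximation is still consistent with all
  earlier ones.\<close>

lemma diagonal_approximation:
  fixes E :: "nat \<Rightarrow> nat \<Rightarrow> 'a::real_normed_vector"
  assumes "\<And>M. \<exists>C. \<forall>N\<ge>M. \<forall>\<^sub>F n in sequentially. norm (E N n - E M n) \<le> C * g M n"
  shows "\<exists>\<rho>. \<forall>M. \<exists>C. \<forall>\<^sub>F n in sequentially. norm (E M n - \<rho> n) \<le> C * g M n"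
proof -
  \<comment> \<open>One constant \<open>C M\<close> serves all \<open>N \<ge> M\<close>; only the
    threshold in \<open>n\<close> depends on \<open>N\<close>. Consistency in \<open>S\<close> is
    tested against these constants.\<close>
  obtain C where C: "\<And>M N. N \<ge> M \<Longrightarrow> \<forall>\<^sub>F n in sequentially. norm (E N n - E M n) \<le> C M * g M n"
    using assms by metis
  define S where "S = (\<lambda>n. {N. N \<le> n \<and> (\<forall>M\<le>N. norm (E N n - E M n) \<le> C M * g M n)})"
  have fin: "finite (S n)" for n by (rule finite_subset[of _ "{..n}"]) (auto simp: S_def)
  show ?thesis
  proof (intro exI[of _ "\<lambda>n. E (Max (S n)) n"] allI)
    fix M
    have "\<forall>\<^sub>F n in sequentially. \<forall>K\<in>{..M}. norm (E M n - E K n) \<le> C K * g K n"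
      by (intro eventually_ball_finite) (auto intro: C)
    then have "\<forall>\<^sub>F n in sequentially. norm (E M n - E (Max (S n)) n) \<le> C M * g M n"
      using eventually_ge_at_top[of M]
    proof eventually_elim
      case (elim n)
      then have "M \<in> S n" by (simp add: S_def)
      then have "Max (S n) \<in> S n" "M \<le> Max (S n)" using fin by (auto intro: Max_in)
      then show ?case by (simp add: S_def norm_minus_commute)
    qed
    then show "\<exists>C. \<forall>\<^sub>F n in sequentially. norm (E M n - E (Max (S n)) n) \<le> C * g M n" by blast
  qed
qed

section \<open>Riemann sums of powers and functions of bounded variation\<close>

text \<open>What an endpoint power with coefficient 1 contributes to the expansion. Including the
  exponent -1 lets simple poles be treated along with the other powers.\<close>

definition singular_term :: "complex \<Rightarrow> real \<Rightarrow> complex" where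
  "singular_term z h = (if z = -1 then of_real (euler_mascheroni - ln h)
     else riemann_zeta (- z) * of_real h powr (z + 1))"

text \<open>Since L = n h, the rescaled primitive at \<open>n\<close> becomes the primitive at
  \<open>L\<close>, which is the finite part. For \<open>z = -1\<close> the identity ln n = ln L -
  ln h holds instead and produces the term - log h.\<close>

lemma power_sum_scaling:
  assumes "L > 0" "n \<ge> 1"
  defines "h \<equiv> L / real n"
  shows "of_real h powr (z + 1) * (power_sum_constant z + pow_prim z (real n)) = pow_prim z L + singular_term z h"
proof -
  have h: "h > 0" and n: "real n > 0" and L: "L = real n * h" using assms by auto
  show ?thesis
  proof (cases "z = -1")
    case True
    have "ln L = ln (real n) + ln h" unfolding L using h n by (simp add: ln_mult)
    then show ?thesis using True h
      by (simp add: singular_term_def pow_prim_def power_sum_constant_minus_one)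
  next
    case False
    have "of_real L powr (z + 1) = of_real (real n) powr (z + 1) * of_real h powr (z + 1)"
      unfolding L of_real_mult using h by (intro powr_times_real) auto
    then show ?thesis using False
      by (simp add: singular_term_def pow_prim_def riemann_zeta_minus algebra_simps)
  qed
qed

text \<open>The k-th derivative of a power is homogeneous of degree z - k; hence the correction
  terms at \<open>n\<close> turn into ordinary Euler-Maclaurin terms at the far endpoint
  \<open>L\<close>.\<close>

lemma pow_deriv_scaling:
  assumes "L > 0" "n \<ge> 1"
  defines "h \<equiv> L / real n"
  shows "of_real h powr (z + 1) * pow_deriv z k (real n) = of_real (h ^ Suc k) * pow_deriv z k L"
proof -
  have h: "h > 0" and L: "L = real n * h" using assms by auto
  have "of_real L powr (z - of_nat k) = of_real (real n) powr (z - of_nat k) * of_real h powr (z - of_nat k)"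
    unfolding L of_real_mult using h by (intro powr_times_real) auto
  moreover have "of_real h powr (z + 1) = of_real h powr (z - of_nat k) * of_real (h ^ Suc k)"
  proof -
    have "of_real h powr (z + 1) = of_real h powr ((z - of_nat k) + of_nat (Suc k))" by simp
    also have "\<dots> = of_real h powr (z - of_nat k) * of_real h powr of_nat (Suc k)"
      by (rule powr_add)
    also have "of_real h powr of_nat (Suc k) = (of_real h ^ Suc k :: complex)"
      using h by (intro powr_nat') auto
    finally show ?thesis by simp
  qed
  ultimately show ?thesis by (simp add: pow_deriv_def algebra_simps)
qed

text \<open>The Riemann sum is h^(z + 1) times the sum of the j^z, so the error of
  \<open>em_power_sum\<close> gets scaled: h^(Re z + 1) n^(Re z - q + 1) is h^q times a fixed power
  of \<open>L\<close>.\<close>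

lemma power_riemann_sum_error:
  assumes "L > 0" "Re z + 2 \<le> real q"
  shows "\<exists>C. \<forall>n\<ge>1. norm (of_real (L / real n) * (\<Sum>j=1..<n. of_real (real j * (L / real n)) powr z)
      - (pow_prim z L + singular_term z (L / real n))
      + (\<Sum>k\<le>q. of_real (em_right k * (L / real n) ^ Suc k) * pow_deriv z k L)) \<le> C * (L / real n) ^ q"
proof -
  obtain C where C: "C \<ge> 0" "\<And>n z. n \<ge> 1 \<Longrightarrow> Re z + 2 \<le> real q \<Longrightarrow>
     norm (em_power_sum q n z - power_sum_constant z)
       \<le> C * norm (ff z (Suc q)) * real n powr (Re z - real q + 1)"
    using em_power_sum_error[of q] by blast
  show ?thesis
  proof (intro exI[of _ "C * norm (ff z (Suc q)) * L powr (Re z - real q + 1)"] allI impI)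
    fix n :: nat assume n: "n \<ge> 1"
    define h where "h = L / real n"
    have h: "h > 0" and L: "L = real n * h" using assms n by (auto simp: h_def)
    let ?g = "of_real h powr (z + 1)"
    have "of_real h * (\<Sum>j=1..<n. of_real (real j * h) powr z) = ?g * (\<Sum>j=1..<n. of_nat j powr z)"
      unfolding sum_distrib_left
    proof (rule sum.cong)
      fix j assume "j \<in> {1..<n}"
      have "of_real (real j * h) powr z = of_real (real j) powr z * of_real h powr z"
        unfolding of_real_mult using h by (intro powr_times_real) auto
      moreover have "?g = of_real h * of_real h powr z" using h by (simp add: powr_add)
      ultimately show "of_real h * of_real (real j * h) powr z = ?g * of_nat j powr z" by simp
    qed simp
    moreover have "(\<Sum>k\<le>q. of_real (em_right k * h ^ Suc k) * pow_deriv z k L)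
        = ?g * (\<Sum>k\<le>q. em_right k *\<^sub>R pow_deriv z k (real n))"
      unfolding sum_distrib_left
    proof (rule sum.cong)
      fix k
      show "of_real (em_right k * h ^ Suc k) * pow_deriv z k L = ?g * em_right k *\<^sub>R pow_deriv z k (real n)"
        using pow_deriv_scaling[OF assms(1) n, of z k, folded h_def]
        by (simp add: scaleR_conv_of_real mult_ac del: power_Suc)
    qed simp
    moreover note power_sum_scaling[OF assms(1) n, of z, folded h_def]
    ultimately have "of_real h * (\<Sum>j=1..<n. of_real (real j * h) powr z)
      - (pow_prim z L + singular_term z h)
      + (\<Sum>k\<le>q. of_real (em_right k * h ^ Suc k) * pow_deriv z k L)
      = ?g * (em_power_sum q n z - power_sum_constant z)"
      by (simp add: em_power_sum_def algebra_simps)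
    also have "norm \<dots> \<le> h powr (Re z + 1) * (C * norm (ff z (Suc q)) * real n powr (Re z - real q + 1))"
      unfolding norm_mult using h C(2)[OF n assms(2)] norm_powr_real_powr[of "of_real h" "z + 1"]
      by (intro mult_mono) auto
    also have "h powr (Re z + 1) = h powr (Re z - real q + 1) * h ^ q"
      using h by (simp add: powr_realpow[symmetric] flip: powr_add)
    also have "(h powr (Re z - real q + 1) * h ^ q) * (C * norm (ff z (Suc q)) * real n powr (Re z - real q + 1))
        = C * norm (ff z (Suc q)) * L powr (Re z - real q + 1) * h ^ q"
      using h by (simp add: L powr_mult mult_ac)
    finally show "norm (of_real (L / real n) * (\<Sum>j=1..<n. of_real (real j * (L / real n)) powr z)
      - (pow_prim z L + singular_term z (L / real n))
      + (\<Sum>k\<le>q. of_real (em_right k * (L / real n) ^ Suc k) * pow_deriv z k L))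
      \<le> C * norm (ff z (Suc q)) * L powr (Re z - real q + 1) * (L / real n) ^ q"
      by (simp only: h_def)
  qed
qed

lemma step_power_bigo:
  assumes "L > 0" "p \<le> k"
  shows "(\<lambda>n. of_real ((L / real n) ^ k) :: complex) \<in> O(\<lambda>n. of_real ((L / real n) ^ p))"
proof (rule bigoI)
  show "\<forall>\<^sub>F n in sequentially. norm (of_real ((L / real n) ^ k) :: complex) \<le> L ^ (k - p) * norm (of_real ((L / real n) ^ p) :: complex)"
    using eventually_ge_at_top[of 1]
  proof eventually_elim
    case (elim n)
    have "(L / real n) ^ k = (L / real n) ^ (k - p) * (L / real n) ^ p"
      using assms(2) by (simp flip: power_add)
    moreover have "(L / real n) ^ (k - p) \<le> L ^ (k - p)"
      using assms(1) elim by (intro power_mono) (auto simp: field_simps)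
    moreover have "norm (of_real ((L / real n) ^ i) :: complex) = (L / real n) ^ i" for i
      unfolding norm_of_real using assms(1) by simp
    ultimately show ?case
      using assms(1) mult_right_mono[of "(L / real n) ^ (k - p)" "L ^ (k - p)" "(L / real n) ^ p"]
      by (simp del: of_real_power of_real_mult of_real_divide of_real_of_nat_eq)
  qed
qed

lemma power_riemann_sum:
  assumes "L > 0"
  shows "(\<lambda>n. of_real (L / real n) * (\<Sum>j=1..<n. of_real (real j * (L / real n)) powr z)
      - (pow_prim z L + singular_term z (L / real n))
      + (\<Sum>k\<le>q. of_real (em_right k * (L / real n) ^ Suc k) * pow_deriv z k L)) \<in> O(\<lambda>n. of_real ((L / real n) ^ Suc q))"
proof -
  \<comment> \<open>The formula is used at an order \<open>r\<close> that meets the condition on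
    \<open>Re z\<close> and has error h^r no larger than the target; the surplus terms with k > q
    are themselves of the target order and are dropped.\<close>
  define r where "r = q + 1 + nat \<lceil>Re z + 2\<rceil>"
  have r: "Re z + 2 \<le> real r" "q + 1 \<le> r" unfolding r_def by linarith+
  let ?f = "\<lambda>n. of_real (L / real n) * (\<Sum>j=1..<n. of_real (real j * (L / real n)) powr z)
      - (pow_prim z L + singular_term z (L / real n))"
  let ?t = "\<lambda>n k. of_real (em_right k * (L / real n) ^ Suc k) * pow_deriv z k L"
  obtain C where C: "\<And>n. n \<ge> 1 \<Longrightarrow> norm (?f n + (\<Sum>k\<le>r. ?t n k)) \<le> C * (L / real n) ^ r"
    using power_riemann_sum_error[OF assms r(1)] by blast
  have "(\<lambda>n. ?f n + (\<Sum>k\<le>r. ?t n k)) \<in> O(\<lambda>n. of_real ((L / real n) ^ r))"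
  proof (rule bigoI)
    show "\<forall>\<^sub>F n in sequentially. norm (?f n + (\<Sum>k\<le>r. ?t n k)) \<le> C * norm (of_real ((L / real n) ^ r) :: complex)"
      using eventually_ge_at_top[of 1]
      by eventually_elim (use C assms in \<open>simp add: norm_power norm_divide flip: power_divide\<close>)
  qed
  also have "(\<lambda>n. of_real ((L / real n) ^ r) :: complex) \<in> O(\<lambda>n. of_real ((L / real n) ^ Suc q))"
    using r by (intro step_power_bigo assms) auto
  finally have main: "(\<lambda>n. ?f n + (\<Sum>k\<le>r. ?t n k)) \<in> O(\<lambda>n. of_real ((L / real n) ^ Suc q))" .
  have "(\<lambda>n. \<Sum>k\<in>{q<..r}. ?t n k) \<in> O(\<lambda>n. of_real ((L / real n) ^ Suc q))"
  proof (rule big_sum_in_bigo)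
    fix k assume k: "k \<in> {q<..r}"
    have "(\<lambda>n. (of_real (em_right k) * pow_deriv z k L) * of_real ((L / real n) ^ Suc k)) \<in> O(\<lambda>n. of_real ((L / real n) ^ Suc q))"
      using k landau_o.big.mult[OF bigo_const[of "of_real (em_right k) * pow_deriv z k L" sequentially]
          step_power_bigo[OF assms, of "Suc q" "Suc k"]] by simp
    then show "(\<lambda>n. ?t n k) \<in> O(\<lambda>n. of_real ((L / real n) ^ Suc q))"
      by (simp add: mult_ac)
  qed
  from sum_in_bigo(2)[OF main this]
  have "(\<lambda>n. ?f n + (\<Sum>k\<le>r. ?t n k) - (\<Sum>k\<in>{q<..r}. ?t n k)) \<in> O(\<lambda>n. of_real ((L / real n) ^ Suc q))" .
  moreover have "(\<Sum>k\<le>r. ?t n k) - (\<Sum>k\<in>{q<..r}. ?t n k) = (\<Sum>k\<le>q. ?t n k)" for n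
  proof -
    have "{..r} = {..q} \<union> {q<..r}" using r by auto
    then have "(\<Sum>k\<le>r. ?t n k) = (\<Sum>k\<le>q. ?t n k) + (\<Sum>k\<in>{q<..r}. ?t n k)"
      by (simp only:) (rule sum.union_disjoint, auto)
    then show ?thesis by simp
  qed
  ultimately show ?thesis by (simp only: add_diff_eq[symmetric])
qed

text \<open>Bounded variation, encoded by a majorant whose increments dominate those of
  \<open>f\<close> instead of by partitions. This is the form in which errors telescope over a grid;
  increments of \<open>V\<close> are automatically nonnegative on the interval.\<close>

definition bv_on :: "(real \<Rightarrow> complex) \<Rightarrow> real \<Rightarrow> real \<Rightarrow> bool" where
  "bv_on f l r \<longleftrightarrow> (\<exists>V. \<forall>x y. l \<le> x \<and> x \<le> y \<and> y \<le> r \<longrightarrow> norm (f y - f x) \<le> V y - (V x :: real))"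

lemma bv_on_combine:
  assumes "bv_on f l m" "bv_on f m r"
  shows "bv_on f l r"
proof -
  obtain V W where V: "\<And>x y. l \<le> x \<Longrightarrow> x \<le> y \<Longrightarrow> y \<le> m \<Longrightarrow> norm (f y - f x) \<le> V y - V x"
    and W: "\<And>x y. m \<le> x \<Longrightarrow> x \<le> y \<Longrightarrow> y \<le> r \<Longrightarrow> norm (f y - f x) \<le> W y - W x"
    using assms unfolding bv_on_def by blast
  \<comment> \<open>The second majorant is shifted to agree with the first at
    \<open>m\<close>.\<close>
  define U where "U = (\<lambda>x. if x \<le> m then V x else V m + W x - W m)"
  have "norm (f y - f x) \<le> U y - U x" if xy: "l \<le> x" "x \<le> y" "y \<le> r" for x y
  proof -
    consider "y \<le> m" | "m < x" | "x \<le> m" "m < y" by linarith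
    then show ?thesis
    proof cases
      case 3
      have "norm (f y - f x) \<le> norm (f y - f m) + norm (f m - f x)"
        by (rule norm_triangle_sub[of "f y - f x" "f m - f x", simplified, THEN order_trans]) (simp add: add.commute)
      then show ?thesis using V[of x m] W[of m y] 3 xy by (auto simp: U_def)
    qed (use V W xy in \<open>auto simp: U_def\<close>)
  qed
  then show ?thesis unfolding bv_on_def by blast
qed

lemma bv_on_diff:
  assumes "bv_on f l r" "bv_on g l r"
  shows "bv_on (\<lambda>x. f x - g x) l r"
proof -
  obtain V W where V: "\<And>x y. l \<le> x \<Longrightarrow> x \<le> y \<Longrightarrow> y \<le> r \<Longrightarrow> norm (f y - f x) \<le> V y - V x"
    and W: "\<And>x y. l \<le> x \<Longrightarrow> x \<le> y \<Longrightarrow> y \<le> r \<Longrightarrow> norm (g y - g x) \<le> W y - W x"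
    using assms unfolding bv_on_def by blast
  have "norm ((f y - g y) - (f x - g x)) \<le> (V y + W y) - (V x + W x)"
    if "l \<le> x" "x \<le> y" "y \<le> r" for x y
    using V[OF that] W[OF that] norm_triangle_ineq4[of "f y - f x" "g y - g x"] by (simp add: algebra_simps)
  then show ?thesis unfolding bv_on_def by (intro exI[of _ "\<lambda>x. V x + W x"]) auto
qed

lemma bv_on_cong:
  assumes "bv_on f l r" "\<And>x. l \<le> x \<Longrightarrow> x \<le> r \<Longrightarrow> f x = g x"
  shows "bv_on g l r"
proof -
  obtain V where "\<And>x y. l \<le> x \<Longrightarrow> x \<le> y \<Longrightarrow> y \<le> r \<Longrightarrow> norm (f y - f x) \<le> V y - V x"
    using assms unfolding bv_on_def by blast
  then show ?thesis unfolding bv_on_def using assms(2) by (intro exI[of _ V]) auto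
qed

lemma bv_on_bounded_derivative:
  assumes "continuous_on {l..r} f"
    and "\<And>t. l < t \<Longrightarrow> t < r \<Longrightarrow> (f has_vector_derivative f' t) (at t)"
    and "\<And>t. l < t \<Longrightarrow> t < r \<Longrightarrow> norm (f' t) \<le> M"
  shows "bv_on f l r"
  unfolding bv_on_def
proof (intro exI[of _ "\<lambda>x. M * x"] allI impI)
  fix x y assume xy: "l \<le> x \<and> x \<le> y \<and> y \<le> r"
  show "norm (f y - f x) \<le> M * y - M * x"
    by (rule norm_diff_le_vector_derivative_bound[where f' = f'])
      (use assms xy in \<open>auto intro: continuous_on_subset\<close>)
qed

lemma bv_on_C1:
  assumes "\<And>t. l \<le> t \<Longrightarrow> t \<le> r \<Longrightarrow> (f has_vector_derivative f' t) (at t)"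
    and "continuous_on {l..r} f'"
  shows "bv_on f l r"
proof -
  have "bounded (f' ` {l..r})"
    using assms(2) by (intro compact_imp_bounded compact_continuous_image) auto
  then obtain M where M: "\<And>t. t \<in> {l..r} \<Longrightarrow> norm (f' t) \<le> M"
    unfolding bounded_iff by blast
  show ?thesis
  proof (rule bv_on_bounded_derivative[where f' = f' and M = M])
    show "continuous_on {l..r} f"
      by (rule continuous_on_vector_derivative[OF has_vector_derivative_at_within]) (use assms(1) in auto)
  qed (use assms M in auto)
qed

text \<open>The majorant is the indefinite integral of the norm of the p-th derivative; the second
  clause of \<open>abs_integrable_deriv\<close> expresses the increments as integrals.\<close>

lemma bv_on_abs_integrable_deriv:
  assumes "abs_integrable_deriv p f l r" "l \<le> l'" "r' \<le> r"
  shows "bv_on (nderiv (p - 1) f) l' r'"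
  unfolding bv_on_def
proof (intro exI[of _ "\<lambda>x. integral {l..x} (\<lambda>t. norm (nderiv p f t))"] allI impI)
  fix x y assume "l' \<le> x \<and> x \<le> y \<and> y \<le> r'"
  then have xy: "l \<le> x" "x \<le> y" "y \<le> r" using assms by auto
  have abs: "nderiv p f absolutely_integrable_on {l..r}"
    and eq: "\<And>x. x \<in> {l..r} \<Longrightarrow> nderiv (p - 1) f x - nderiv (p - 1) f l = integral {l..x} (nderiv p f)"
    using assms(1) by (auto simp: abs_integrable_deriv_def)
  have i1: "nderiv p f integrable_on {l..r}"
    using abs by (rule set_lebesgue_integral_eq_integral(1))
  have i2: "(\<lambda>t. norm (nderiv p f t)) integrable_on {l..r}"
    using abs by (simp add: absolutely_integrable_on_def)
  have "integral {l..x} (nderiv p f) + integral {x..y} (nderiv p f) = integral {l..y} (nderiv p f)"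
    using xy by (intro Henstock_Kurzweil_Integration.integral_combine integrable_subinterval_real[OF i1]) auto
  then have "nderiv (p - 1) f y - nderiv (p - 1) f x = integral {x..y} (nderiv p f)"
    using eq[of x] eq[of y] xy by (simp add: algebra_simps)
  also have "norm \<dots> \<le> integral {x..y} (\<lambda>t. norm (nderiv p f t))"
    using xy by (intro integral_norm_bound_integral integrable_subinterval_real[OF i1]
        integrable_subinterval_real[OF i2]) auto
  also have "\<dots> = integral {l..y} (\<lambda>t. norm (nderiv p f t)) - integral {l..x} (\<lambda>t. norm (nderiv p f t))"
  proof -
    have "integral {l..x} (\<lambda>t. norm (nderiv p f t)) + integral {x..y} (\<lambda>t. norm (nderiv p f t))
        = integral {l..y} (\<lambda>t. norm (nderiv p f t))"
      using xy by (intro Henstock_Kurzweil_Integration.integral_combine integrable_subinterval_real[OF i2]) auto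
    then show ?thesis by simp
  qed
  finally show "norm (nderiv (p - 1) f y - nderiv (p - 1) f x)
    \<le> integral {l..y} (\<lambda>t. norm (nderiv p f t)) - integral {l..x} (\<lambda>t. norm (nderiv p f t))" .
qed

section \<open>Iterated derivatives of the endpoint powers\<close>

lemma nderiv_0 [simp]: "nderiv 0 f = f"
  and nderiv_Suc: "nderiv (Suc k) f x = vector_derivative (nderiv k f) (at x)"
  by (simp_all add: nderiv_def)

text \<open>\<open>nderiv\<close> is computed from the function on neighbourhoods, and the endpoint
  powers have the expected derivatives on one side only. Openness of \<open>S\<close> carries the
  identification from one order to the next.\<close>

lemma nderiv_eq_on_open:
  assumes "open S" "x \<in> S" "\<And>y. y \<in> S \<Longrightarrow> f y = g 0 y"
    and "\<And>k y. y \<in> S \<Longrightarrow> (g k has_vector_derivative g (Suc k) y) (at y)"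
  shows "nderiv k f x = g k x"
  using assms(2)
proof (induction k arbitrary: x)
  case 0
  then show ?case using assms(3) by simp
next
  case (Suc k)
  have "(nderiv k f has_vector_derivative g (Suc k) x) (at x)"
    using has_vector_derivative_transform_within_open[OF assms(4)[OF Suc.prems] assms(1) Suc.prems] Suc.IH by auto
  then show ?case by (simp add: nderiv_Suc vector_derivative_at)
qed

definition left_deriv :: "real \<Rightarrow> complex \<Rightarrow> nat \<Rightarrow> real \<Rightarrow> complex" where
  "left_deriv a z k x = pow_deriv z k (x - a)"

definition right_deriv :: "real \<Rightarrow> complex \<Rightarrow> nat \<Rightarrow> real \<Rightarrow> complex" where
  "right_deriv b z k x = (-1) ^ k * pow_deriv z k (b - x)"

lemma left_deriv_has_vector_derivative:
  assumes "a < x"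
  shows "(left_deriv a z k has_vector_derivative left_deriv a z (Suc k) x) (at x within S)"
proof -
  have "((\<lambda>x. x - a) has_vector_derivative 1) (at x)"
    by (auto intro!: derivative_eq_intros)
  from vector_diff_chain_at[OF this pow_deriv_has_vector_derivative[of "x - a" z k UNIV]] assms
  show ?thesis
    by (simp add: o_def left_deriv_def[abs_def] has_vector_derivative_at_within)
qed

lemma right_deriv_has_vector_derivative:
  assumes "x < b"
  shows "(right_deriv b z k has_vector_derivative right_deriv b z (Suc k) x) (at x within S)"
proof -
  have "((\<lambda>x. b - x) has_vector_derivative -1) (at x)"
    by (auto intro!: derivative_eq_intros)
  from vector_diff_chain_at[OF this pow_deriv_has_vector_derivative[of "b - x" z k UNIV]] assms
  have "((\<lambda>x. pow_deriv z k (b - x)) has_vector_derivative - pow_deriv z (Suc k) (b - x)) (at x)"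
    by (simp add: o_def)
  from has_vector_derivative_mult_right[OF this, of "(-1) ^ k"] show ?thesis
    by (simp add: right_deriv_def[abs_def] has_vector_derivative_at_within)
qed

lemma nderiv_left_power:
  assumes "a < x"
  shows "nderiv k (\<lambda>y. c * of_real (y - a) powr z) x = c * left_deriv a z k x"
proof (rule nderiv_eq_on_open[of "{a<..}" x _ "\<lambda>k x. c * left_deriv a z k x"])
  show "((\<lambda>x. c * left_deriv a z k x) has_vector_derivative c * left_deriv a z (Suc k) y) (at y)"
    if "y \<in> {a<..}" for k y
    using that by (intro has_vector_derivative_mult_right left_deriv_has_vector_derivative) auto
qed (use assms in \<open>auto simp: left_deriv_def pow_deriv_def\<close>)

lemma nderiv_right_power:
  assumes "x < b"
  shows "nderiv k (\<lambda>y. c * of_real (b - y) powr z) x = c * right_deriv b z k x"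
proof (rule nderiv_eq_on_open[of "{..<b}" x _ "\<lambda>k x. c * right_deriv b z k x"])
  show "((\<lambda>x. c * right_deriv b z k x) has_vector_derivative c * right_deriv b z (Suc k) y) (at y)"
    if "y \<in> {..<b}" for k y
    using that by (intro has_vector_derivative_mult_right right_deriv_has_vector_derivative) auto
qed (use assms in \<open>auto simp: right_deriv_def pow_deriv_def\<close>)

lemma divide_eq_powr_minus_one: "K / z = K * z powr (-1)" for z :: complex
  by (cases "z = 0") (auto simp: powr_minus field_simps)

section \<open>Functions with matching singular parts\<close>

lemma has_finite_part_left_power:
  assumes "a < b"
  shows "has_finite_part (left_deriv a z 0) a b (pow_prim z (b - a))"
proof (rule has_finite_part_pow_prim[OF assms])
  fix \<epsilon> :: real assume e: "0 < \<epsilon>" "\<epsilon> < (b - a) / 2"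
  have "(left_deriv a z 0 has_integral pow_prim z (b - \<epsilon> - a) - pow_prim z (a + \<epsilon> - a)) {a + \<epsilon>..b - \<epsilon>}"
  proof (rule fundamental_theorem_of_calculus)
    show "a + \<epsilon> \<le> b - \<epsilon>" using e by (simp add: field_simps)
    fix x assume x: "x \<in> {a + \<epsilon>..b - \<epsilon>}"
    have "((\<lambda>x. x - a) has_vector_derivative 1) (at x)"
      by (auto intro!: derivative_eq_intros)
    from vector_diff_chain_at[OF this pow_prim_has_vector_derivative[of "x - a" z UNIV]] x e
    show "((\<lambda>x. pow_prim z (x - a)) has_vector_derivative left_deriv a z 0 x) (at x within {a + \<epsilon>..b - \<epsilon>})"
      by (simp add: o_def left_deriv_def has_vector_derivative_at_within)
  qed
  then show "(left_deriv a z 0 has_integral pow_prim z (b - a - \<epsilon>) - pow_prim z \<epsilon>) {a + \<epsilon>..b - \<epsilon>}"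
    by (simp add: algebra_simps)
qed

lemma has_finite_part_right_power:
  assumes "a < b"
  shows "has_finite_part (right_deriv b z 0) a b (pow_prim z (b - a))"
proof (rule has_finite_part_pow_prim[OF assms])
  fix \<epsilon> :: real assume e: "0 < \<epsilon>" "\<epsilon> < (b - a) / 2"
  have "(right_deriv b z 0 has_integral - pow_prim z (b - (b - \<epsilon>)) - - pow_prim z (b - (a + \<epsilon>))) {a + \<epsilon>..b - \<epsilon>}"
  proof (rule fundamental_theorem_of_calculus)
    show "a + \<epsilon> \<le> b - \<epsilon>" using e by (simp add: field_simps)
    fix x assume x: "x \<in> {a + \<epsilon>..b - \<epsilon>}"
    have "((\<lambda>x. b - x) has_vector_derivative -1) (at x)"
      by (auto intro!: derivative_eq_intros)
    from vector_diff_chain_at[OF this pow_prim_has_vector_derivative[of "b - x" z UNIV]] x e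
    have "((\<lambda>x. pow_prim z (b - x)) has_vector_derivative - right_deriv b z 0 x) (at x within {a + \<epsilon>..b - \<epsilon>})"
      by (simp add: o_def right_deriv_def has_vector_derivative_at_within)
    from has_vector_derivative_minus[OF this]
    show "((\<lambda>x. - pow_prim z (b - x)) has_vector_derivative right_deriv b z 0 x) (at x within {a + \<epsilon>..b - \<epsilon>})"
      by simp
  qed
  then show "(right_deriv b z 0 has_integral pow_prim z (b - a - \<epsilon>) - pow_prim z \<epsilon>) {a + \<epsilon>..b - \<epsilon>}"
    by (simp add: algebra_simps)
qed

lemma continuous_on_left_deriv [continuous_intros]:
  "(\<And>x. x \<in> S \<Longrightarrow> a < x) \<Longrightarrow> continuous_on S (left_deriv a z k)"
  by (rule continuous_on_vector_derivative[OF left_deriv_has_vector_derivative])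

lemma continuous_on_right_deriv [continuous_intros]:
  "(\<And>x. x \<in> S \<Longrightarrow> x < b) \<Longrightarrow> continuous_on S (right_deriv b z k)"
  by (rule continuous_on_vector_derivative[OF right_deriv_has_vector_derivative])

text \<open>The boundary values in \<open>w\<close> are forced: at \<open>a\<close> the difference
  of \<open>v\<close> and \<open>A\<close> tends to 0, which leaves \<open>- B\<close>, and
  symmetrically at \<open>b\<close>. Then \<open>w\<close> is covered by the grid formula and
  \<open>A\<close>, \<open>B\<close> by the sums of powers. Bounded variation is demanded only given
  continuity of \<open>w\<close>, because it is proved by pieces that reach up to the
  endpoints.\<close>

lemma riemann_sum_expansion:
  fixes v :: "nat \<Rightarrow> real \<Rightarrow> complex" and \<alpha> \<beta> y z :: "nat \<Rightarrow> complex"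
    and a b :: real and m m' q :: nat
  defines "A \<equiv> \<lambda>k x. \<Sum>s<m. \<alpha> s * left_deriv a (y s) k x"
    and "B \<equiv> \<lambda>k x. \<Sum>s<m'. \<beta> s * right_deriv b (z s) k x"
  defines "w \<equiv> \<lambda>k x. if x \<le> a then - B k a else if b \<le> x then - A k b else v k x - A k x - B k x"
  assumes ab: "a < b"
    and vd: "\<And>k x. k < q \<Longrightarrow> a < x \<Longrightarrow> x < b \<Longrightarrow> (v k has_vector_derivative v (Suc k) x) (at x)"
    and vc: "\<And>k x. k \<le> q \<Longrightarrow> a < x \<Longrightarrow> x < b \<Longrightarrow> isCont (v k) x"
    and la: "\<And>k. k \<le> q \<Longrightarrow> ((\<lambda>x. v k x - A k x) \<longlongrightarrow> 0) (at_right a)"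
    and lb: "\<And>k. k \<le> q \<Longrightarrow> ((\<lambda>x. v k x - B k x) \<longlongrightarrow> 0) (at_left b)"
    and bv: "(\<And>k. k \<le> q \<Longrightarrow> continuous_on {a..b} (w k)) \<Longrightarrow> bv_on (w q) a b"
  shows "\<exists>I. has_finite_part (v 0) a b I \<and>
    (\<lambda>n. of_real ((b - a) / real n) * (\<Sum>j=1..<n. v 0 (a + real j * ((b - a) / real n))) - I
      - (\<Sum>s<m. \<alpha> s * singular_term (y s) ((b - a) / real n))
      - (\<Sum>s<m'. \<beta> s * singular_term (z s) ((b - a) / real n)))
    \<in> O(\<lambda>n. of_real (((b - a) / real n) ^ Suc q))"
proof -
  define L where "L = b - a"
  have L: "L > 0" using ab by (simp add: L_def)
  define h where "h = (\<lambda>n. L / real n)"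
  have A_der: "(A k has_vector_derivative A (Suc k) x) (at x)" if "a < x" for k x
    unfolding A_def using that
    by (intro has_vector_derivative_sum has_vector_derivative_mult_right left_deriv_has_vector_derivative)
  have B_der: "(B k has_vector_derivative B (Suc k) x) (at x)" if "x < b" for k x
    unfolding B_def using that
    by (intro has_vector_derivative_sum has_vector_derivative_mult_right right_deriv_has_vector_derivative)
  have A_cont: "isCont (A k) x" if "a < x" for k x
    using A_der[OF that] by (rule has_vector_derivative_continuous)
  have B_cont: "isCont (B k) x" if "x < b" for k x
    using B_der[OF that] by (rule has_vector_derivative_continuous)
  have w_cont: "continuous_on {a..b} (w k)" if k: "k \<le> q" for k
  proof (rule continuous_on_IccI)
    have "((\<lambda>x. (v k x - A k x) - B k x) \<longlongrightarrow> 0 - B k a) (at_right a)"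
      using B_cont[OF ab] by (intro tendsto_diff la k) (auto simp: isCont_def intro: tendsto_within_subset)
    moreover have "\<forall>\<^sub>F x in at_right a. (v k x - A k x) - B k x = w k x"
      using eventually_at_right_real[OF ab] by eventually_elim (auto simp: w_def)
    ultimately show "(w k \<longlongrightarrow> w k a) (at_right a)"
      by (simp add: w_def Lim_transform_eventually)
    have "((\<lambda>x. (v k x - B k x) - A k x) \<longlongrightarrow> 0 - A k b) (at_left b)"
      using A_cont[OF ab] by (intro tendsto_diff lb k) (auto simp: isCont_def intro: tendsto_within_subset)
    moreover have "\<forall>\<^sub>F x in at_left b. (v k x - B k x) - A k x = w k x"
      using eventually_at_left_real[OF ab] by eventually_elim (auto simp: w_def)
    ultimately show "(w k \<longlongrightarrow> w k b) (at_left b)"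
      using ab by (simp add: w_def Lim_transform_eventually)
    fix x assume x: "a < x" "x < b"
    have "((\<lambda>x. v k x - A k x - B k x) \<longlongrightarrow> v k x - A k x - B k x) (at x)"
      using A_cont[OF x(1)] B_cont[OF x(2)] vc[OF k x] by (intro tendsto_diff) (auto simp: isCont_def)
    moreover have "\<forall>\<^sub>F x in at x. v k x - A k x - B k x = w k x"
      using eventually_at_in_open'[of "{a<..<b}" x] x by (auto simp: w_def elim: eventually_mono)
    ultimately show "(w k \<longlongrightarrow> w k x) (at x)"
      using x by (simp add: w_def Lim_transform_eventually)
  qed (rule ab)
  have w_der: "(w k has_vector_derivative w (Suc k) x) (at x)" if k: "k < q" and x: "a < x" "x < b" for k x
  proof -
    have "((\<lambda>x. v k x - A k x - B k x) has_vector_derivative v (Suc k) x - A (Suc k) x - B (Suc k) x) (at x)"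
      using k x by (intro has_vector_derivative_diff vd A_der B_der)
    then have "(w k has_vector_derivative v (Suc k) x - A (Suc k) x - B (Suc k) x) (at x)"
      by (rule has_vector_derivative_transform_within_open[of _ _ _ "{a<..<b}"]) (use x in \<open>auto simp: w_def\<close>)
    then show ?thesis using x by (simp add: w_def)
  qed
  have left_end: "left_deriv a (y s) k b = pow_deriv (y s) k L" for s k
    by (simp add: left_deriv_def L_def)
  have right_end: "right_deriv b (z s) k a = (-1) ^ k * pow_deriv (z s) k L" for s k
    by (simp add: right_deriv_def L_def)

  \<comment> \<open>The finite part of \<open>v 0\<close> is the ordinary integral of
    \<open>w 0\<close> plus the finite parts of the subtracted powers.\<close>
  define I where "I = integral {a..b} (w 0) + (\<Sum>s<m. \<alpha> s * pow_prim (y s) L) + (\<Sum>s<m'. \<beta> s * pow_prim (z s) L)"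
  have fp: "has_finite_part (v 0) a b I"
  proof (rule has_finite_part_cong)
    have iw: "w 0 integrable_on {a + \<epsilon>..b - \<epsilon>}" if "\<epsilon> > 0" for \<epsilon>
      using that w_cont[of 0] by (intro integrable_continuous_real) (auto intro: continuous_on_subset)
    have il: "(\<lambda>x. \<alpha> s * left_deriv a (y s) 0 x) integrable_on {a + \<epsilon>..b - \<epsilon>}" if "\<epsilon> > 0" for \<epsilon> s
      using that by (intro integrable_continuous_real continuous_intros) auto
    have ir: "(\<lambda>x. \<beta> s * right_deriv b (z s) 0 x) integrable_on {a + \<epsilon>..b - \<epsilon>}" if "\<epsilon> > 0" for \<epsilon> s
      using that by (intro integrable_continuous_real continuous_intros) auto
    show "has_finite_part (\<lambda>x. w 0 x + A 0 x + B 0 x) a b I"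
      unfolding I_def A_def B_def
      by (intro has_finite_part_add has_finite_part_sum has_finite_part_mult_left has_finite_part_continuous
          integrable_add integrable_sum iw il ir ab w_cont
          has_finite_part_left_power[OF ab, folded L_def] has_finite_part_right_power[OF ab, folded L_def]) auto
    show "w 0 x + A 0 x + B 0 x = v 0 x" if "a < x" "x < b" for x
      using that by (simp add: w_def)
  qed

  let ?O = "O(\<lambda>n. of_real (h n ^ Suc q) :: complex)"
  let ?X = "\<lambda>n j. a + real j * h n"
  have "(\<lambda>n. integral {a..b} (w 0) - h n *\<^sub>R (\<Sum>j=1..<n. w 0 (?X n j))
        - (\<Sum>k\<le>q. h n ^ Suc k *\<^sub>R (em_right k *\<^sub>R w k b - em_left k *\<^sub>R w k a))) \<in> ?O"
  proof -
    obtain C where C: "\<forall>(w :: nat \<Rightarrow> real \<Rightarrow> complex) V a b n. a < b \<longrightarrow> n \<ge> 1 \<longrightarrow>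
       (\<forall>k\<le>q. continuous_on {a..b} (w k)) \<longrightarrow>
       (\<forall>k<q. \<forall>x. a < x \<and> x < b \<longrightarrow> (w k has_vector_derivative w (Suc k) x) (at x)) \<longrightarrow>
       (\<forall>x y. a \<le> x \<and> x \<le> y \<and> y \<le> b \<longrightarrow> norm (w q y - w q x) \<le> V y - V x) \<longrightarrow>
       norm (integral {a..b} (w 0)
          - ((b - a) / real n) *\<^sub>R (\<Sum>j=1..<n. w 0 (a + real j * ((b - a) / real n)))
          - (\<Sum>k\<le>q. ((b - a) / real n) ^ Suc k *\<^sub>R (em_right k *\<^sub>R w k b - em_left k *\<^sub>R w k a)))
        \<le> C * ((b - a) / real n) ^ Suc q * (V b - V a)"
      using euler_maclaurin_grid[of q] by blast
    obtain V where V: "\<And>x y. a \<le> x \<and> x \<le> y \<and> y \<le> b \<Longrightarrow> norm (w q y - w q x) \<le> V y - V x"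
      using bv w_cont unfolding bv_on_def by blast
    show ?thesis
    proof (rule bigoI)
      show "\<forall>\<^sub>F n in sequentially. norm (integral {a..b} (w 0) - h n *\<^sub>R (\<Sum>j=1..<n. w 0 (?X n j))
        - (\<Sum>k\<le>q. h n ^ Suc k *\<^sub>R (em_right k *\<^sub>R w k b - em_left k *\<^sub>R w k a)))
          \<le> (C * (V b - V a)) * norm (of_real (h n ^ Suc q) :: complex)"
        using eventually_ge_at_top[of 1]
      proof eventually_elim
        case (elim n)
        have "norm (of_real (h n ^ Suc q) :: complex) = h n ^ Suc q"
          unfolding norm_of_real using L by (simp add: h_def)
        moreover have "norm (integral {a..b} (w 0) - h n *\<^sub>R (\<Sum>j=1..<n. w 0 (?X n j))
          - (\<Sum>k\<le>q. h n ^ Suc k *\<^sub>R (em_right k *\<^sub>R w k b - em_left k *\<^sub>R w k a)))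
            \<le> C * h n ^ Suc q * (V b - V a)"
          unfolding h_def L_def
          by (rule C[rule_format, OF ab elim]) (use w_cont w_der V in auto)
        ultimately show ?case by (simp only: mult_ac)
      qed
    qed
  qed
  then have W: "(\<lambda>n. - (integral {a..b} (w 0) - h n *\<^sub>R (\<Sum>j=1..<n. w 0 (?X n j))
        - (\<Sum>k\<le>q. h n ^ Suc k *\<^sub>R (em_right k *\<^sub>R w k b - em_left k *\<^sub>R w k a)))) \<in> ?O"
    by (simp only: landau_o.big.uminus_in_iff)
  let ?P = "\<lambda>x n. of_real (h n) * (\<Sum>j=1..<n. of_real (real j * h n) powr x)
      - (pow_prim x L + singular_term x (h n))
      + (\<Sum>k\<le>q. of_real (em_right k * h n ^ Suc k) * pow_deriv x k L)"
  have P: "(\<lambda>n. c * ?P x n) \<in> ?O" for c x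
  proof -
    have "(\<lambda>n. ?P x n) \<in> ?O" unfolding h_def by (rule power_riemann_sum[OF L])
    from landau_o.big.mult[OF bigo_const[of c sequentially] this] show ?thesis
      by (simp only: mult_1)
  qed
  have total: "(\<lambda>n. - (integral {a..b} (w 0) - h n *\<^sub>R (\<Sum>j=1..<n. w 0 (?X n j))
        - (\<Sum>k\<le>q. h n ^ Suc k *\<^sub>R (em_right k *\<^sub>R w k b - em_left k *\<^sub>R w k a)))
      + (\<Sum>s<m. \<alpha> s * ?P (y s) n) + (\<Sum>s<m'. \<beta> s * ?P (z s) n)) \<in> ?O"
    by (intro sum_in_bigo(1) W big_sum_in_bigo P)

  have split: "of_real (h n) * (\<Sum>j=1..<n. v 0 (?X n j)) = h n *\<^sub>R (\<Sum>j=1..<n. w 0 (?X n j))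
      + (\<Sum>s<m. \<alpha> s * (of_real (h n) * (\<Sum>j=1..<n. of_real (real j * h n) powr y s)))
      + (\<Sum>s<m'. \<beta> s * (of_real (h n) * (\<Sum>j=1..<n. of_real (real j * h n) powr z s)))" for n
  proof -
    have X: "a < ?X n j" "?X n j < b" "b - ?X n j = real (n - j) * h n" if "j \<in> {1..<n}" for j
    proof -
      have hn: "h n > 0" using L that by (simp add: h_def)
      then show "a < ?X n j" using that by simp
      have b: "b = a + real n * h n" using that by (simp add: h_def L_def)
      have "real j * h n < real n * h n" using hn that by simp
      then show "?X n j < b" using b by linarith
      show "b - ?X n j = real (n - j) * h n" using that unfolding b by (simp add: algebra_simps of_nat_diff)
    qed
    have v0: "v 0 x = w 0 x + A 0 x + B 0 x" if "a < x" "x < b" for x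
      using that by (simp add: w_def)
    have "(\<Sum>j=1..<n. v 0 (?X n j)) = (\<Sum>j=1..<n. w 0 (?X n j) + A 0 (?X n j) + B 0 (?X n j))"
      using v0 X(1,2) by (intro sum.cong) auto
    moreover have "(\<Sum>j=1..<n. A 0 (?X n j)) = (\<Sum>s<m. \<alpha> s * (\<Sum>j=1..<n. of_real (real j * h n) powr y s))"
      unfolding A_def sum_distrib_left by (subst sum.swap) (simp add: left_deriv_def pow_deriv_def)
    moreover have "(\<Sum>j=1..<n. B 0 (?X n j)) = (\<Sum>s<m'. \<beta> s * (\<Sum>j=1..<n. of_real (real j * h n) powr z s))"
    proof -
      have "(\<Sum>j=1..<n. B 0 (?X n j)) = (\<Sum>s<m'. \<beta> s * (\<Sum>j=1..<n. of_real (b - ?X n j) powr z s))"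
        unfolding B_def sum_distrib_left by (subst sum.swap) (simp add: right_deriv_def pow_deriv_def)
      \<comment> \<open>The grid is symmetric: the distance from \<open>b\<close> to node
        \<open>j\<close> is the distance from \<open>a\<close> to node \<open>n - j\<close>.\<close>
      moreover have "(\<Sum>j=1..<n. of_real (b - ?X n j) powr z s) = (\<Sum>j=1..<n. of_real (real j * h n) powr z s)" for s
        by (rule sum.reindex_bij_witness[of _ "\<lambda>j. n - j" "\<lambda>j. n - j"]) (use X in auto)
      ultimately show ?thesis by simp
    qed
    ultimately show ?thesis
      by (simp add: sum.distrib distrib_left scaleR_conv_of_real sum_distrib_left mult.left_commute)
  qed
  \<comment> \<open>The correction terms of the powers in \<open>A\<close> sit at their far endpoint
    \<open>b\<close>, where \<open>w k\<close> is \<open>- A k b\<close>, and cancel directly. Those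
    in \<open>B\<close> sit at \<open>a\<close>; there \<open>em_left_reflect\<close> supplies a
    sign (-1)^k that offsets the one in \<open>right_deriv\<close>.\<close>
  have boundary: "(\<Sum>k\<le>q. h n ^ Suc k *\<^sub>R (em_right k *\<^sub>R w k b - em_left k *\<^sub>R w k a))
      + (\<Sum>s<m. \<alpha> s * (\<Sum>k\<le>q. of_real (em_right k * h n ^ Suc k) * pow_deriv (y s) k L))
      + (\<Sum>s<m'. \<beta> s * (\<Sum>k\<le>q. of_real (em_right k * h n ^ Suc k) * pow_deriv (z s) k L)) = 0" for n
  proof -
    have swap: "(\<Sum>s<i. \<xi> s * (\<Sum>k\<le>q. of_real (em_right k * h n ^ Suc k) * pow_deriv (x s) k L))
       = (\<Sum>k\<le>q. of_real (em_right k * h n ^ Suc k) * (\<Sum>s<i. \<xi> s * pow_deriv (x s) k L))"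
      for i and \<xi> x :: "nat \<Rightarrow> complex"
      unfolding sum_distrib_left by (subst sum.swap) (simp add: mult_ac)
    show ?thesis
      unfolding swap sum.distrib[symmetric]
    proof (rule sum.neutral, safe)
      fix k
      have wb: "w k b = - (\<Sum>s<m. \<alpha> s * pow_deriv (y s) k L)"
        using ab by (simp add: w_def A_def left_end)
      have wa: "w k a = - ((-1) ^ k * (\<Sum>s<m'. \<beta> s * pow_deriv (z s) k L))"
        by (simp add: w_def B_def right_end sum_distrib_left mult_ac)
      show "h n ^ Suc k *\<^sub>R (em_right k *\<^sub>R w k b - em_left k *\<^sub>R w k a)
        + of_real (em_right k * h n ^ Suc k) * (\<Sum>s<m. \<alpha> s * pow_deriv (y s) k L)
        + of_real (em_right k * h n ^ Suc k) * (\<Sum>s<m'. \<beta> s * pow_deriv (z s) k L) = 0"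
        unfolding wa wb by (simp add: em_left_reflect scaleR_conv_of_real algebra_simps flip: power_add mult_2)
    qed
  qed
  have "(\<lambda>n. of_real (h n) * (\<Sum>j=1..<n. v 0 (?X n j)) - I
      - (\<Sum>s<m. \<alpha> s * singular_term (y s) (h n)) - (\<Sum>s<m'. \<beta> s * singular_term (z s) (h n))) \<in> ?O"
  proof (rule landau_o.big.in_cong[THEN iffD1, OF always_eventually total], rule allI)
    fix n
    show "- (integral {a..b} (w 0) - h n *\<^sub>R (\<Sum>j=1..<n. w 0 (?X n j))
        - (\<Sum>k\<le>q. h n ^ Suc k *\<^sub>R (em_right k *\<^sub>R w k b - em_left k *\<^sub>R w k a)))
      + (\<Sum>s<m. \<alpha> s * ?P (y s) n) + (\<Sum>s<m'. \<beta> s * ?P (z s) n)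
      = of_real (h n) * (\<Sum>j=1..<n. v 0 (?X n j)) - I
      - (\<Sum>s<m. \<alpha> s * singular_term (y s) (h n)) - (\<Sum>s<m'. \<beta> s * singular_term (z s) (h n))"
      using boundary[of n] unfolding split I_def
      by (simp only: distrib_left right_diff_distrib sum.distrib sum_subtractf) (simp add: algebra_simps)
  qed
  then show ?thesis using fp unfolding h_def L_def by blast
qed

section \<open>The asymptotic expansion\<close>

lemma bounded_right_neighbourhood:
  fixes g :: "real \<Rightarrow> 'a::real_normed_vector"
  assumes "\<forall>\<^sub>F x in at_right a. norm (g x) \<le> C" "\<And>x. a < x \<Longrightarrow> x \<le> l \<Longrightarrow> isCont g x"
  shows "\<exists>M. \<forall>x. a < x \<and> x \<le> l \<longrightarrow> norm (g x) \<le> M"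
proof -
  obtain d where d: "d > a" "\<And>x. a < x \<Longrightarrow> x < d \<Longrightarrow> norm (g x) \<le> C"
    using assms(1) unfolding eventually_at_right_field by blast
  have "continuous_on {d..l} g"
    using assms(2) d(1) by (intro continuous_at_imp_continuous_on) auto
  then have "bounded (g ` {d..l})"
    by (intro compact_imp_bounded compact_continuous_image) auto
  then obtain M where M: "\<And>x. x \<in> {d..l} \<Longrightarrow> norm (g x) \<le> M"
    unfolding bounded_iff by blast
  show ?thesis
  proof (intro exI[of _ "max C M"] allI impI)
    fix x assume "a < x \<and> x \<le> l"
    then show "norm (g x) \<le> max C M" using d(2)[of x] M[of x] by (cases "x < d") auto
  qed
qed

lemma bounded_left_neighbourhood:
  fixes g :: "real \<Rightarrow> 'a::real_normed_vector"
  assumes "\<forall>\<^sub>F x in at_left b. norm (g x) \<le> C" "\<And>x. r \<le> x \<Longrightarrow> x < b \<Longrightarrow> isCont g x"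
  shows "\<exists>M. \<forall>x. r \<le> x \<and> x < b \<longrightarrow> norm (g x) \<le> M"
proof -
  obtain d where d: "d < b" "\<And>x. d < x \<Longrightarrow> x < b \<Longrightarrow> norm (g x) \<le> C"
    using assms(1) unfolding eventually_at_left_field by blast
  have "continuous_on {r..d} g"
    using assms(2) d(1) by (intro continuous_at_imp_continuous_on) auto
  then have "bounded (g ` {r..d})"
    by (intro compact_imp_bounded compact_continuous_image) auto
  then obtain M where M: "\<And>x. x \<in> {r..d} \<Longrightarrow> norm (g x) \<le> M"
    unfolding bounded_iff by blast
  show ?thesis
  proof (intro exI[of _ "max C M"] allI impI)
    fix x assume "r \<le> x \<and> x < b"
    then show "norm (g x) \<le> max C M" using d(2)[of x] M[of x] by (cases "d < x") auto
  qed
qed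

text \<open>The simple pole is treated as one more power, with exponent \<open>-1\<close>, put in front of the sequence.\<close>

lemma expansion_left_bound:
  assumes "expansion_left k f a K c \<gamma>"
  shows "\<exists>C. \<forall>\<^sub>F x in at_right a. norm (nderiv k f x
    - (\<Sum>s<Suc N. case_nat K c s * left_deriv a (case_nat (-1) \<gamma> s) k x)) \<le> C * (x - a) powr (Re (\<gamma> N) - real k)"
proof -
  have "(\<lambda>x. norm (nderiv k f x - nderiv k (\<lambda>y. K / of_real (y - a)) x
              - (\<Sum>s<N. nderiv k (\<lambda>y. c s * of_real (y - a) powr \<gamma> s) x)))
          \<in> O[at_right a](\<lambda>x. (x - a) powr (Re (\<gamma> N) - real k))"
    using assms unfolding expansion_left_def by blast
  then obtain C where "\<forall>\<^sub>F x in at_right a. norm (norm (nderiv k f x - nderiv k (\<lambda>y. K / of_real (y - a)) x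
      - (\<Sum>s<N. nderiv k (\<lambda>y. c s * of_real (y - a) powr \<gamma> s) x))) \<le> C * norm ((x - a) powr (Re (\<gamma> N) - real k))"
    by (elim landau_o.bigE) auto
  then have "\<forall>\<^sub>F x in at_right a. norm (nderiv k f x
      - (\<Sum>s<Suc N. case_nat K c s * left_deriv a (case_nat (-1) \<gamma> s) k x)) \<le> C * (x - a) powr (Re (\<gamma> N) - real k)"
    using eventually_at_right_less[of a]
  proof eventually_elim
    case (elim x)
    then show ?case
      unfolding divide_eq_powr_minus_one nderiv_left_power[OF elim(2)] sum.lessThan_Suc_shift
      by (simp add: algebra_simps)
  qed
  then show ?thesis by blast
qed

lemma expansion_right_bound:
  assumes "expansion_right k f b L d \<delta>"
  shows "\<exists>C. \<forall>\<^sub>F x in at_left b. norm (nderiv k f x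
    - (\<Sum>s<Suc N. case_nat L d s * right_deriv b (case_nat (-1) \<delta> s) k x)) \<le> C * (b - x) powr (Re (\<delta> N) - real k)"
proof -
  have "(\<lambda>x. norm (nderiv k f x - nderiv k (\<lambda>y. L / of_real (b - y)) x
              - (\<Sum>s<N. nderiv k (\<lambda>y. d s * of_real (b - y) powr \<delta> s) x)))
          \<in> O[at_left b](\<lambda>x. (b - x) powr (Re (\<delta> N) - real k))"
    using assms unfolding expansion_right_def by blast
  then obtain C where "\<forall>\<^sub>F x in at_left b. norm (norm (nderiv k f x - nderiv k (\<lambda>y. L / of_real (b - y)) x
      - (\<Sum>s<N. nderiv k (\<lambda>y. d s * of_real (b - y) powr \<delta> s) x))) \<le> C * norm ((b - x) powr (Re (\<delta> N) - real k))"
    by (elim landau_o.bigE) auto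
  moreover have "\<forall>\<^sub>F x in at_left b. x < b"
    using lt_ex by (auto simp: eventually_at_left_field)
  ultimately have "\<forall>\<^sub>F x in at_left b. norm (nderiv k f x
      - (\<Sum>s<Suc N. case_nat L d s * right_deriv b (case_nat (-1) \<delta> s) k x)) \<le> C * (b - x) powr (Re (\<delta> N) - real k)"
  proof eventually_elim
    case (elim x)
    then show ?case
      unfolding divide_eq_powr_minus_one nderiv_right_power[OF elim(2)] sum.lessThan_Suc_shift
      by (simp add: algebra_simps)
  qed
  then show ?thesis by blast
qed

section \<open>Limits and bounds at the endpoints from power estimates\<close>

lemma tendsto_0_at_right_powr_bound:
  fixes f :: "real \<Rightarrow> 'a::real_normed_vector"
  assumes "\<forall>\<^sub>F x in at_right a. norm (f x) \<le> C * (x - a) powr e" "e > 0"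
  shows "(f \<longlongrightarrow> 0) (at_right a)"
proof (rule Lim_null_comparison[OF assms(1)])
  have "((\<lambda>x. x - a) \<longlongrightarrow> 0) (at_right a)" by (auto intro!: tendsto_eq_intros)
  then have "((\<lambda>x. (x - a) powr e) \<longlongrightarrow> 0) (at_right a)"
    by (rule tendsto_zero_powrI[OF _ tendsto_const])
      (use assms(2) in \<open>auto intro: eventually_mono[OF eventually_at_right_less[of a]]\<close>)
  from tendsto_mult_left[OF this, of C] show "((\<lambda>x. C * (x - a) powr e) \<longlongrightarrow> 0) (at_right a)" by simp
qed

lemma tendsto_0_at_left_powr_bound:
  fixes f :: "real \<Rightarrow> 'a::real_normed_vector"
  assumes "\<forall>\<^sub>F x in at_left b. norm (f x) \<le> C * (b - x) powr e" "e > 0"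
  shows "(f \<longlongrightarrow> 0) (at_left b)"
proof (rule Lim_null_comparison[OF assms(1)])
  have "((\<lambda>x. b - x) \<longlongrightarrow> 0) (at_left b)" by (auto intro!: tendsto_eq_intros)
  moreover have "\<forall>\<^sub>F x in at_left b. 0 \<le> b - x"
    using lt_ex by (auto simp: eventually_at_left_field)
  ultimately have "((\<lambda>x. (b - x) powr e) \<longlongrightarrow> 0) (at_left b)"
    by (intro tendsto_zero_powrI[OF _ tendsto_const]) (use assms(2) in auto)
  from tendsto_mult_left[OF this, of C] show "((\<lambda>x. C * (b - x) powr e) \<longlongrightarrow> 0) (at_left b)" by simp
qed

lemma bounded_at_right_powr_bound:
  assumes "\<forall>\<^sub>F x in at_right a. norm (f x) \<le> C * (x - a) powr e" "e > 0"
  shows "\<forall>\<^sub>F x in at_right a. norm (f x) \<le> 1"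
  using tendsto_norm_zero[OF tendsto_0_at_right_powr_bound[OF assms]]
  by (auto dest!: order_tendstoD(2)[of _ _ _ 1] elim: eventually_mono)

lemma bounded_at_left_powr_bound:
  assumes "\<forall>\<^sub>F x in at_left b. norm (f x) \<le> C * (b - x) powr e" "e > 0"
  shows "\<forall>\<^sub>F x in at_left b. norm (f x) \<le> 1"
  using tendsto_norm_zero[OF tendsto_0_at_left_powr_bound[OF assms]]
  by (auto dest!: order_tendstoD(2)[of _ _ _ 1] elim: eventually_mono)

text \<open>The condition on \<open>N\<close> makes the remainder exponents positive up to order
  \<open>p\<close>: the derivatives of order below \<open>p\<close> then have the limits required
  for continuity of \<open>w\<close>, and the one of order \<open>p\<close> stays bounded near the
  endpoints, which gives bounded variation there.\<close>

lemma truncated_expansion: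
  fixes u :: "real \<Rightarrow> complex" and c d \<gamma> \<delta> :: "nat \<Rightarrow> complex"
  assumes ab: "a < a2" "a2 < b2" "b2 < b" and p: "p \<ge> 1"
    and Cinf: "Cinf_on u ({a<..<a2} \<union> {b2<..<b})"
    and Ck: "Ck_on (p - 1) u {a2..b2}"
    and abs: "\<exists>\<eta>>0. abs_integrable_deriv p u (a2 - \<eta>) (b2 + \<eta>)"
    and left: "\<And>k. expansion_left k u a K c \<gamma>"
    and right: "\<And>k. expansion_right k u b L d \<delta>"
    and N: "Re (\<gamma> N) > real p" "Re (\<delta> N) > real p"
  shows "\<exists>I. has_finite_part u a b I \<and>
    (\<lambda>n. of_real ((b - a) / real n) * (\<Sum>j=1..<n. u (a + real j * ((b - a) / real n))) - I
      - (\<Sum>s<Suc N. case_nat K c s * singular_term (case_nat (-1) \<gamma> s) ((b - a) / real n))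
      - (\<Sum>s<Suc N. case_nat L d s * singular_term (case_nat (-1) \<delta> s) ((b - a) / real n)))
    \<in> O(\<lambda>n. of_real (((b - a) / real n) ^ p))"
proof -
  define q where "q = p - 1"
  have q: "p = Suc q" using p by (simp add: q_def)
  define A where "A = (\<lambda>k x. \<Sum>s<Suc N. case_nat K c s * left_deriv a (case_nat (-1) \<gamma> s) k x)"
  define B where "B = (\<lambda>k x. \<Sum>s<Suc N. case_nat L d s * right_deriv b (case_nat (-1) \<delta> s) k x)"
  define w where "w = (\<lambda>k x. if x \<le> a then - B k a else if b \<le> x then - A k b else nderiv k u x - A k x - B k x)"
  have a_lt_b: "a < b" using ab by linarith
  \<comment> \<open>Away from [a2, b2] every order is available, on [a2, b2] only orders below
    \<open>q\<close>; the derivatives are two-sided at \<open>a2\<close> and \<open>b2\<close> as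
    well.\<close>
  have diff: "nderiv k u differentiable (at x)" if "a < x" "x < b" "k < q \<or> x < a2 \<or> b2 < x" for k x
  proof (cases "x < a2 \<or> b2 < x")
    case True
    then have "x \<in> {a<..<a2} \<union> {b2<..<b}" using that ab by auto
    then show ?thesis using Cinf unfolding Cinf_on_def Ck_on_def by (meson lessI)
  next
    case False
    then show ?thesis using that Ck unfolding Ck_on_def q_def by auto
  qed
  have vd: "(nderiv k u has_vector_derivative nderiv (Suc k) u x) (at x)"
    if "a < x" "x < b" "k < q \<or> x < a2 \<or> b2 < x" for k x
    using diff[OF that] by (simp add: nderiv_Suc vector_derivative_works)
  have vc: "isCont (nderiv k u) x" if "a < x" "x < b" "k \<le> q \<or> x < a2 \<or> b2 < x" for k x
  proof (cases "k < q \<or> x < a2 \<or> b2 < x")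
    case True
    then show ?thesis using vd[OF that(1,2)] has_vector_derivative_continuous by blast
  next
    case False
    then show ?thesis using that Ck unfolding Ck_on_def q_def by auto
  qed
  have A_der: "(A k has_vector_derivative A (Suc k) x) (at x)" if "a < x" for k x
    unfolding A_def using that
    by (intro has_vector_derivative_sum has_vector_derivative_mult_right left_deriv_has_vector_derivative)
  have B_der: "(B k has_vector_derivative B (Suc k) x) (at x)" if "x < b" for k x
    unfolding B_def using that
    by (intro has_vector_derivative_sum has_vector_derivative_mult_right right_deriv_has_vector_derivative)
  have A_cont: "isCont (A k) x" if "a < x" for k x
    using A_der[OF that] by (rule has_vector_derivative_continuous)
  have B_cont: "isCont (B k) x" if "x < b" for k x
    using B_der[OF that] by (rule has_vector_derivative_continuous)
  have la: "\<exists>C. \<forall>\<^sub>F x in at_right a. norm (nderiv k u x - A k x) \<le> C * (x - a) powr (Re (\<gamma> N) - real k)" for k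
    unfolding A_def by (rule expansion_left_bound[OF left])
  have lb: "\<exists>C. \<forall>\<^sub>F x in at_left b. norm (nderiv k u x - B k x) \<le> C * (b - x) powr (Re (\<delta> N) - real k)" for k
    unfolding B_def by (rule expansion_right_bound[OF right])
  have w_der: "(w q has_vector_derivative nderiv p u x - A p x - B p x) (at x)"
    if x: "a < x" "x < b" "x < a2 \<or> b2 < x" for x
  proof -
    have "((\<lambda>x. nderiv q u x - A q x - B q x) has_vector_derivative nderiv p u x - A p x - B p x) (at x)"
      unfolding q using x by (intro has_vector_derivative_diff vd A_der B_der) auto
    then show ?thesis
      by (rule has_vector_derivative_transform_within_open[of _ _ _ "{a<..<b}"]) (use x in \<open>auto simp: w_def\<close>)
  qed
  have bv: "bv_on (w q) a b" if w_cont: "continuous_on {a..b} (w q)"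
  proof -
    obtain \<eta> where \<eta>: "\<eta> > 0" "abs_integrable_deriv p u (a2 - \<eta>) (b2 + \<eta>)" using abs by blast
    \<comment> \<open>Smoothness on (a, a2) does not bound the p-th derivative as x tends to
      \<open>a2\<close> from the left, so the middle piece has to reach beyond \<open>a2\<close>,
      inside the margin \<open>\<eta>\<close>. The midpoint keeps \<open>l\<close> away from
      \<open>a\<close>; \<open>r\<close> is chosen likewise.\<close>
    define l where "l = max (a2 - \<eta>) ((a + a2) / 2)"
    define r where "r = min (b2 + \<eta>) ((b2 + b) / 2)"
    have l: "a < l" "l < a2" "a2 - \<eta> \<le> l" using ab \<eta> by (auto simp: l_def max_def field_simps)
    have r: "b2 < r" "r < b" "r \<le> b2 + \<eta>" using ab \<eta> by (auto simp: r_def min_def field_simps)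
    have "bv_on (w q) a l"
    proof -
      obtain C where "\<forall>\<^sub>F x in at_right a. norm (nderiv p u x - A p x) \<le> C * (x - a) powr (Re (\<gamma> N) - real p)"
        using la by blast
      then have "\<forall>\<^sub>F x in at_right a. norm (nderiv p u x - A p x) \<le> 1"
        by (rule bounded_at_right_powr_bound) (use N in simp)
      moreover have "isCont (\<lambda>x. nderiv p u x - A p x) x" if "a < x" "x \<le> l" for x
        using that l r ab by (intro isCont_diff vc A_cont) auto
      ultimately obtain M where M: "\<And>x. a < x \<Longrightarrow> x \<le> l \<Longrightarrow> norm (nderiv p u x - A p x) \<le> M"
        using bounded_right_neighbourhood[where a = a and l = l and C = 1 and g = "\<lambda>x. nderiv p u x - A p x"] by blast
      have "continuous_on {a..l} (B p)"
        using B_cont l ab by (intro continuous_at_imp_continuous_on) auto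
      then have "bounded (B p ` {a..l})"
        by (intro compact_imp_bounded compact_continuous_image) auto
      then obtain M' where M': "\<And>x. x \<in> {a..l} \<Longrightarrow> norm (B p x) \<le> M'"
        unfolding bounded_iff by blast
      show ?thesis
      proof (rule bv_on_bounded_derivative)
        show "continuous_on {a..l} (w q)"
          using w_cont by (rule continuous_on_subset) (use l ab in auto)
        fix t assume t: "a < t" "t < l"
        show "(w q has_vector_derivative nderiv p u t - A p t - B p t) (at t)"
          using t l ab by (intro w_der) auto
        show "norm (nderiv p u t - A p t - B p t) \<le> M + M'"
          using norm_triangle_ineq4[of "nderiv p u t - A p t" "B p t"] M[of t] M'[of t] t by auto
      qed
    qed
    moreover have "bv_on (w q) l r"
    proof (rule bv_on_cong)
      have "bv_on (nderiv q u) l r"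
        unfolding q_def using \<eta>(2) l(3) r(3) by (rule bv_on_abs_integrable_deriv)
      moreover have "bv_on (A q) l r"
        using l A_cont by (intro bv_on_C1[where f' = "A (Suc q)"] A_der continuous_at_imp_continuous_on) auto
      moreover have "bv_on (B q) l r"
        using r B_cont by (intro bv_on_C1[where f' = "B (Suc q)"] B_der continuous_at_imp_continuous_on) auto
      ultimately show "bv_on (\<lambda>x. nderiv q u x - A q x - B q x) l r"
        by (intro bv_on_diff)
      show "nderiv q u x - A q x - B q x = w q x" if "l \<le> x" "x \<le> r" for x
        using that l r by (simp add: w_def)
    qed
    moreover have "bv_on (w q) r b"
    proof -
      obtain C where "\<forall>\<^sub>F x in at_left b. norm (nderiv p u x - B p x) \<le> C * (b - x) powr (Re (\<delta> N) - real p)"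
        using lb by blast
      then have "\<forall>\<^sub>F x in at_left b. norm (nderiv p u x - B p x) \<le> 1"
        by (rule bounded_at_left_powr_bound) (use N in simp)
      moreover have "isCont (\<lambda>x. nderiv p u x - B p x) x" if "r \<le> x" "x < b" for x
        using that l r ab by (intro isCont_diff vc B_cont) auto
      ultimately obtain M where M: "\<And>x. r \<le> x \<Longrightarrow> x < b \<Longrightarrow> norm (nderiv p u x - B p x) \<le> M"
        using bounded_left_neighbourhood[where b = b and r = r and C = 1 and g = "\<lambda>x. nderiv p u x - B p x"] by blast
      have "continuous_on {r..b} (A p)"
        using A_cont r ab by (intro continuous_at_imp_continuous_on) auto
      then have "bounded (A p ` {r..b})"
        by (intro compact_imp_bounded compact_continuous_image) auto
      then obtain M' where M': "\<And>x. x \<in> {r..b} \<Longrightarrow> norm (A p x) \<le> M'"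
        unfolding bounded_iff by blast
      show ?thesis
      proof (rule bv_on_bounded_derivative)
        show "continuous_on {r..b} (w q)"
          using w_cont by (rule continuous_on_subset) (use r ab in auto)
        fix t assume t: "r < t" "t < b"
        show "(w q has_vector_derivative nderiv p u t - A p t - B p t) (at t)"
          using t r ab by (intro w_der) auto
        show "norm (nderiv p u t - A p t - B p t) \<le> M + M'"
          using norm_triangle_ineq4[of "nderiv p u t - B p t" "A p t"] M[of t] M'[of t] t
          by (auto simp: algebra_simps)
      qed
    qed
    ultimately show ?thesis by (blast intro: bv_on_combine)
  qed
  have "\<exists>I. has_finite_part (nderiv 0 u) a b I \<and>
    (\<lambda>n. of_real ((b - a) / real n) * (\<Sum>j=1..<n. nderiv 0 u (a + real j * ((b - a) / real n))) - I
      - (\<Sum>s<Suc N. case_nat K c s * singular_term (case_nat (-1) \<gamma> s) ((b - a) / real n))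
      - (\<Sum>s<Suc N. case_nat L d s * singular_term (case_nat (-1) \<delta> s) ((b - a) / real n)))
    \<in> O(\<lambda>n. of_real (((b - a) / real n) ^ Suc q))"
  proof (rule riemann_sum_expansion[OF a_lt_b, where v = "\<lambda>k. nderiv k u"])
    fix k assume "k \<le> q"
    then have k: "Re (\<gamma> N) - real k > 0" "Re (\<delta> N) - real k > 0" using N q by auto
    have "((\<lambda>x. nderiv k u x - A k x) \<longlongrightarrow> 0) (at_right a)"
      using la[of k] k(1) by (elim exE) (rule tendsto_0_at_right_powr_bound)
    then show "((\<lambda>x. nderiv k u x - (\<Sum>s<Suc N. case_nat K c s * left_deriv a (case_nat (-1) \<gamma> s) k x)) \<longlongrightarrow> 0) (at_right a)"
      unfolding A_def .
    have "((\<lambda>x. nderiv k u x - B k x) \<longlongrightarrow> 0) (at_left b)"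
      using lb[of k] k(2) by (elim exE) (rule tendsto_0_at_left_powr_bound)
    then show "((\<lambda>x. nderiv k u x - (\<Sum>s<Suc N. case_nat L d s * right_deriv b (case_nat (-1) \<delta> s) k x)) \<longlongrightarrow> 0) (at_left b)"
      unfolding B_def .
  next
    assume "\<And>k. k \<le> q \<Longrightarrow> continuous_on {a..b}
      (\<lambda>x. if x \<le> a then - (\<Sum>s<Suc N. case_nat L d s * right_deriv b (case_nat (-1) \<delta> s) k a)
        else if b \<le> x then - (\<Sum>s<Suc N. case_nat K c s * left_deriv a (case_nat (-1) \<gamma> s) k b)
        else nderiv k u x - (\<Sum>s<Suc N. case_nat K c s * left_deriv a (case_nat (-1) \<gamma> s) k x)
          - (\<Sum>s<Suc N. case_nat L d s * right_deriv b (case_nat (-1) \<delta> s) k x))"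
    from this[of q] show "bv_on
      (\<lambda>x. if x \<le> a then - (\<Sum>s<Suc N. case_nat L d s * right_deriv b (case_nat (-1) \<delta> s) q a)
        else if b \<le> x then - (\<Sum>s<Suc N. case_nat K c s * left_deriv a (case_nat (-1) \<gamma> s) q b)
        else nderiv q u x - (\<Sum>s<Suc N. case_nat K c s * left_deriv a (case_nat (-1) \<gamma> s) q x)
          - (\<Sum>s<Suc N. case_nat L d s * right_deriv b (case_nat (-1) \<delta> s) q x)) a b"
      using bv unfolding w_def A_def B_def by blast
  qed (use vd vc in auto)
  then show ?thesis unfolding q nderiv_0 .
qed

text \<open>The point is a constant independent of \<open>N\<close>. Only finitely many exponents
  lie less than 1 above that of index \<open>M\<close>; every later term has an extra factor
  \<open>h n\<close>, which makes the sum of all of these small once \<open>n\<close> is large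
  depending on \<open>N\<close>.\<close>

lemma power_series_tail_bound:
  fixes t \<gamma> :: "nat \<Rightarrow> complex" and h :: "nat \<Rightarrow> real"
  assumes inc: "incseq (\<lambda>s. Re (\<gamma> s))" and top: "filterlim (\<lambda>s. Re (\<gamma> s)) at_top sequentially"
    and h: "h \<longlonglongrightarrow> 0" "\<And>n. n \<ge> 1 \<Longrightarrow> h n > 0"
  shows "\<exists>C. \<forall>N\<ge>M. \<forall>\<^sub>F n in sequentially.
    norm (\<Sum>s=M..<N. t s * of_real (h n) powr (\<gamma> s + 1)) \<le> C * h n powr (Re (\<gamma> M) + 1)"
proof -
  obtain M' where M': "\<And>s. s \<ge> M' \<Longrightarrow> Re (\<gamma> s) \<ge> Re (\<gamma> M) + 1"
    using top unfolding filterlim_at_top eventually_at_top_linorder by blast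
  \<comment> \<open>The summand 1 pays for all terms that carry the extra factor
    \<open>h n\<close>.\<close>
  define C where "C = (\<Sum>s<M'. norm (t s)) + 1"
  show ?thesis
  proof (intro exI[of _ C] allI impI)
    fix N assume "M \<le> N"
    let ?S = "\<Sum>s=M..<N. norm (t s)"
    have "(\<lambda>n. h n * ?S) \<longlonglongrightarrow> 0 * ?S" by (intro tendsto_intros h)
    then have "\<forall>\<^sub>F n in sequentially. h n * ?S < 1" by (intro order_tendstoD) auto
    moreover have "\<forall>\<^sub>F n in sequentially. h n < 1" using h(1) by (intro order_tendstoD) auto
    ultimately show "\<forall>\<^sub>F n in sequentially.
      norm (\<Sum>s=M..<N. t s * of_real (h n) powr (\<gamma> s + 1)) \<le> C * h n powr (Re (\<gamma> M) + 1)"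
      using eventually_ge_at_top[of 1]
    proof eventually_elim
      case (elim n)
      have hn: "h n > 0" using h(2) elim by blast
      let ?e = "h n powr (Re (\<gamma> M) + 1)"
      have "norm (\<Sum>s=M..<N. t s * of_real (h n) powr (\<gamma> s + 1))
          \<le> (\<Sum>s=M..<N. ((if s < M' then norm (t s) else 0) + h n * norm (t s)) * ?e)"
      proof (rule sum_norm_le)
        fix s assume s: "s \<in> {M..<N}"
        have "norm (t s * of_real (h n) powr (\<gamma> s + 1)) = norm (t s) * h n powr (Re (\<gamma> s) + 1)"
          using hn norm_powr_real_powr[of "of_real (h n)" "\<gamma> s + 1"] by (simp add: norm_mult)
        also have "\<dots> \<le> ((if s < M' then norm (t s) else 0) + h n * norm (t s)) * ?e"
        proof (cases "s < M'")
          case True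
          have "Re (\<gamma> M) \<le> Re (\<gamma> s)" using s inc by (auto simp: incseq_def)
          then have "norm (t s) * h n powr (Re (\<gamma> s) + 1) \<le> norm (t s) * ?e"
            using hn elim by (intro mult_left_mono powr_mono') auto
          moreover have "0 \<le> h n * norm (t s) * ?e" using hn by simp
          ultimately show ?thesis using True by (simp add: distrib_right)
        next
          case False
          have "h n powr (Re (\<gamma> s) + 1) \<le> h n powr (1 + (Re (\<gamma> M) + 1))"
            using hn elim M'[of s] False by (intro powr_mono') auto
          also have "\<dots> = h n * ?e" using hn by (subst powr_add) simp
          finally have "norm (t s) * h n powr (Re (\<gamma> s) + 1) \<le> norm (t s) * (h n * ?e)"
            by (intro mult_left_mono) auto
          then show ?thesis using False by (simp add: mult_ac)
        qed
        finally show "norm (t s * of_real (h n) powr (\<gamma> s + 1))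
          \<le> ((if s < M' then norm (t s) else 0) + h n * norm (t s)) * ?e" .
      qed
      also have "\<dots> = ((\<Sum>s=M..<N. if s < M' then norm (t s) else 0) + h n * ?S) * ?e"
        by (simp add: sum_distrib_right sum_distrib_left sum.distrib distrib_right)
      also have "\<dots> \<le> C * ?e"
      proof (intro mult_right_mono)
        have "(\<Sum>s=M..<N. if s < M' then norm (t s) else 0) = (\<Sum>s\<in>{s \<in> {M..<N}. s < M'}. norm (t s))"
          by (rule sum.inter_filter[symmetric]) simp
        also have "\<dots> \<le> (\<Sum>s<M'. norm (t s))" by (rule sum_mono2) auto
        finally show "(\<Sum>s=M..<N. if s < M' then norm (t s) else 0) + h n * ?S \<le> C"
          using elim by (simp add: C_def)
      qed simp
      finally show ?case .
    qed
  qed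
qed

lemma singular_term_sum:
  assumes "\<And>s. \<gamma> s \<noteq> -1"
  shows "(\<Sum>s<Suc N. case_nat K c s * singular_term (case_nat (-1) \<gamma> s) h)
    = K * of_real (euler_mascheroni - ln h) + (\<Sum>s<N. c s * riemann_zeta (- \<gamma> s) * of_real h powr (\<gamma> s + 1))"
  unfolding sum.lessThan_Suc_shift using assms by (simp add: singular_term_def mult.assoc)

text \<open>The excluded exponents are those at which zeta has its trivial zeros, so the terms left
  out are 0.\<close>

lemma sum_omit_trivial_zeros:
  fixes N :: nat
  shows
  "(\<Sum>s\<in>{s. s < N \<and> \<gamma> s \<notin> positive_even}. c s * riemann_zeta (- \<gamma> s) * f s)
    = (\<Sum>s<N. c s * riemann_zeta (- \<gamma> s) * f s)"
  by (rule sum.mono_neutral_left) (auto simp: riemann_zeta_trivial_zero)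

lemma step_powr_sum_bigo:
  fixes h :: "nat \<Rightarrow> real"
  assumes h: "h \<longlonglongrightarrow> 0" "\<And>n. n \<ge> 1 \<Longrightarrow> h n > 0" and e: "e \<ge> real p" "e' \<ge> real p" and "C \<ge> 0"
  shows "\<forall>\<^sub>F n in sequentially. C * (h n powr e + h n powr e') \<le> 2 * C * h n ^ p"
proof -
  have "\<forall>\<^sub>F n in sequentially. h n < 1" using h(1) by (intro order_tendstoD) auto
  then show ?thesis using eventually_ge_at_top[of 1]
  proof eventually_elim
    case (elim n)
    have hn: "h n > 0" using h(2) elim by blast
    have "h n powr x \<le> h n ^ p" if "x \<ge> real p" for x
      using powr_mono'[of "real p" x "h n"] that hn elim by (simp add: powr_realpow)
    then have "h n powr e + h n powr e' \<le> 2 * h n ^ p" using e by (smt (verit))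
    from mult_left_mono[OF this \<open>C \<ge> 0\<close>] show ?case by (simp add: mult_ac)
  qed
qed

theorem theoremA3:
  fixes a b a2 b2 :: real and p :: nat
    and u :: "real \<Rightarrow> complex"
    and K L :: complex
    and c d \<gamma> \<delta> :: "nat \<Rightarrow> complex"
    and h :: "nat \<Rightarrow> real"
  assumes "a < a2" "a2 < b2" "b2 < b"
    and "p \<ge> 1"
    and "Cinf_on u ({a<..<a2} \<union> {b2<..<b})"
    and "Ck_on (p - 1) u {a2..b2}"
    and "\<exists>\<eta>>0. abs_integrable_deriv p u (a2 - \<eta>) (b2 + \<eta>)"
    and "expansion_left 0 u a K c \<gamma>"
    and "expansion_right 0 u b L d \<delta>"
    and "\<And>k. k \<ge> 1 \<Longrightarrow> expansion_left k u a K c \<gamma>"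
    and "\<And>k. k \<ge> 1 \<Longrightarrow> expansion_right k u b L d \<delta>"
    and "inj \<gamma>" "\<And>s. \<gamma> s \<noteq> -1" "incseq (\<lambda>s. Re (\<gamma> s))"
        "filterlim (\<lambda>s. Re (\<gamma> s)) at_top sequentially"
    and "inj \<delta>" "\<And>s. \<delta> s \<noteq> -1" "incseq (\<lambda>s. Re (\<delta> s))"
        "filterlim (\<lambda>s. Re (\<delta> s)) at_top sequentially"
    and h: "\<And>n. h n = (b - a) / real n"
  shows "\<exists>R :: real \<Rightarrow> complex.
    (\<lambda>t. norm (R t)) \<in> O[at_right 0](\<lambda>t. t ^ p) \<and>
    (\<forall>N. (\<lambda>n. norm (
            of_real (h n) * (\<Sum>j=1..<n. u (a + real j * h n))
            - finite_part u a b
            - R (h n)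
            - (K + L) * of_real (euler_mascheroni - ln (h n))
            - (\<Sum>s\<in>{s. s < N \<and> \<gamma> s \<notin> positive_even}.
                 c s * riemann_zeta (- \<gamma> s) * of_real (h n) powr (\<gamma> s + 1))
            - (\<Sum>s\<in>{s. s < N \<and> \<delta> s \<notin> positive_even}.
                 d s * riemann_zeta (- \<delta> s) * of_real (h n) powr (\<delta> s + 1))))
         \<in> O(\<lambda>n. h n powr (Re (\<gamma> N) + 1) + h n powr (Re (\<delta> N) + 1)))"
proof -
  note inc = \<open>incseq (\<lambda>s. Re (\<gamma> s))\<close> \<open>incseq (\<lambda>s. Re (\<delta> s))\<close>
    and top = \<open>filterlim (\<lambda>s. Re (\<gamma> s)) at_top sequentially\<close> \<open>filterlim (\<lambda>s. Re (\<delta> s)) at_top sequentially\<close>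
    and not_m1 = \<open>\<And>s. \<gamma> s \<noteq> -1\<close> \<open>\<And>s. \<delta> s \<noteq> -1\<close>
  have ab: "a < b" using assms by linarith
  have left: "expansion_left k u a K c \<gamma>" and right: "expansion_right k u b L d \<delta>" for k
    using assms(8-11) by (cases "k = 0"; simp)+
  have h_pos: "h n > 0" if "n \<ge> 1" for n using ab that by (simp add: h)
  have h_lim: "h \<longlonglongrightarrow> 0" unfolding h by (rule lim_const_over_n)
  define x where "x = (\<lambda>s n. c s * riemann_zeta (- \<gamma> s) * of_real (h n) powr (\<gamma> s + 1))"
  define y where "y = (\<lambda>s n. d s * riemann_zeta (- \<delta> s) * of_real (h n) powr (\<delta> s + 1))"
  \<comment> \<open>The discrepancy of truncation \<open>N\<close> before any remainder is
    subtracted; \<open>R\<close> has to match \<open>E N\<close> up to \<open>g N\<close> for every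
    \<open>N\<close>.\<close>
  define E where "E = (\<lambda>N n. of_real (h n) * (\<Sum>j=1..<n. u (a + real j * h n)) - finite_part u a b
    - (K + L) * of_real (euler_mascheroni - ln (h n)) - (\<Sum>s<N. x s n) - (\<Sum>s<N. y s n))"
  define g where "g = (\<lambda>N n. h n powr (Re (\<gamma> N) + 1) + h n powr (Re (\<delta> N) + 1))"

  \<comment> \<open>Past this index the omitted terms are of smaller order than h^p, so the
    truncation \<open>M\<close> decides the size of \<open>R\<close>.\<close>
  obtain M where M: "Re (\<gamma> M) > real p" "Re (\<delta> M) > real p"
  proof -
    have "\<forall>\<^sub>F s in sequentially. Re (\<gamma> s) > real p \<and> Re (\<delta> s) > real p"
      using top by (auto simp: filterlim_at_top_dense intro: eventually_conj)
    then show ?thesis using that by (auto simp: eventually_at_top_linorder)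
  qed
  have E_M: "E M \<in> O(\<lambda>n. of_real (h n ^ p))"
  proof -
    obtain I where I: "has_finite_part u a b I"
      and O: "(\<lambda>n. of_real ((b - a) / real n) * (\<Sum>j=1..<n. u (a + real j * ((b - a) / real n))) - I
      - (\<Sum>s<Suc M. case_nat K c s * singular_term (case_nat (-1) \<gamma> s) ((b - a) / real n))
      - (\<Sum>s<Suc M. case_nat L d s * singular_term (case_nat (-1) \<delta> s) ((b - a) / real n)))
      \<in> O(\<lambda>n. of_real (((b - a) / real n) ^ p))"
      using truncated_expansion[OF assms(1-7) left right M] by blast
    show ?thesis
      using O unfolding h[symmetric] singular_term_sum[OF not_m1(1)] singular_term_sum[OF not_m1(2)]
      by (simp add: E_def[abs_def] x_def y_def finite_part_eq[OF I] algebra_simps)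
  qed

  have E_diff: "\<exists>C. \<forall>N\<ge>M. \<forall>\<^sub>F n in sequentially. norm (E N n - E M n) \<le> C * g M n" for M
  proof -
    obtain C where C: "\<And>N. N \<ge> M \<Longrightarrow> \<forall>\<^sub>F n in sequentially. norm (\<Sum>s=M..<N. x s n) \<le> C * h n powr (Re (\<gamma> M) + 1)"
      using power_series_tail_bound[OF inc(1) top(1) h_lim h_pos, of M "\<lambda>s. c s * riemann_zeta (- \<gamma> s)"]
      unfolding x_def by blast
    obtain D where D: "\<And>N. N \<ge> M \<Longrightarrow> \<forall>\<^sub>F n in sequentially. norm (\<Sum>s=M..<N. y s n) \<le> D * h n powr (Re (\<delta> M) + 1)"
      using power_series_tail_bound[OF inc(2) top(2) h_lim h_pos, of M "\<lambda>s. d s * riemann_zeta (- \<delta> s)"]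
      unfolding y_def by blast
    show ?thesis
    proof (intro exI[of _ "max C D"] allI impI)
      fix N assume N: "M \<le> N"
      show "\<forall>\<^sub>F n in sequentially. norm (E N n - E M n) \<le> max C D * g M n"
        using C[OF N] D[OF N]
      proof eventually_elim
        case (elim n)
        have split: "(\<Sum>s<N. f s) = (\<Sum>s<M. f s) + (\<Sum>s=M..<N. f s)" for f :: "nat \<Rightarrow> complex"
          using sum.atLeastLessThan_concat[of 0 M N f] N by (simp add: atLeast0LessThan)
        have "E N n - E M n = - ((\<Sum>s=M..<N. x s n) + (\<Sum>s=M..<N. y s n))"
          by (simp add: E_def split)
        then have "norm (E N n - E M n) \<le> norm (\<Sum>s=M..<N. x s n) + norm (\<Sum>s=M..<N. y s n)"
          by (simp only: norm_minus_cancel norm_triangle_ineq)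
        also have "\<dots> \<le> max C D * h n powr (Re (\<gamma> M) + 1) + max C D * h n powr (Re (\<delta> M) + 1)"
          by (intro add_mono order_trans[OF elim(1)] order_trans[OF elim(2)] mult_right_mono) auto
        finally show ?case by (simp add: g_def distrib_left)
      qed
    qed
  qed
  obtain \<rho> where \<rho>: "\<And>N. \<exists>C. \<forall>\<^sub>F n in sequentially. norm (E N n - \<rho> n) \<le> C * g N n"
    using diagonal_approximation[of E g, OF E_diff] by blast

  \<comment> \<open>\<open>\<rho>\<close> differs from \<open>E M\<close> by O(g M), and both
    exponents in \<open>g M\<close> exceed \<open>p\<close>; hence it inherits the bound O(h^p) of
    \<open>E M\<close>.\<close>
  obtain C where C: "C \<ge> 0" "\<forall>\<^sub>F n in sequentially. norm (\<rho> n) \<le> C * h n ^ p"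
  proof -
    obtain C1 where C1: "\<forall>\<^sub>F n in sequentially. norm (E M n) \<le> C1 * norm (of_real (h n ^ p) :: complex)" "C1 > 0"
      using E_M by (elim landau_o.bigE) auto
    obtain C2 where C2: "\<forall>\<^sub>F n in sequentially. norm (E M n - \<rho> n) \<le> C2 * g M n"
      using \<rho> by blast
    have "\<forall>\<^sub>F n in sequentially. \<bar>C2\<bar> * g M n \<le> 2 * \<bar>C2\<bar> * h n ^ p"
      unfolding g_def using M by (intro step_powr_sum_bigo h_lim h_pos) auto
    with C1(1) C2 have "\<forall>\<^sub>F n in sequentially. norm (\<rho> n) \<le> (C1 + 2 * \<bar>C2\<bar>) * h n ^ p"
      using eventually_ge_at_top[of 1]
    proof eventually_elim
      case (elim n)
      have "norm (of_real (h n ^ p) :: complex) = h n ^ p"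
        unfolding norm_of_real using h_pos[OF elim(4)] by simp
      moreover have "norm (\<rho> n) \<le> norm (E M n) + norm (E M n - \<rho> n)"
        by (metis norm_minus_commute norm_triangle_sub)
      moreover have "C2 * g M n \<le> \<bar>C2\<bar> * g M n"
        by (intro mult_right_mono) (auto simp: g_def)
      ultimately show ?case using elim by (simp add: distrib_right)
    qed
    then show ?thesis using that[of "C1 + 2 * \<bar>C2\<bar>"] C1(2) by simp
  qed

  \<comment> \<open>\<open>\<rho>\<close> depends on \<open>n\<close>, whereas the remainder must be
    a function of a real step. As \<open>h\<close> is injective on positive indices,
    \<open>\<rho>\<close> is transported to the sample points; elsewhere the value is 0.\<close>
  define R where "R = (\<lambda>t. if \<exists>n\<ge>1. t = h n then \<rho> (SOME n. n \<ge> 1 \<and> t = h n) else 0)"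
  have R_h: "R (h n) = \<rho> n" if "n \<ge> 1" for n
  proof -
    have "(SOME m. m \<ge> 1 \<and> h n = h m) = n"
      using that ab by (intro some_equality) (auto simp: h field_simps)
    then show ?thesis using that by (auto simp: R_def)
  qed
  have "(\<lambda>t. norm (R t)) \<in> O[at_right 0](\<lambda>t. t ^ p)"
  proof (rule bigoI)
    obtain n0 where n0: "\<And>n. n \<ge> n0 \<Longrightarrow> norm (\<rho> n) \<le> C * h n ^ p"
      using C(2) by (auto simp: eventually_at_top_linorder)
    \<comment> \<open>A sample point below \<open>h (max 1 n0)\<close> has index above
      \<open>n0\<close>, since \<open>h\<close> decreases. The maximum with 1 avoids
      \<open>h 0\<close>, which is 0.\<close>
    have "\<forall>\<^sub>F t in at_right 0. 0 < t \<and> t < h (max 1 n0)"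
      using h_pos[of "max 1 n0"] by (intro eventually_at_rightI[of 0 "h (max 1 n0)"]) auto
    then show "\<forall>\<^sub>F t in at_right 0. norm (norm (R t)) \<le> C * norm (t ^ p)"
    proof eventually_elim
      case (elim t)
      show ?case
      proof (cases "\<exists>n\<ge>1. t = h n")
        case True
        then obtain n where n: "n \<ge> 1" "t = h n" by blast
        have "max 1 n0 < n"
        proof (rule ccontr)
          assume "\<not> max 1 n0 < n"
          then have "h (max 1 n0) \<le> h n"
            using ab n(1) unfolding h by (intro divide_left_mono) auto
          then show False using elim n by simp
        qed
        then show ?thesis using n0[of n] n elim by (simp add: R_h)
      next
        case False
        then have "R t = 0" unfolding R_def by (rule if_not_P)
        then show ?thesis using C(1) elim by simp
      qed
    qed
  qed
  moreover have "(\<lambda>n. norm (of_real (h n) * (\<Sum>j=1..<n. u (a + real j * h n))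
            - finite_part u a b
            - R (h n)
            - (K + L) * of_real (euler_mascheroni - ln (h n))
            - (\<Sum>s\<in>{s. s < N \<and> \<gamma> s \<notin> positive_even}.
                 c s * riemann_zeta (- \<gamma> s) * of_real (h n) powr (\<gamma> s + 1))
            - (\<Sum>s\<in>{s. s < N \<and> \<delta> s \<notin> positive_even}.
                 d s * riemann_zeta (- \<delta> s) * of_real (h n) powr (\<delta> s + 1))))
         \<in> O(\<lambda>n. h n powr (Re (\<gamma> N) + 1) + h n powr (Re (\<delta> N) + 1))" for N
  proof -
    obtain C where C: "\<forall>\<^sub>F n in sequentially. norm (E N n - \<rho> n) \<le> C * g N n" using \<rho> by blast
    have "\<forall>\<^sub>F n in sequentially. norm (norm (of_real (h n) * (\<Sum>j=1..<n. u (a + real j * h n)) - finite_part u a b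
        - R (h n) - (K + L) * of_real (euler_mascheroni - ln (h n)) - (\<Sum>s<N. x s n) - (\<Sum>s<N. y s n)))
        \<le> C * norm (g N n)"
      using C eventually_ge_at_top[of 1]
    proof eventually_elim
      case (elim n)
      have "norm (g N n) = g N n" by (simp add: g_def)
      moreover have "of_real (h n) * (\<Sum>j=1..<n. u (a + real j * h n)) - finite_part u a b - R (h n)
            - (K + L) * of_real (euler_mascheroni - ln (h n)) - (\<Sum>s<N. x s n) - (\<Sum>s<N. y s n) = E N n - \<rho> n"
        unfolding E_def R_h[OF elim(2)] by (simp only: diff_diff_eq add_ac)
      ultimately show ?case using elim(1) by (simp only: real_norm_def abs_norm_cancel)
    qed
    then show ?thesis unfolding sum_omit_trivial_zeros x_def y_def g_def by (rule bigoI)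
  qed
  ultimately show ?thesis by blast
qed

end
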